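(* Let $T,c,\sigma>0$ and let $R:\mathbb{R}\times[0,1]\to\mathbb{R}$ be bounded, continuous, and non-decreasing in both arguments. Let $\Phi:\mathcal{P}(\mathbb{R})\to\mathcal{P}(\mathbb{R})$ be the map $\Phi(\mu)=\mathcal{L}(X^\mu_T)$, the law at time $T$ of the optimally controlled state process $X^\mu$ given by $$dX_t=\frac{v_x(t,X_t;\mu)}{2c}\,dt+\sigma\,dB_t,\qquad X_0=0,$$ where $v(\cdot,\cdot;\mu)$ is the value function defined in the context. Then $\Phi$ has a fixed point, i.e. there is $\mu\in\mathcal{P}(\mathbb{R})$ with $\Phi(\mu)=\mu$.
   Context: $\mathcal{P}(\mathbb{R})$ is the set of Borel probability measures on $\mathbb{R}$; for $\mu\in\mathcal{P}(\mathbb{R})$, $F_\mu(x)=\mu(-\infty,x]$ and $R_\mu(x):=R(x,F_\mu(x))$. $B$ is a standard Brownian motion. For $\mu\in\mathcal{P}(\mathbb{R})$ the value function is $$v(t,x;\mu):=\sup_a \mathbb{E}_{t,x}\Big[R_\mu(X_T)-\int_t^T c\,a_s^2\,ds\Big],\qquad dX_s=a_s\,ds+\sigma\,dB_s,\ X_t=x,$$ where $a$ ranges over progressively measurable processes with $\mathbb{E}\int_0^T|a_s|ds<\infty$. Explicitly, $v=2c\sigma^2\log u$ with $u(t,x;\mu)=\mathbb{E}\big[\exp\big(\tfrac{1}{2c\sigma^2}R_\mu(x+\sigma\sqrt{T-t}\,Z)\big)\big]$, $Z$ standard normal; $v$ is smooth in $x$ for $t<T$, and $v_x$ is its $x$-derivative.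 The SDE for $X^\mu$ has a strong solution on $[0,T)$, and $X^\mu_T$ denotes its (existing) limit as $t\to T$. $\mathcal{L}(\cdot)$ denotes the law of a random variable. *)

theory Defs
  imports "HOL-Probability.Probability"
begin

text \<open>
  Time is indexed by \<^typ>\<open>real\<close>; only nonnegative times matter. (A filtration over
  nonnegative times extends to all reals by freezing it at time zero.) No completeness or
  right-continuity of the filtration is assumed, so in particular \<open>F\<close> may be the
  filtration generated by \<open>B\<close>.
\<close>

definition brownian_motion ::
    "'w measure \<Rightarrow> (real \<Rightarrow> 'w measure) \<Rightarrow> (real \<Rightarrow> 'w \<Rightarrow> real) \<Rightarrow> bool" where
  "brownian_motion M F B \<longleftrightarrow>
     prob_space M \<and> filtration (space M) F \<and> (\<forall>t\<ge>0. sets (F t) \<subseteq> sets M) \<and>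
     (\<forall>t\<ge>0. B t \<in> borel_measurable (F t)) \<and>
     (\<forall>\<omega>\<in>space M. continuous_on {0..} (\<lambda>t. B t \<omega>)) \<and>
     (AE \<omega> in M. B 0 \<omega> = 0) \<and>
     (\<forall>s t. 0 \<le> s \<and> s < t \<longrightarrow>
        distributed M lborel (\<lambda>\<omega>. B t \<omega> - B s \<omega>) (normal_density 0 (sqrt (t - s))) \<and>
        prob_space.indep_set M (sets (F s))
          {(\<lambda>\<omega>. B t \<omega> - B s \<omega>) -` A \<inter> space M | A. A \<in> sets borel})"

definition progressively_measurable ::
    "(real \<Rightarrow> 'w measure) \<Rightarrow> real \<Rightarrow> (real \<Rightarrow> 'w \<Rightarrow> real) \<Rightarrow> bool" where
  "progressively_measurable F T a \<longleftrightarrow>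
     (\<forall>t\<in>{0..T}. (\<lambda>(s, \<omega>). a s \<omega>) \<in> borel_measurable (restrict_space borel {0..t} \<Otimes>\<^sub>M F t))"

definition controls ::
    "'w measure \<Rightarrow> (real \<Rightarrow> 'w measure) \<Rightarrow> real \<Rightarrow> (real \<Rightarrow> 'w \<Rightarrow> real) set" where
  "controls M F T =
     {a. progressively_measurable F T a \<and>
         (\<integral>\<^sup>+\<omega>. (\<integral>\<^sup>+s\<in>{0..T}. ennreal \<bar>a s \<omega>\<bar> \<partial>lborel) \<partial>M) < \<infinity>}"

definition rank_reward :: "(real \<Rightarrow> real \<Rightarrow> real) \<Rightarrow> real measure \<Rightarrow> real \<Rightarrow> real" where
  "rank_reward R \<mu> x = R x (cdf \<mu> x)"

text \<open>The state at time \<open>r\<close> when started from \<open>x\<close> at time \<open>t\<close>: since the noise is additive,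
  the controlled SDE is the pathwise integral equation.\<close>

definition controlled_state ::
    "(real \<Rightarrow> 'w \<Rightarrow> real) \<Rightarrow> real \<Rightarrow> real \<Rightarrow> real \<Rightarrow> (real \<Rightarrow> 'w \<Rightarrow> real) \<Rightarrow> real \<Rightarrow> 'w \<Rightarrow> real" where
  "controlled_state B \<sigma> t x a r \<omega> =
     x + (LINT s:{t..r}|lborel. a s \<omega>) + \<sigma> * (B r \<omega> - B t \<omega>)"

text \<open>The cost is a Lebesgue integral with values in the extended nonnegative reals, so that a
  control of infinite energy has payoff \<open>-\<infinity>\<close> (a Bochner integral would give it cost \<open>0\<close>).\<close>

definition payoff ::
    "'w measure \<Rightarrow> (real \<Rightarrow> 'w \<Rightarrow> real) \<Rightarrow> real \<Rightarrow> real \<Rightarrow> real \<Rightarrow> (real \<Rightarrow> real \<Rightarrow> real) \<Rightarrow>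
     real measure \<Rightarrow> real \<Rightarrow> real \<Rightarrow> (real \<Rightarrow> 'w \<Rightarrow> real) \<Rightarrow> ereal" where
  "payoff M B T c \<sigma> R \<mu> t x a =
     ereal (\<integral>\<omega>. rank_reward R \<mu> (controlled_state B \<sigma> t x a T \<omega>) \<partial>M)
     - enn2ereal (\<integral>\<^sup>+\<omega>. (\<integral>\<^sup>+s\<in>{t..T}. ennreal (c * (a s \<omega>)\<^sup>2) \<partial>lborel) \<partial>M)"

text \<open>For bounded \<open>R\<close> the supremum is finite: the zero control bounds it from below.\<close>

definition value_fun ::
    "'w measure \<Rightarrow> (real \<Rightarrow> 'w measure) \<Rightarrow> (real \<Rightarrow> 'w \<Rightarrow> real) \<Rightarrow> real \<Rightarrow> real \<Rightarrow> real \<Rightarrow>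
     (real \<Rightarrow> real \<Rightarrow> real) \<Rightarrow> real measure \<Rightarrow> real \<Rightarrow> real \<Rightarrow> real" where
  "value_fun M F B T c \<sigma> R \<mu> t x =
     real_of_ereal (SUP a\<in>controls M F T. payoff M B T c \<sigma> R \<mu> t x a)"

definition optimal_drift ::
    "'w measure \<Rightarrow> (real \<Rightarrow> 'w measure) \<Rightarrow> (real \<Rightarrow> 'w \<Rightarrow> real) \<Rightarrow> real \<Rightarrow> real \<Rightarrow> real \<Rightarrow>
     (real \<Rightarrow> real \<Rightarrow> real) \<Rightarrow> real measure \<Rightarrow> real \<Rightarrow> real \<Rightarrow> real" where
  "optimal_drift M F B T c \<sigma> R \<mu> t x =
     deriv (\<lambda>y. value_fun M F B T c \<sigma> R \<mu> t y) x / (2 * c)"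

definition optimal_state ::
    "'w measure \<Rightarrow> (real \<Rightarrow> 'w measure) \<Rightarrow> (real \<Rightarrow> 'w \<Rightarrow> real) \<Rightarrow> real \<Rightarrow> real \<Rightarrow> real \<Rightarrow>
     (real \<Rightarrow> real \<Rightarrow> real) \<Rightarrow> real measure \<Rightarrow> (real \<Rightarrow> 'w \<Rightarrow> real) \<Rightarrow> bool" where
  "optimal_state M F B T c \<sigma> R \<mu> X \<longleftrightarrow>
     (\<forall>t\<in>{0..<T}. X t \<in> borel_measurable (F t)) \<and>
     (\<forall>\<omega>\<in>space M. continuous_on {0..<T} (\<lambda>t. X t \<omega>)) \<and>
     (AE \<omega> in M. X 0 \<omega> = 0 \<and>
        (\<forall>t\<in>{0..<T}.
           set_integrable lborel {0..t} (\<lambda>s. optimal_drift M F B T c \<sigma> R \<mu> s (X s \<omega>)) \<and>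
           X t \<omega> = (LINT s:{0..t}|lborel. optimal_drift M F B T c \<sigma> R \<mu> s (X s \<omega>))
                     + \<sigma> * B t \<omega>))"

definition is_terminal_law ::
    "'w measure \<Rightarrow> (real \<Rightarrow> 'w measure) \<Rightarrow> (real \<Rightarrow> 'w \<Rightarrow> real) \<Rightarrow> real \<Rightarrow> real \<Rightarrow> real \<Rightarrow>
     (real \<Rightarrow> real \<Rightarrow> real) \<Rightarrow> real measure \<Rightarrow> real measure \<Rightarrow> bool" where
  "is_terminal_law M F B T c \<sigma> R \<mu> \<nu> \<longleftrightarrow>
     (\<exists>X X\<^sub>T. optimal_state M F B T c \<sigma> R \<mu> X \<and> X\<^sub>T \<in> borel_measurable M \<and>
        (AE \<omega> in M. ((\<lambda>t. X t \<omega>) \<longlongrightarrow> X\<^sub>T \<omega>) (at_left T)) \<and>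
        \<nu> = distr M borel X\<^sub>T)"

text \<open>Where the law of the terminal state is not well defined, the value is the null measure.
  That is not a probability measure, so a fixed point among the probability measures is
  always a genuine one.\<close>

definition terminal_law_map ::
    "'w measure \<Rightarrow> (real \<Rightarrow> 'w measure) \<Rightarrow> (real \<Rightarrow> 'w \<Rightarrow> real) \<Rightarrow> real \<Rightarrow> real \<Rightarrow> real \<Rightarrow>
     (real \<Rightarrow> real \<Rightarrow> real) \<Rightarrow> real measure \<Rightarrow> real measure" where
  "terminal_law_map M F B T c \<sigma> R \<mu> =
     (if \<exists>!\<nu>. is_terminal_law M F B T c \<sigma> R \<mu> \<nu>
      then THE \<nu>. is_terminal_law M F B T c \<sigma> R \<mu> \<nu>
      else null_measure borel)"

end

theory Submission
  imports Defs
begin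

text \<open>
  Put \<open>\<phi> = R\<^sub>\<mu> / (2 c \<sigma>\<^sup>2)\<close>, so that \<open>v = 2 c \<sigma>\<^sup>2 \<psi>\<close> with \<open>\<psi> = ln u\<close>. No stochastic calculus is
  used. Over a time step of length \<open>\<delta>\<close> a second-order cumulant expansion gives
  \<open>\<psi>(s, x) = E [\<psi>(s + \<delta>, x + \<sigma> \<Delta>B) + \<sigma>\<^sup>2 \<delta> \<psi>\<^sub>x(s + \<delta>, x + \<sigma> \<Delta>B)\<^sup>2 / 2] + O(\<delta> sqrt \<delta>)\<close>, and
  completing the square in the displacement caused by the control turns this into the upper bound for
  every control and, for the feedback control \<open>\<sigma>\<^sup>2 \<psi>\<^sub>x\<close>, into the matching lower bound.

  As the upper bound holds for every reward and a solution \<open>X\<close> of the state equation is optimal for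
  \<open>\<phi>\<close>, perturbing \<open>\<phi>\<close> to \<open>\<phi> + \<eta> h\<close> identifies the law of \<open>X\<^sub>T\<close>: its density with respect to
  \<open>N(0, \<sigma>\<^sup>2 T)\<close> is \<open>exp \<phi>\<close> up to normalisation. Hence \<open>\<Phi>(\<mu>) = \<mu>\<close> becomes a scalar equation for
  the distribution function of \<open>\<mu>\<close>, solved by an Euler scheme, the intermediate value theorem for the
  normalising constant, and Helly's selection theorem. Only \<open>\<mu>\<close> with a continuous distribution
  function occur, so \<open>R\<^sub>\<mu>\<close> is continuous and, being bounded and monotone, uniformly continuous.
\<close>

section \<open>Gaussian smoothing\<close>

text \<open>The bound on \<open>psi_deriv\<close> degenerates like \<open>1 / sqrt (T - t)\<close>
  at the horizon. Estimates over a time step are therefore made on intervals ending at some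
  \<open>T - e\<close>, where one constant controls \<open>psi\<close> and its derivatives, and
  \<open>T\<close> is reached by a limit uniform in space; this is what uniform continuity of \<phi>
  provides. An error of \<delta> sqrt \<delta> per step is affordable, since (b - a) / \<delta>
  steps add up to (b - a) sqrt \<delta>.

  The terminal law comes from a tangency argument: with Eh the mean of h at the terminal state and
  S(\<eta>) the Gaussian mean of exp (\<phi> + \<eta> h), \<eta> Eh lies below ln S(\<eta>) - ln
  S(0) for \<eta> of both signs, with equality at 0. So Eh is the logarithmic derivative of S at 0.

  What remains for the fixed point is F(x) = 1/Z times the integral of exp (R(y, F(y)) / (2 c
  \<sigma>^2)) over y <= x with respect to N(0, \<sigma>^2 T): an initial value problem started at
  minus infinity, with Z to be chosen so that the total mass is 1. As R is merely continuous in the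
  rank, compactness takes the place of a contraction, and Z is found by shooting.\<close>

definition gauss_smooth :: "real \<Rightarrow> (real \<Rightarrow> real) \<Rightarrow> real \<Rightarrow> real" where
  "gauss_smooth s f x = (LINT z|std_normal_distribution. f (x + s * z))"

definition abs_moment :: "nat \<Rightarrow> real" where
  "abs_moment k = (LINT z|std_normal_distribution. \<bar>z\<bar> ^ k)"

interpretation std_normal: real_distribution std_normal_distribution
  by (rule real_dist_normal_dist)

text \<open>Completing the square turns the integrand into \<open>exp (a^2/2)\<close> times the
  normal density with mean \<open>a\<close>.\<close>

lemma integrable_std_normal_exp: "integrable std_normal_distribution (\<lambda>z. exp (a * z))"
proof -
  have "integrable lborel (\<lambda>z. exp (a^2/2) * normal_density a 1 z)"
    by (intro integrable_mult_right integrable_normal_density) auto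
  also have "(\<lambda>z. exp (a^2/2) * normal_density a 1 z) = (\<lambda>z. std_normal_density z *\<^sub>R exp (a * z))"
    by (auto simp: fun_eq_iff normal_density_def exp_add[symmetric] power2_eq_square field_simps)
  finally show ?thesis
    by (subst integrable_density) auto
qed

lemma integrable_std_normal_abs_moment [simp]:
  "integrable std_normal_distribution (\<lambda>z. \<bar>z\<bar> ^ k)"
  by (subst integrable_density) (auto simp: integrable_std_normal_moment_abs)

lemma integrable_std_normal_moment' [simp]:
  "integrable std_normal_distribution (\<lambda>z. z ^ k)"
  by (subst integrable_density) (auto simp: integrable_std_normal_moment)

lemma integrable_std_normal_ident [simp]: "integrable std_normal_distribution (\<lambda>z. z)"
  using integrable_std_normal_moment'[of 1] by simp

lemma integrable_std_normal_abs [simp]: "integrable std_normal_distribution (\<lambda>z. \<bar>z\<bar>)"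
  using integrable_std_normal_abs_moment[of 1] by simp

lemma integral_std_normal_ident [simp]: "(LINT z|std_normal_distribution. z) = 0"
  using integral_std_normal_distribution_moment_odd[of 1] by simp

lemma integral_std_normal_square [simp]: "(LINT z|std_normal_distribution. z\<^sup>2) = 1"
  using std_normal_distribution_even_moments(1)[of 1] by simp

lemma abs_moment_nonneg: "0 \<le> abs_moment k"
  unfolding abs_moment_def by (intro integral_nonneg_AE) auto

text \<open>A single term of the exponential series gives
  \<open>\<bar>z\<bar> ^ k \<le> fact k * exp \<bar>z\<bar>\<close>, and
  \<open>exp ((a + 1) * \<bar>z\<bar>)\<close> is at most the sum of the two exponentials without
  absolute value.\<close>

lemma integrable_std_normal_poly_exp:
  assumes "a \<ge> 0"
  shows "integrable std_normal_distribution (\<lambda>z. \<bar>z\<bar> ^ k * exp (a * \<bar>z\<bar>))"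
proof -
  have int: "integrable std_normal_distribution (\<lambda>z. fact k * (exp ((a + 1) * z) + exp (-(a + 1) * z)))"
    using integrable_std_normal_exp[of "a + 1"] integrable_std_normal_exp[of "-(a + 1)"]
    by (intro integrable_mult_right Bochner_Integration.integrable_add) auto
  have "norm (\<bar>z\<bar> ^ k * exp (a * \<bar>z\<bar>)) \<le> norm (fact k * (exp ((a + 1) * z) + exp (-(a + 1) * z)))"
    for z :: real
  proof -
    have "\<bar>z\<bar> ^ k / fact k \<le> exp \<bar>z\<bar>"
      using sum_le_suminf[OF summable_exp_generic[of "\<bar>z\<bar>"], of "{k}"]
      by (simp add: exp_def divide_inverse_commute)
    then have "\<bar>z\<bar> ^ k \<le> fact k * exp \<bar>z\<bar>"
      by (simp add: field_simps)
    then have "\<bar>z\<bar> ^ k * exp (a * \<bar>z\<bar>) \<le> fact k * (exp \<bar>z\<bar> * exp (a * \<bar>z\<bar>))"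
      by (simp add: mult.assoc[symmetric] mult_right_mono)
    also have "exp \<bar>z\<bar> * exp (a * \<bar>z\<bar>) = exp ((a + 1) * \<bar>z\<bar>)"
      by (simp add: exp_add[symmetric] algebra_simps)
    also have "\<dots> \<le> exp ((a + 1) * z) + exp (-(a + 1) * z)"
      by (cases "z \<ge> 0") (auto simp: algebra_simps add_increasing)
    finally show ?thesis
      by (simp add: abs_mult mult_left_mono)
  qed
  then show ?thesis
    by (intro Bochner_Integration.integrable_bound[OF int]) auto
qed

lemma gauss_smooth_integrable:
  fixes f :: "real \<Rightarrow> real"
  assumes [measurable]: "f \<in> borel_measurable borel" and "\<And>x. \<bar>f x\<bar> \<le> K"
  shows "integrable std_normal_distribution (\<lambda>z. f (x + s * z))"
  by (rule std_normal.integrable_const_bound[where B=K]) (use assms in auto)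

lemma gauss_smooth_moment_integrable:
  fixes f :: "real \<Rightarrow> real"
  assumes [measurable]: "f \<in> borel_measurable borel" and "\<And>x. \<bar>f x\<bar> \<le> K"
  shows "integrable std_normal_distribution (\<lambda>z. f (x + s * z) * z)"
proof (rule Bochner_Integration.integrable_bound)
  show "integrable std_normal_distribution (\<lambda>z. K * \<bar>z\<bar>)" by simp
  have "0 \<le> K" using assms(2)[of 0] by linarith
  then show "AE z in std_normal_distribution. norm (f (x + s * z) * z) \<le> norm (K * \<bar>z\<bar>)"
    by (auto simp: abs_mult assms intro!: mult_right_mono)
qed simp

lemma gauss_smooth_measurable [measurable]:
  assumes [measurable]: "f \<in> borel_measurable borel"
  shows "gauss_smooth s f \<in> borel_measurable borel"
  unfolding gauss_smooth_def[abs_def] by measurable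

lemma gauss_smooth_zero [simp]: "gauss_smooth 0 f x = f x"
  using std_normal.prob_space by (simp add: gauss_smooth_def)

lemma gauss_smooth_mono:
  assumes "f \<in> borel_measurable borel" "\<And>x. \<bar>f x\<bar> \<le> K"
    and "g \<in> borel_measurable borel" "\<And>x. \<bar>g x\<bar> \<le> K'" and "\<And>x. f x \<le> g x"
  shows "gauss_smooth s f x \<le> gauss_smooth s g x"
  unfolding gauss_smooth_def
  by (intro integral_mono gauss_smooth_integrable[OF assms(1,2)] gauss_smooth_integrable[OF assms(3,4)] assms(5))

lemma gauss_smooth_const [simp]: "gauss_smooth s (\<lambda>_. a) x = a"
  using std_normal.prob_space by (simp add: gauss_smooth_def)

lemma gauss_smooth_bound:
  assumes [measurable]: "f \<in> borel_measurable borel" and "\<And>x. \<bar>f x\<bar> \<le> K"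
  shows "\<bar>gauss_smooth s f x\<bar> \<le> K"
proof -
  have "\<bar>gauss_smooth s f x\<bar> \<le> (LINT z|std_normal_distribution. \<bar>f (x + s * z)\<bar>)"
    unfolding gauss_smooth_def by (simp only: integral_abs_bound)
  also have "\<dots> \<le> (LINT z|std_normal_distribution. K)"
    by (intro integral_mono integrable_abs gauss_smooth_integrable[OF assms] assms(2)) auto
  finally show ?thesis using std_normal.prob_space by simp
qed

lemma gauss_smooth_add:
  assumes "f \<in> borel_measurable borel" "\<And>x. \<bar>f x\<bar> \<le> K"
    and "g \<in> borel_measurable borel" "\<And>x. \<bar>g x\<bar> \<le> K'"
  shows "gauss_smooth s (\<lambda>y. f y + g y) x = gauss_smooth s f x + gauss_smooth s g x"
  unfolding gauss_smooth_def
  by (intro Bochner_Integration.integral_add gauss_smooth_integrable[OF assms(1,2)] gauss_smooth_integrable[OF assms(3,4)])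

lemma gauss_smooth_cmult: "gauss_smooth s (\<lambda>y. a * f y) x = a * gauss_smooth s f x"
  unfolding gauss_smooth_def by simp

text \<open>The argument is displaced by \<open>s * z\<close>, whose mean size is
  \<open>abs_moment 1 * s\<close>. With \<open>s = \<sigma> * sqrt \<delta>\<close> this is the
  source of the square-root moduli in time.\<close>

lemma gauss_smooth_close:
  assumes [measurable]: "f \<in> borel_measurable borel" and "\<And>x. \<bar>f x\<bar> \<le> K"
    and "\<And>x y. \<bar>f x - f y\<bar> \<le> L * \<bar>x - y\<bar>" and "s \<ge> 0"
  shows "\<bar>gauss_smooth s f x - f x\<bar> \<le> L * abs_moment 1 * s"
proof -
  have "gauss_smooth s f x - f x = (LINT z|std_normal_distribution. f (x + s * z) - f x)"
    using std_normal.prob_space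
    by (simp add: gauss_smooth_def Bochner_Integration.integral_diff gauss_smooth_integrable[OF assms(1,2)])
  then have "\<bar>gauss_smooth s f x - f x\<bar> \<le> (LINT z|std_normal_distribution. \<bar>f (x + s * z) - f x\<bar>)"
    by (simp only: integral_abs_bound)
  also have "\<dots> \<le> (LINT z|std_normal_distribution. (L * s) * \<bar>z\<bar> ^ 1)"
  proof (intro integral_mono integrable_abs Bochner_Integration.integrable_diff gauss_smooth_integrable[OF assms(1,2)])
    show "\<bar>f (x + s * z) - f x\<bar> \<le> (L * s) * \<bar>z\<bar> ^ 1" for z
      using assms(3)[of "x + s * z" x] assms(4) by (simp add: abs_mult mult.assoc)
  qed auto
  also have "\<dots> = L * abs_moment 1 * s"
    unfolding abs_moment_def by simp
  finally show ?thesis .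
qed

text \<open>Off \<open>\<bar>s * z\<bar> < d\<close> the oscillation is at most \<open>2 * K * (s * z / d)\<^sup>2\<close>, which is integrable.\<close>

lemma gauss_smooth_uniform_limit:
  assumes [measurable]: "f \<in> borel_measurable borel" and bd: "\<And>x. \<bar>f x\<bar> \<le> K"
    and uc: "uniformly_continuous_on UNIV f" and "e > 0"
  shows "\<exists>s0>0. \<forall>s x. 0 \<le> s \<and> s < s0 \<longrightarrow> \<bar>gauss_smooth s f x - f x\<bar> \<le> e"
proof -
  obtain d where d: "d > 0" "\<And>x y. dist x y < d \<Longrightarrow> dist (f x) (f y) < e / 2"
    using uc \<open>e > 0\<close> unfolding uniformly_continuous_on_def by (metis UNIV_I half_gt_zero)
  have K: "0 \<le> K" using bd[of 0] by linarith
  have main: "\<bar>gauss_smooth s f x - f x\<bar> \<le> e / 2 + 2 * K * s\<^sup>2 / d\<^sup>2" for s x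
  proof -
    have "gauss_smooth s f x - f x = (LINT z|std_normal_distribution. f (x + s * z) - f x)"
      using std_normal.prob_space
      by (simp add: gauss_smooth_def Bochner_Integration.integral_diff gauss_smooth_integrable[OF assms(1,2)])
    then have "\<bar>gauss_smooth s f x - f x\<bar> \<le> (LINT z|std_normal_distribution. \<bar>f (x + s * z) - f x\<bar>)"
      by (simp only: integral_abs_bound)
    also have "\<dots> \<le> (LINT z|std_normal_distribution. e / 2 + (2 * K * s\<^sup>2 / d\<^sup>2) * z\<^sup>2)"
    proof (intro integral_mono integrable_abs Bochner_Integration.integrable_diff
        gauss_smooth_integrable[OF assms(1,2)])
      show "\<bar>f (x + s * z) - f x\<bar> \<le> e / 2 + (2 * K * s\<^sup>2 / d\<^sup>2) * z\<^sup>2" for z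
      proof (cases "\<bar>s * z\<bar> < d")
        case True
        then show ?thesis using d(2)[of "x + s * z" x] K
          by (auto simp: dist_real_def intro!: add_increasing2)
      next
        case False
        then have "1 \<le> (\<bar>s * z\<bar> / d)\<^sup>2"
          using d(1) by (intro one_le_power) simp
        then have "2 * K * 1 \<le> 2 * K * (s * z / d)\<^sup>2"
          using K by (intro mult_left_mono) (auto simp: power_divide)
        moreover have "\<bar>f (x + s * z) - f x\<bar> \<le> 2 * K"
          using bd[of "x + s * z"] bd[of x] by linarith
        ultimately show ?thesis using \<open>e > 0\<close> by (simp add: power_divide power_mult_distrib)
      qed
    qed auto
    also have "\<dots> = e / 2 + 2 * K * s\<^sup>2 / d\<^sup>2"
      using std_normal.prob_space by simp
    finally show ?thesis .
  qed
  have "((\<lambda>s. e / 2 + 2 * K * s\<^sup>2 / d\<^sup>2) \<longlongrightarrow> e / 2 + 2 * K * 0\<^sup>2 / d\<^sup>2) (at 0)"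
    using d(1) by (intro tendsto_intros) auto
  then have "eventually (\<lambda>s. e / 2 + 2 * K * s\<^sup>2 / d\<^sup>2 < e) (at 0)"
    using order_tendstoD(2)[of _ "e / 2" "at 0" e] \<open>e > 0\<close> by simp
  then obtain s0 where s0: "s0 > 0" "\<And>s. s \<noteq> 0 \<Longrightarrow> dist s 0 < s0 \<Longrightarrow> e / 2 + 2 * K * s\<^sup>2 / d\<^sup>2 < e"
    unfolding eventually_at by auto
  show ?thesis
  proof (intro exI[of _ s0] conjI allI impI)
    fix s x assume s: "0 \<le> s \<and> s < s0"
    show "\<bar>gauss_smooth s f x - f x\<bar> \<le> e"
    proof (cases "s = 0")
      case False
      then show ?thesis using main[of s x] s0(2)[of s] s by (simp add: dist_real_def)
    qed (use \<open>e > 0\<close> in simp)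
  qed (rule s0)
qed

text \<open>Integration by parts moves the derivative of \<open>f\<close> onto the Gaussian density.\<close>

definition gauss_smooth_deriv :: "real \<Rightarrow> (real \<Rightarrow> real) \<Rightarrow> real \<Rightarrow> real" where
  "gauss_smooth_deriv s f x = (LINT z|std_normal_distribution. f (x + s * z) * z) / s"

text \<open>The Cameron-Martin formula: moving the centre by \<open>s * h\<close> multiplies the
  Gaussian density by \<open>exp (h * z - h^2 / 2)\<close>. The dependence on \<open>h\<close> thus
  passes from \<open>f\<close> to a smooth factor.\<close>

lemma gauss_smooth_shift:
  assumes [measurable]: "f \<in> borel_measurable borel" and "s > 0"
  shows "gauss_smooth s f (x + s * h) = (LINT z|std_normal_distribution. f (x + s * z) * exp (h * z - h\<^sup>2 / 2))"
proof -
  have "gauss_smooth s f (x + s * h) = (\<integral>z. std_normal_density z * f (x + s * h + s * z) \<partial>lborel)"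
    unfolding gauss_smooth_def by (subst integral_density) auto
  also have "\<dots> = (\<integral>z. std_normal_density (-h + 1 * z) * f (x + s * h + s * (-h + 1 * z)) \<partial>lborel)"
    by (subst lborel_integral_real_affine[where c=1 and t="-h"]) auto
  also have "\<dots> = (\<integral>z. std_normal_density z * (f (x + s * z) * exp (h * z - h\<^sup>2 / 2)) \<partial>lborel)"
  proof (intro Bochner_Integration.integral_cong refl)
    fix z :: real
    have "std_normal_density (-h + 1 * z) = std_normal_density z * exp (h * z - h\<^sup>2 / 2)"
      by (simp add: std_normal_density_def exp_add[symmetric] power2_eq_square field_simps)
    then show "std_normal_density (-h + 1 * z) * f (x + s * h + s * (-h + 1 * z)) =
      std_normal_density z * (f (x + s * z) * exp (h * z - h\<^sup>2 / 2))"
      by (simp add: algebra_simps)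
  qed
  also have "\<dots> = (LINT z|std_normal_distribution. f (x + s * z) * exp (h * z - h\<^sup>2 / 2))"
    by (subst integral_density) auto
  finally show ?thesis .
qed

lemma abs_exp_minus_one_minus_le:
  fixes w :: real shows "\<bar>exp w - 1 - w\<bar> \<le> w\<^sup>2 * exp \<bar>w\<bar>"
proof -
  have "\<bar>exp w - (\<Sum>i\<le>1. w^i / fact i)\<bar> \<le> exp \<bar>w\<bar> * (\<bar>w\<bar> ^ Suc 1) / fact 1"
    using Taylor_exp_field[of w 1] by simp
  then show ?thesis
    by (simp add: power2_eq_square algebra_simps)
qed

text \<open>By the shift formula only the factor \<open>exp (h * z - h^2 / 2)\<close> depends on the
  increment. It equals \<open>1 + h * z\<close> up to \<open>h^2\<close> times an integrable
  function of \<open>z\<close>, and the linear term integrates to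
  \<open>gauss_smooth_deriv\<close>.\<close>

lemma gauss_smooth_has_deriv:
  assumes [measurable]: "f \<in> borel_measurable borel" and bd: "\<And>x. \<bar>f x\<bar> \<le> K" and "s > 0"
  shows "(gauss_smooth s f has_field_derivative gauss_smooth_deriv s f x) (at x)"
proof -
  have K: "0 \<le> K" using bd[of 0] by linarith
  \<comment> \<open>An integrable majorant valid for all \<open>\<bar>h\<bar> \<le> 1\<close>: the
    exponent is at most \<open>\<bar>h\<bar> * (\<bar>z\<bar> + 1)\<close> in absolute value, and
    the summand 1 absorbs the \<open>h^2 / 2\<close> by which it differs from
    \<open>h * z\<close>.\<close>
  define J where "J z = 1 + (\<bar>z\<bar> + 1)\<^sup>2 * exp (\<bar>z\<bar> + 1)" for z :: real
  have J_int: "integrable std_normal_distribution J"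
  proof -
    have "J = (\<lambda>z. 1 + exp 1 * (\<bar>z\<bar>^2 * exp (1 * \<bar>z\<bar>) + 2 * (\<bar>z\<bar>^1 * exp (1 * \<bar>z\<bar>)) + \<bar>z\<bar>^0 * exp (1 * \<bar>z\<bar>)))"
      by (auto simp: fun_eq_iff J_def exp_add power2_eq_square algebra_simps)
    moreover have *: "integrable std_normal_distribution (\<lambda>z. \<bar>z\<bar> ^ k * exp (1 * \<bar>z\<bar>))" for k
      by (rule integrable_std_normal_poly_exp) simp
    ultimately show ?thesis
      using *[of 0] *[of 1] *[of 2] by simp
  qed
  define C where "C = K * integral\<^sup>L std_normal_distribution J"
  have est: "\<bar>gauss_smooth s f (x + s * h) - gauss_smooth s f x - (s * h) * gauss_smooth_deriv s f x\<bar> \<le> C * h\<^sup>2"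
    if h: "\<bar>h\<bar> \<le> 1" for h
  proof -
    have pt: "\<bar>exp (h * z - h\<^sup>2 / 2) - 1 - h * z\<bar> \<le> h\<^sup>2 * J z" for z
    proof -
      let ?w = "h * z - h\<^sup>2 / 2"
      have "\<bar>?w\<bar> \<le> \<bar>h\<bar> * \<bar>z\<bar> + \<bar>h\<bar> * \<bar>h\<bar> / 2"
        using abs_triangle_ineq4[of "h * z" "h\<^sup>2/2"] by (simp add: abs_mult power2_eq_square)
      also have "\<dots> \<le> \<bar>h\<bar> * (\<bar>z\<bar> + 1)"
        using h mult_left_mono[of "\<bar>h\<bar>" 2 "\<bar>h\<bar>"] by (simp add: algebra_simps)
      finally have w: "\<bar>?w\<bar> \<le> \<bar>h\<bar> * (\<bar>z\<bar> + 1)" .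
      then have w2: "\<bar>?w\<bar> \<le> \<bar>z\<bar> + 1"
        using mult_right_mono[OF h, of "\<bar>z\<bar> + 1"] by simp
      have w3: "?w\<^sup>2 \<le> h\<^sup>2 * (\<bar>z\<bar> + 1)\<^sup>2"
        using power_mono[OF w, of 2] by (simp add: power_mult_distrib)
      have "\<bar>exp ?w - 1 - h * z\<bar> \<le> \<bar>exp ?w - 1 - ?w\<bar> + h\<^sup>2 / 2"
        using abs_triangle_ineq4[of "exp ?w - 1 - ?w" "h\<^sup>2 / 2"] by simp
      also have "\<dots> \<le> ?w\<^sup>2 * exp \<bar>?w\<bar> + h\<^sup>2"
        using abs_exp_minus_one_minus_le[of ?w] zero_le_power2[of h] by linarith
      also have "?w\<^sup>2 * exp \<bar>?w\<bar> \<le> (h\<^sup>2 * (\<bar>z\<bar> + 1)\<^sup>2) * exp (\<bar>z\<bar> + 1)"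
        by (intro mult_mono w3) (use w2 in auto)
      finally show ?thesis by (simp add: J_def algebra_simps)
    qed
    have int1: "integrable std_normal_distribution (\<lambda>z. f (x + s * z) * exp (h * z - h\<^sup>2 / 2))"
    proof (rule Bochner_Integration.integrable_bound)
      show "integrable std_normal_distribution (\<lambda>z. K * exp (- h\<^sup>2 / 2) * exp (h * z))"
        by (intro integrable_mult_right integrable_std_normal_exp)
      have "\<bar>f (x + s * z)\<bar> * exp (h * z - h\<^sup>2 / 2) \<le> K * (exp (- h\<^sup>2 / 2) * exp (h * z))" for z
        using bd[of "x + s * z"] by (simp add: exp_add[symmetric] add.commute mult_right_mono)
      then show "AE z in std_normal_distribution.
        norm (f (x + s * z) * exp (h * z - h\<^sup>2 / 2)) \<le> norm (K * exp (- h\<^sup>2 / 2) * exp (h * z))"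
        using K by (simp add: abs_mult mult.assoc)
    qed simp
    note int2 = gauss_smooth_integrable[OF assms(1,2), of x s]
    note int3 = integrable_mult_left[OF gauss_smooth_moment_integrable[OF assms(1,2), of x s], of h]
    have "gauss_smooth s f (x + s * h) - gauss_smooth s f x - (s * h) * gauss_smooth_deriv s f x
      = (LINT z|std_normal_distribution. f (x + s * z) * exp (h * z - h\<^sup>2 / 2))
        - (LINT z|std_normal_distribution. f (x + s * z)) - (LINT z|std_normal_distribution. f (x + s * z) * z * h)"
      unfolding gauss_smooth_shift[OF assms(1) \<open>s > 0\<close>] using \<open>s > 0\<close>
      by (simp add: gauss_smooth_def gauss_smooth_deriv_def)
    also have "\<dots> = (LINT z|std_normal_distribution. f (x + s * z) * exp (h * z - h\<^sup>2 / 2) - f (x + s * z) - f (x + s * z) * z * h)"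
      by (simp only: Bochner_Integration.integral_diff int1 int2 int3 Bochner_Integration.integrable_diff)
    finally have "\<bar>gauss_smooth s f (x + s * h) - gauss_smooth s f x - (s * h) * gauss_smooth_deriv s f x\<bar>
      \<le> (LINT z|std_normal_distribution. \<bar>f (x + s * z) * exp (h * z - h\<^sup>2 / 2) - f (x + s * z) - f (x + s * z) * z * h\<bar>)"
      by (simp only: integral_abs_bound)
    also have "\<dots> \<le> (LINT z|std_normal_distribution. (K * h\<^sup>2) * J z)"
    proof (rule integral_mono)
      show "integrable std_normal_distribution
        (\<lambda>z. \<bar>f (x + s * z) * exp (h * z - h\<^sup>2 / 2) - f (x + s * z) - f (x + s * z) * z * h\<bar>)"
        by (intro integrable_abs Bochner_Integration.integrable_diff int1 int2 int3)
      show "integrable std_normal_distribution (\<lambda>z. (K * h\<^sup>2) * J z)"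
        by (intro integrable_mult_right J_int)
      fix z
      have "\<bar>f (x + s * z) * exp (h * z - h\<^sup>2 / 2) - f (x + s * z) - f (x + s * z) * z * h\<bar>
        = \<bar>f (x + s * z)\<bar> * \<bar>exp (h * z - h\<^sup>2 / 2) - 1 - h * z\<bar>"
        by (simp add: abs_mult[symmetric] algebra_simps)
      also have "\<dots> \<le> K * (h\<^sup>2 * J z)"
        using pt[of z] bd[of "x + s * z"] K by (intro mult_mono) auto
      finally show "\<bar>f (x + s * z) * exp (h * z - h\<^sup>2 / 2) - f (x + s * z) - f (x + s * z) * z * h\<bar> \<le> (K * h\<^sup>2) * J z"
        by (simp add: mult.assoc)
    qed
    also have "\<dots> = C * h\<^sup>2" by (simp add: C_def)
    finally show ?thesis .
  qed
  have "C \<ge> 0" unfolding C_def J_def using K by (intro mult_nonneg_nonneg integral_nonneg_AE) auto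
  show ?thesis
    unfolding DERIV_def LIM_def
  proof (intro allI impI)
    fix e :: real assume "e > 0"
    \<comment> \<open>The first bound gives \<open>\<bar>k / s\<bar> \<le> 1\<close>, so that
      \<open>est\<close> applies with \<open>h = k / s\<close>; the second makes the remainder
      smaller than \<open>e\<close>. \<open>C + 1\<close> stands in for \<open>C\<close>, which may
      be 0.\<close>
    define d where "d = min s (e * s\<^sup>2 / (C + 1))"
    have "d > 0" using \<open>s > 0\<close> \<open>e > 0\<close> \<open>C \<ge> 0\<close> by (auto simp: d_def)
    have "dist ((gauss_smooth s f (x + k) - gauss_smooth s f x) / k) (gauss_smooth_deriv s f x) < e"
      if k: "k \<noteq> 0" "dist k 0 < d" for k
    proof -
      have k': "\<bar>k / s\<bar> \<le> 1" using k \<open>s > 0\<close> by (auto simp: d_def dist_real_def)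
      have "\<bar>gauss_smooth s f (x + k) - gauss_smooth s f x - k * gauss_smooth_deriv s f x\<bar> \<le> C * (k / s)\<^sup>2"
        using est[OF k'] \<open>s > 0\<close> by simp
      then have "\<bar>(gauss_smooth s f (x + k) - gauss_smooth s f x - k * gauss_smooth_deriv s f x) / k\<bar> \<le> C * (k / s)\<^sup>2 / \<bar>k\<bar>"
        by (simp add: divide_right_mono)
      also have "C * (k / s)\<^sup>2 / \<bar>k\<bar> = C / s\<^sup>2 * \<bar>k\<bar>"
        using k(1) by (simp add: power2_eq_square field_simps abs_if)
      also have "\<dots> \<le> (C + 1) / s\<^sup>2 * \<bar>k\<bar>"
        by (intro mult_right_mono divide_right_mono) auto
      also have "\<dots> < (C + 1) / s\<^sup>2 * (e * s\<^sup>2 / (C + 1))"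
        using k \<open>s > 0\<close> \<open>C \<ge> 0\<close> by (intro mult_strict_left_mono) (auto simp: d_def dist_real_def)
      also have "\<dots> = e" using \<open>s > 0\<close> \<open>C \<ge> 0\<close> by simp
      finally show ?thesis using k(1) by (simp add: dist_real_def diff_divide_distrib)
    qed
    then show "\<exists>d>0. \<forall>k. k \<noteq> 0 \<and> dist k 0 < d \<longrightarrow>
        dist ((gauss_smooth s f (x + k) - gauss_smooth s f x) / k) (gauss_smooth_deriv s f x) < e"
      using \<open>d > 0\<close> by blast
  qed
qed

lemma gauss_smooth_deriv_bound:
  assumes [measurable]: "f \<in> borel_measurable borel" and bd: "\<And>x. \<bar>f x\<bar> \<le> K" and "s > 0"
  shows "\<bar>gauss_smooth_deriv s f x\<bar> \<le> K * abs_moment 1 / s"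
proof -
  have "\<bar>LINT z|std_normal_distribution. f (x + s * z) * z\<bar> \<le> (LINT z|std_normal_distribution. \<bar>f (x + s * z) * z\<bar>)"
    by (simp only: integral_abs_bound)
  also have "\<dots> \<le> (LINT z|std_normal_distribution. K * \<bar>z\<bar> ^ 1)"
    by (intro integral_mono integrable_abs gauss_smooth_moment_integrable[OF assms(1,2)])
      (auto simp: abs_mult bd intro!: mult_right_mono)
  also have "\<dots> = K * abs_moment 1" by (simp add: abs_moment_def)
  finally show ?thesis
    using \<open>s > 0\<close> by (simp add: gauss_smooth_deriv_def divide_right_mono)
qed

lemma gauss_smooth_deriv_measurable [measurable]:
  assumes [measurable]: "f \<in> borel_measurable borel"
  shows "gauss_smooth_deriv s f \<in> borel_measurable borel"
  unfolding gauss_smooth_deriv_def[abs_def] by measurable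

lemma gauss_smooth_deriv_diff:
  assumes "f \<in> borel_measurable borel" "\<And>x. \<bar>f x\<bar> \<le> K"
    and "g \<in> borel_measurable borel" "\<And>x. \<bar>g x\<bar> \<le> K'"
  shows "gauss_smooth_deriv s (\<lambda>y. f y - g y) x = gauss_smooth_deriv s f x - gauss_smooth_deriv s g x"
  unfolding gauss_smooth_deriv_def left_diff_distrib
    diff_divide_distrib[symmetric]
  by (subst Bochner_Integration.integral_diff)
    (simp_all add: gauss_smooth_moment_integrable[OF assms(1,2)] gauss_smooth_moment_integrable[OF assms(3,4)])

text \<open>The difference of the two values is the smoothed derivative at 0 of
  \<open>\<lambda>z. f (x + z) - f (y + z)\<close>, a function bounded by
  \<open>L * \<bar>x - y\<bar>\<close>, so the bound on smoothed derivatives applies once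
  more.\<close>

lemma gauss_smooth_deriv_lipschitz:
  assumes [measurable]: "f \<in> borel_measurable borel" and "\<And>x. \<bar>f x\<bar> \<le> K"
    and lip: "\<And>x y. \<bar>f x - f y\<bar> \<le> L * \<bar>x - y\<bar>" and "s > 0"
  shows "\<bar>gauss_smooth_deriv s f x - gauss_smooth_deriv s f y\<bar> \<le> L * abs_moment 1 / s * \<bar>x - y\<bar>"
proof -
  have lip': "\<bar>f (x + z) - f (y + z)\<bar> \<le> L * \<bar>x - y\<bar>" for z
    using lip[of "x + z" "y + z"] by simp
  have "gauss_smooth_deriv s f x - gauss_smooth_deriv s f y = gauss_smooth_deriv s (\<lambda>z. f (x + z) - f (y + z)) 0"
    by (subst gauss_smooth_deriv_diff[where K=K and K'=K])
      (auto simp: assms gauss_smooth_deriv_def)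
  also have "\<bar>\<dots>\<bar> \<le> (L * \<bar>x - y\<bar>) * abs_moment 1 / s"
    using lip' by (intro gauss_smooth_deriv_bound assms) auto
  finally show ?thesis by (simp add: algebra_simps)
qed

section \<open>Bounded functions with bounded Lipschitz derivative\<close>

text \<open>One constant bounds the function, its derivative and the Lipschitz constant of the
  derivative, so that the error of a time step depends on the function through \<open>L\<close>
  alone and is uniform in time.\<close>

definition C11 :: "real \<Rightarrow> (real \<Rightarrow> real) \<Rightarrow> (real \<Rightarrow> real) \<Rightarrow> bool" where
  "C11 L f f' \<longleftrightarrow> (\<forall>x. (f has_field_derivative f' x) (at x)) \<and> (\<forall>x. \<bar>f x\<bar> \<le> L) \<and>
     (\<forall>x. \<bar>f' x\<bar> \<le> L) \<and> (\<forall>x y. \<bar>f' x - f' y\<bar> \<le> L * \<bar>x - y\<bar>)"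

context
  fixes L :: real and f f' :: "real \<Rightarrow> real"
  assumes C11: "C11 L f f'"
begin

lemma C11_deriv: "(f has_field_derivative f' x) (at x)"
  and C11_bound: "\<bar>f x\<bar> \<le> L"
  and C11_deriv_bound: "\<bar>f' x\<bar> \<le> L"
  and C11_deriv_lipschitz: "\<bar>f' x - f' y\<bar> \<le> L * \<bar>x - y\<bar>"
  using C11 by (auto simp: C11_def)

lemma C11_nonneg: "0 \<le> L"
  using C11_bound[of 0] by linarith

lemma C11_continuous: "continuous_on A f"
  by (meson C11_deriv DERIV_isCont continuous_at_imp_continuous_on)

lemma C11_deriv_continuous: "continuous_on A f'"
proof (rule continuous_on_subset)
  show "continuous_on UNIV f'"
    by (rule lipschitz_on_continuous_on[of L], rule lipschitz_onI)
      (use C11_deriv_lipschitz C11_nonneg in \<open>auto simp: dist_real_def\<close>)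
qed simp

lemma C11_measurable: "f \<in> borel_measurable borel" "f' \<in> borel_measurable borel"
  using C11_continuous[of UNIV] C11_deriv_continuous[of UNIV]
  by (auto intro: borel_measurable_continuous_onI)

lemma C11_mvt: "\<exists>z. \<bar>z - x\<bar> \<le> \<bar>h\<bar> \<and> f (x + h) - f x = f' z * h"
proof -
  consider "h = 0" | "h > 0" | "h < 0" by linarith
  then show ?thesis
  proof cases
    case 2
    then obtain z where "x < z" "z < x + h" "f (x + h) - f x = (x + h - x) * f' z"
      using MVT2[of x "x + h" f f'] C11_deriv by auto
    with 2 show ?thesis by (intro exI[of _ z]) (auto simp: mult.commute)
  next
    case 3
    then obtain z where "x + h < z" "z < x" "f x - f (x + h) = (x - (x + h)) * f' z"
      using MVT2[of "x + h" x f f'] C11_deriv by auto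
    with 3 show ?thesis by (intro exI[of _ z]) (auto simp: algebra_simps)
  qed (auto intro: exI[of _ x])
qed

lemma C11_lipschitz: "\<bar>f x - f y\<bar> \<le> L * \<bar>x - y\<bar>"
proof -
  obtain z where "f (y + (x - y)) - f y = f' z * (x - y)"
    using C11_mvt[of y "x - y"] by blast
  then show ?thesis
    using mult_right_mono[OF C11_deriv_bound[of z], of "\<bar>x - y\<bar>"] by (simp add: abs_mult)
qed

text \<open>The mean value theorem, used here in place of an integral remainder, gives
  \<open>L\<close> instead of \<open>L / 2\<close>.\<close>

lemma C11_taylor: "\<bar>f (x + h) - f x - f' x * h\<bar> \<le> L * h\<^sup>2"
proof -
  obtain z where z: "\<bar>z - x\<bar> \<le> \<bar>h\<bar>" "f (x + h) - f x = f' z * h"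
    using C11_mvt[of x h] by blast
  have "\<bar>f (x + h) - f x - f' x * h\<bar> = \<bar>f' z - f' x\<bar> * \<bar>h\<bar>"
    using z(2) by (simp add: abs_mult[symmetric] left_diff_distrib)
  also have "\<dots> \<le> (L * \<bar>h\<bar>) * \<bar>h\<bar>"
    using C11_deriv_lipschitz[of z x] mult_left_mono[OF z(1) C11_nonneg]
    by (intro mult_right_mono) linarith+
  finally show ?thesis by (simp add: power2_eq_square mult.assoc)
qed

lemma C11_deriv_square_lipschitz: "\<bar>(f' x)\<^sup>2 - (f' y)\<^sup>2\<bar> \<le> (2 * L\<^sup>2) * \<bar>x - y\<bar>"
proof -
  have "\<bar>(f' x)\<^sup>2 - (f' y)\<^sup>2\<bar> = \<bar>f' x + f' y\<bar> * \<bar>f' x - f' y\<bar>"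
    by (simp add: abs_mult[symmetric] power2_eq_square algebra_simps)
  also have "\<dots> \<le> (2 * L) * (L * \<bar>x - y\<bar>)"
    using C11_deriv_bound[of x] C11_deriv_bound[of y] C11_deriv_lipschitz[of x y] C11_nonneg
    by (intro mult_mono) auto
  finally show ?thesis by (simp add: power2_eq_square)
qed

lemma C11_deriv_square_bound: "\<bar>(f' x)\<^sup>2\<bar> \<le> L\<^sup>2"
  using power_mono[OF C11_deriv_bound[of x], of 2] by simp

end

section \<open>The logarithm of a Gaussian mean of exponentials\<close>

lemma abs_exp_taylor2_le:
  fixes w :: real shows "\<bar>exp w - 1 - w - w\<^sup>2 / 2\<bar> \<le> \<bar>w\<bar> ^ 3 * exp \<bar>w\<bar>"
proof -
  have "\<bar>exp w - (\<Sum>i\<le>2. w^i / fact i)\<bar> \<le> exp \<bar>w\<bar> * (\<bar>w\<bar> ^ Suc 2) / fact 2"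
    using Taylor_exp_field[of w 2] by simp
  moreover have "(\<Sum>i\<le>2. w^i / fact i) = 1 + w + w\<^sup>2 / 2"
    by (simp add: numeral_2_eq_2)
  moreover have "exp \<bar>w\<bar> * (\<bar>w\<bar> ^ Suc 2) / fact 2 \<le> \<bar>w\<bar> ^ 3 * exp \<bar>w\<bar>"
  proof -
    have "0 \<le> \<bar>w\<bar> ^ 3 * exp \<bar>w\<bar>" by simp
    then show ?thesis by (simp add: eval_nat_numeral algebra_simps)
  qed
  ultimately show ?thesis
    by linarith
qed

text \<open>Apply \<open>ln t \<le> t - 1\<close> to \<open>1 / (1 + y)\<close>. The result
  complements \<open>ln (1 + y) \<le> y\<close> up to a quadratic error, as long as
  \<open>1 + y\<close> stays away from 0.\<close>

lemma ln_ge_quadratic: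
  fixes y :: real assumes "c > 0" "1 + y \<ge> c"
  shows "y - y\<^sup>2 / c \<le> ln (1 + y)"
proof -
  have pos: "1 + y > 0" using assms by linarith
  have "- ln (1 + y) \<le> 1 / (1 + y) - 1"
    using ln_le_minus_one[of "1 / (1 + y)"] pos by (simp add: ln_div)
  moreover have "1 / (1 + y) - 1 = - y + y\<^sup>2 / (1 + y)"
    using pos by (simp add: field_simps power2_eq_square)
  moreover have "y\<^sup>2 / (1 + y) \<le> y\<^sup>2 / c"
    using assms pos by (intro divide_left_mono) auto
  ultimately show ?thesis by linarith
qed

text \<open>For a Gaussian perturbation \<open>N\<close> of standard deviation \<open>s\<close>, the cumulant expansion
  \<open>ln E exp \<psi>(x + N) = E \<psi>(x + N) + Var \<psi>(x + N) / 2 + O(s\<^sup>3)\<close>, in which the variance is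
  \<open>s\<^sup>2 * \<psi>'(x)\<^sup>2\<close> up to the same error. It replaces Ito's formula in what follows.\<close>

lemma log_gauss_smooth_expansion:
  assumes "L \<ge> 0"
  obtains C where "C \<ge> 0"
    and "\<And>\<psi> \<psi>' s x. C11 L \<psi> \<psi>' \<Longrightarrow> 0 \<le> s \<Longrightarrow> s \<le> 1 \<Longrightarrow>
      \<bar>ln (gauss_smooth s (\<lambda>y. exp (\<psi> y)) x) - gauss_smooth s \<psi> x - s\<^sup>2 / 2 * (\<psi>' x)\<^sup>2\<bar> \<le> C * s ^ 3"
proof -
  let ?E = "integral\<^sup>L std_normal_distribution"
  define I3 where "I3 = ?E (\<lambda>z. \<bar>z\<bar> ^ 3 * exp (L * \<bar>z\<bar>))"
  \<comment> \<open>With \<open>y\<close> the mean of \<open>exp D - 1\<close>, \<open>c1\<close> is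
    the constant in \<open>\<bar>y\<bar> \<le> c1 * s^2\<close>. The three terms of \<open>C\<close>
    come from the Taylor remainder of \<open>exp\<close>, from half the error in replacing the
    second moment of \<open>D\<close> by \<open>s^2 * p^2\<close>, and from the loss
    \<open>y^2 * exp (2 * L)\<close> in the logarithm.\<close>
  define c1 where "c1 = L + L\<^sup>2 / 2 + L ^ 3 * I3"
  define C where "C = L ^ 3 * I3 + L\<^sup>2 * abs_moment 3 + c1\<^sup>2 * exp (2 * L)"
  have I3: "I3 \<ge> 0" unfolding I3_def by (intro integral_nonneg_AE) auto
  have c1: "c1 \<ge> 0" using assms I3 by (auto simp: c1_def)
  have "C \<ge> 0" using assms I3 abs_moment_nonneg[of 3] by (auto simp: C_def)
  moreover have "\<bar>ln (gauss_smooth s (\<lambda>y. exp (\<psi> y)) x) - gauss_smooth s \<psi> x - s\<^sup>2 / 2 * (\<psi>' x)\<^sup>2\<bar> \<le> C * s ^ 3"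
    if psi: "C11 L \<psi> \<psi>'" and s: "0 \<le> s" "s \<le> 1" for \<psi> \<psi>' s x
  proof -
    note [measurable] = C11_measurable[OF psi]
    define p where "p = \<psi>' x"
    define D where "D z = \<psi> (x + s * z) - \<psi> x" for z
    have [measurable]: "D \<in> borel_measurable borel" unfolding D_def[abs_def] by measurable
    have p: "\<bar>p\<bar> \<le> L" using C11_deriv_bound[OF psi] by (simp add: p_def)
    have D1: "\<bar>D z\<bar> \<le> L * s * \<bar>z\<bar>" for z
      using C11_lipschitz[OF psi, of "x + s * z" x] s by (simp add: D_def abs_mult mult.assoc)
    have D2: "\<bar>D z - p * s * z\<bar> \<le> L * s\<^sup>2 * z\<^sup>2" for z
      using C11_taylor[OF psi, of x "s * z"] by (simp add: D_def p_def power_mult_distrib mult.assoc)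
    have D0: "\<bar>D z\<bar> \<le> 2 * L" for z
      using C11_bound[OF psi, of "x + s * z"] C11_bound[OF psi, of x] by (simp add: D_def)
    have intD: "integrable std_normal_distribution D"
      by (rule std_normal.integrable_const_bound[where B="2 * L"]) (use D0 in auto)
    have D0sq: "(D z)\<^sup>2 \<le> (2 * L)\<^sup>2" for z
      using power_mono[OF D0[of z], of 2] by simp
    have intD2: "integrable std_normal_distribution (\<lambda>z. (D z)\<^sup>2)"
      by (rule std_normal.integrable_const_bound[where B="(2 * L)\<^sup>2"])
        (use D0sq in auto)
    have intE: "integrable std_normal_distribution (\<lambda>z. exp (D z))"
      by (rule std_normal.integrable_const_bound[where B="exp (2 * L)"])
        (use D0 in \<open>auto simp: abs_le_iff\<close>)
    have intI3: "integrable std_normal_distribution (\<lambda>z. \<bar>z\<bar> ^ 3 * exp (L * \<bar>z\<bar>))"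
      by (rule integrable_std_normal_poly_exp) fact

    have ED: "\<bar>?E D\<bar> \<le> L * s\<^sup>2"
    proof -
      \<comment> \<open>As \<open>z\<close> has mean 0, subtracting the linear part of
        \<open>D\<close> leaves the mean unchanged; the mean is therefore of order
        \<open>s^2\<close> and not \<open>s\<close>.\<close>
      have "?E D = ?E (\<lambda>z. D z - p * s * z)"
        using intD by (simp add: Bochner_Integration.integral_diff)
      also have "\<bar>\<dots>\<bar> \<le> ?E (\<lambda>z. \<bar>D z - p * s * z\<bar>)"
        by (rule integral_abs_bound)
      also have "\<dots> \<le> ?E (\<lambda>z. (L * s\<^sup>2) * z\<^sup>2)"
        using D2 intD by (intro integral_mono integrable_abs Bochner_Integration.integrable_diff) auto
      finally show ?thesis by simp
    qed
    have ED2: "\<bar>?E (\<lambda>z. (D z)\<^sup>2) - s\<^sup>2 * p\<^sup>2\<bar> \<le> 2 * L\<^sup>2 * abs_moment 3 * s ^ 3"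
    proof -
      have "?E (\<lambda>z. (D z)\<^sup>2) - s\<^sup>2 * p\<^sup>2 = ?E (\<lambda>z. (D z)\<^sup>2 - (s\<^sup>2 * p\<^sup>2) * z\<^sup>2)"
        using intD2 by (simp add: Bochner_Integration.integral_diff)
      also have "\<bar>\<dots>\<bar> \<le> ?E (\<lambda>z. \<bar>(D z)\<^sup>2 - (s\<^sup>2 * p\<^sup>2) * z\<^sup>2\<bar>)"
        by (rule integral_abs_bound)
      also have "\<dots> \<le> ?E (\<lambda>z. (2 * L\<^sup>2 * s ^ 3) * \<bar>z\<bar> ^ 3)"
      proof (intro integral_mono integrable_abs Bochner_Integration.integrable_diff intD2 integrable_mult_right)
        fix z
        have "\<bar>(D z)\<^sup>2 - (s\<^sup>2 * p\<^sup>2) * z\<^sup>2\<bar> = \<bar>D z - p * s * z\<bar> * \<bar>D z + p * s * z\<bar>"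
          by (simp add: abs_mult[symmetric] power2_eq_square algebra_simps)
        also have "\<dots> \<le> (L * s\<^sup>2 * z\<^sup>2) * (L * s * \<bar>z\<bar> + L * s * \<bar>z\<bar>)"
        proof (intro mult_mono D2)
          have "\<bar>p * s * z\<bar> \<le> L * s * \<bar>z\<bar>"
            using p s by (simp add: abs_mult mult_right_mono)
          with D1[of z] show "\<bar>D z + p * s * z\<bar> \<le> L * s * \<bar>z\<bar> + L * s * \<bar>z\<bar>" by linarith
        qed (use assms in auto)
        also have "\<dots> = (2 * L\<^sup>2 * s ^ 3) * \<bar>z\<bar> ^ 3"
          by (simp add: power2_eq_square power3_eq_cube)
        finally show "\<bar>(D z)\<^sup>2 - (s\<^sup>2 * p\<^sup>2) * z\<^sup>2\<bar> \<le> (2 * L\<^sup>2 * s ^ 3) * \<bar>z\<bar> ^ 3" .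
      qed auto
      also have "\<dots> = 2 * L\<^sup>2 * abs_moment 3 * s ^ 3" by (simp add: abs_moment_def)
      finally show ?thesis .
    qed
    have EE: "\<bar>?E (\<lambda>z. exp (D z)) - 1 - ?E D - ?E (\<lambda>z. (D z)\<^sup>2) / 2\<bar> \<le> L ^ 3 * I3 * s ^ 3"
    proof -
      have "?E (\<lambda>z. exp (D z)) - 1 - ?E D - ?E (\<lambda>z. (D z)\<^sup>2) / 2 = ?E (\<lambda>z. exp (D z) - 1 - D z - (D z)\<^sup>2 / 2)"
        using intD intD2 intE std_normal.prob_space by (simp add: Bochner_Integration.integral_diff)
      then have "\<bar>?E (\<lambda>z. exp (D z)) - 1 - ?E D - ?E (\<lambda>z. (D z)\<^sup>2) / 2\<bar> \<le> ?E (\<lambda>z. \<bar>exp (D z) - 1 - D z - (D z)\<^sup>2 / 2\<bar>)"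
        by (simp only: integral_abs_bound)
      also have "\<dots> \<le> ?E (\<lambda>z. (L ^ 3 * s ^ 3) * (\<bar>z\<bar> ^ 3 * exp (L * \<bar>z\<bar>)))"
      proof (intro integral_mono integrable_abs integrable_mult_right intI3)
        fix z
        have "\<bar>exp (D z) - 1 - D z - (D z)\<^sup>2 / 2\<bar> \<le> \<bar>D z\<bar> ^ 3 * exp \<bar>D z\<bar>"
          by (rule abs_exp_taylor2_le)
        also have "\<dots> \<le> (L * s * \<bar>z\<bar>) ^ 3 * exp (L * \<bar>z\<bar>)"
        proof (intro mult_mono power_mono D1)
          have "L * s * \<bar>z\<bar> \<le> L * 1 * \<bar>z\<bar>"
            using assms s by (intro mult_right_mono mult_left_mono) auto
          then show "exp \<bar>D z\<bar> \<le> exp (L * \<bar>z\<bar>)" using D1[of z] by simp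
        qed (use assms s in auto)
        finally show "\<bar>exp (D z) - 1 - D z - (D z)\<^sup>2 / 2\<bar> \<le> (L ^ 3 * s ^ 3) * (\<bar>z\<bar> ^ 3 * exp (L * \<bar>z\<bar>))"
          by (simp add: power_mult_distrib mult.assoc)
      qed (use intD intD2 intE in auto)
      also have "\<dots> = L ^ 3 * I3 * s ^ 3" by (simp add: I3_def)
      finally show ?thesis .
    qed
    have ED2b: "?E (\<lambda>z. (D z)\<^sup>2) \<le> L\<^sup>2 * s\<^sup>2"
    proof -
      have "?E (\<lambda>z. (D z)\<^sup>2) \<le> ?E (\<lambda>z. (L\<^sup>2 * s\<^sup>2) * z\<^sup>2)"
      proof (intro integral_mono intD2)
        show "(D z)\<^sup>2 \<le> (L\<^sup>2 * s\<^sup>2) * z\<^sup>2" for z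
          using power_mono[OF D1[of z], of 2] by (simp add: power_mult_distrib)
      qed auto
      then show ?thesis by simp
    qed
    have ED2c: "0 \<le> ?E (\<lambda>z. (D z)\<^sup>2)" by (intro integral_nonneg_AE) auto
    define y where "y = ?E (\<lambda>z. exp (D z)) - 1"
    have s3: "s ^ 3 \<le> s\<^sup>2" using s by (simp add: power_decreasing)
    have yb: "\<bar>y\<bar> \<le> c1 * s\<^sup>2"
    proof -
      have "\<bar>y\<bar> \<le> L * s\<^sup>2 + L\<^sup>2 * s\<^sup>2 / 2 + L ^ 3 * I3 * s ^ 3"
        using ED EE ED2b ED2c unfolding y_def by linarith
      also have "L ^ 3 * I3 * s ^ 3 \<le> L ^ 3 * I3 * s\<^sup>2"
        using s3 assms I3 by (intro mult_left_mono) auto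
      finally show ?thesis by (simp add: c1_def algebra_simps)
    qed
    \<comment> \<open>\<open>D \<ge> - 2 * L\<close> keeps the argument of \<open>ln\<close> above a
      constant depending on \<open>L\<close> alone, as \<open>ln_ge_quadratic\<close>
      requires.\<close>
    have ypos: "1 + y \<ge> exp (- 2 * L)"
    proof -
      have "?E (\<lambda>z. exp (- 2 * L)) \<le> ?E (\<lambda>z. exp (D z))"
        using D0 by (intro integral_mono intE) (auto simp: abs_le_iff minus_le_iff)
      then show ?thesis using std_normal.prob_space by (simp add: y_def)
    qed
    have up: "ln (1 + y) \<le> y"
      using ln_le_minus_one[of "1 + y"] ypos by (smt (verit) exp_gt_zero)
    have lo: "y - c1\<^sup>2 * exp (2 * L) * s ^ 3 \<le> ln (1 + y)"
    proof -
      have "y\<^sup>2 \<le> c1\<^sup>2 * s ^ 4"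
        using power_mono[OF yb, of 2] by (simp add: power_mult_distrib flip: power_mult)
      also have "\<dots> \<le> c1\<^sup>2 * s ^ 3"
        using s by (intro mult_left_mono power_decreasing) auto
      finally have "y\<^sup>2 / exp (- 2 * L) \<le> c1\<^sup>2 * s ^ 3 * exp (2 * L)"
        by (simp add: exp_minus field_simps)
      with ln_ge_quadratic[OF _ ypos] show ?thesis by (simp add: algebra_simps)
    qed
    have "ln (gauss_smooth s (\<lambda>y. exp (\<psi> y)) x) = \<psi> x + ln (1 + y)"
    proof -
      have "gauss_smooth s (\<lambda>y. exp (\<psi> y)) x = ?E (\<lambda>z. exp (\<psi> x) * exp (D z))"
        by (simp add: gauss_smooth_def D_def exp_add[symmetric])
      also have "\<dots> = exp (\<psi> x) * (1 + y)" by (simp add: y_def)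
      finally show ?thesis
        using less_le_trans[OF exp_gt_zero ypos] by (simp add: ln_mult)
    qed
    moreover have "gauss_smooth s \<psi> x = \<psi> x + ?E D"
      using intD std_normal.prob_space gauss_smooth_integrable[OF C11_measurable(1)[OF psi] C11_bound[OF psi]]
      by (simp add: gauss_smooth_def D_def[abs_def] Bochner_Integration.integral_diff)
    moreover have "\<bar>y - ?E D - s\<^sup>2 / 2 * p\<^sup>2\<bar> \<le> L ^ 3 * I3 * s ^ 3 + L\<^sup>2 * abs_moment 3 * s ^ 3"
      using EE ED2 unfolding y_def by linarith
    moreover have "C * s ^ 3 = L ^ 3 * I3 * s ^ 3 + L\<^sup>2 * abs_moment 3 * s ^ 3 + c1\<^sup>2 * exp (2 * L) * s ^ 3"
      by (simp add: C_def algebra_simps)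
    moreover have "0 \<le> c1\<^sup>2 * exp (2 * L) * s ^ 3" using s by simp
    ultimately show ?thesis
      using up lo unfolding p_def by linarith
  qed
  ultimately show thesis by (rule that)
qed

section \<open>Brownian increments\<close>

text \<open>\<open>brownian_motion\<close> states independence for the preimages of the increment,
  whereas \<open>indep_var\<close> speaks of generated sigma-algebras; passing from one to the other
  requires generators stable under intersection.\<close>

lemma Int_stable_preimages: "Int_stable {X -` A \<inter> S | A. A \<in> sets N}"
proof (rule Int_stableI)
  fix a b assume "a \<in> {X -` A \<inter> S | A. A \<in> sets N}" "b \<in> {X -` A \<inter> S | A. A \<in> sets N}"
  then obtain A A' where A: "a = X -` A \<inter> S" "b = X -` A' \<inter> S" "A \<in> sets N" "A' \<in> sets N"
    by blast
  then have "a \<inter> b = X -` (A \<inter> A') \<inter> S" by auto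
  moreover have "A \<inter> A' \<in> sets N" using A by (intro sets.Int)
  ultimately show "a \<inter> b \<in> {X -` A \<inter> S | A. A \<in> sets N}" by blast
qed

locale brownian =
  fixes M :: "'w measure" and F :: "real \<Rightarrow> 'w measure" and B :: "real \<Rightarrow> 'w \<Rightarrow> real"
  assumes bm: "brownian_motion M F B"

sublocale brownian \<subseteq> prob_space M
  using bm by (simp add: brownian_motion_def)

context brownian
begin

lemma space_F [simp]: "space (F t) = space M"
  and sets_F_mono: "s \<le> t \<Longrightarrow> sets (F s) \<subseteq> sets (F t)"
  using bm by (auto simp: brownian_motion_def filtration_def)

lemma sets_F_subset: "0 \<le> t \<Longrightarrow> sets (F t) \<subseteq> sets M"
  and B_adapted: "0 \<le> t \<Longrightarrow> B t \<in> borel_measurable (F t)"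
  and B_continuous: "\<omega> \<in> space M \<Longrightarrow> continuous_on {0..} (\<lambda>t. B t \<omega>)"
  and B_zero: "AE \<omega> in M. B 0 \<omega> = 0"
  using bm by (auto simp: brownian_motion_def)

lemma measurable_F_mono:
  "X \<in> borel_measurable (F s) \<Longrightarrow> s \<le> t \<Longrightarrow> X \<in> borel_measurable (F t)"
  using sets_F_mono[of s t] by (auto simp: measurable_def)

lemma measurable_F_M:
  "X \<in> borel_measurable (F s) \<Longrightarrow> 0 \<le> s \<Longrightarrow> X \<in> borel_measurable M"
  using sets_F_subset[of s] by (auto simp: measurable_def)

lemma B_adapted': "0 \<le> s \<Longrightarrow> s \<le> t \<Longrightarrow> B s \<in> borel_measurable (F t)"
  using B_adapted measurable_F_mono by blast

lemma B_measurable [measurable]: "0 \<le> t \<Longrightarrow> B t \<in> borel_measurable M"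
  using B_adapted measurable_F_M by blast

lemma normalized_increment_distr:
  assumes "0 \<le> s" "s < t"
  shows "distr M borel (\<lambda>\<omega>. (B t \<omega> - B s \<omega>) / sqrt (t - s)) = std_normal_distribution"
proof -
  have "distributed M lborel (\<lambda>\<omega>. B t \<omega> - B s \<omega>) (normal_density 0 (sqrt (t - s)))"
    using bm assms by (auto simp: brownian_motion_def)
  then have "distributed M lborel (\<lambda>\<omega>. (B t \<omega> - B s \<omega> - 0) / sqrt (t - s)) std_normal_density"
    using assms by (subst (asm) normal_standard_normal_convert) auto
  then show ?thesis
    by (simp add: distributed_def cong: distr_cong)
qed

lemma increment_indep:
  assumes st: "0 \<le> s" "s < t" and X: "X \<in> borel_measurable (F s)"
  shows "indep_var borel X borel (\<lambda>\<omega>. (B t \<omega> - B s \<omega>) / sqrt (t - s))"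
proof -
  let ?W = "\<lambda>\<omega>. B t \<omega> - B s \<omega>"
  have [measurable]: "?W \<in> borel_measurable M" "X \<in> borel_measurable M"
    using st measurable_F_M[OF X] by auto
  have "indep_set (sets (F s)) {?W -` A \<inter> space M | A. A \<in> sets borel}"
    using bm st by (auto simp: brownian_motion_def)
  moreover have "{X -` A \<inter> space M | A. A \<in> sets borel} \<subseteq> sets (F s)"
    using measurable_sets[OF X] by auto
  ultimately have "indep_set {X -` A \<inter> space M | A. A \<in> sets borel} {?W -` A \<inter> space M | A. A \<in> sets borel}"
    unfolding indep_sets2_eq by blast
  then have "indep_set (sigma_sets (space M) {X -` A \<inter> space M | A. A \<in> sets borel})
    (sigma_sets (space M) {?W -` A \<inter> space M | A. A \<in> sets borel})"
    by (rule indep_set_sigma_sets) (rule Int_stable_preimages)+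
  then have "indep_var borel X borel ?W"
    by (auto simp: indep_var_eq)
  then have "indep_var borel ((\<lambda>x. x) \<circ> X) borel ((\<lambda>w. w / sqrt (t - s)) \<circ> ?W)"
    by (rule indep_var_compose) auto
  then show ?thesis by (simp add: comp_def)
qed

lemma integral_increment:
  assumes st: "0 \<le> s" "s \<le> t" and [measurable]: "h \<in> borel_measurable borel"
  shows "(\<integral>\<omega>. h (B t \<omega> - B s \<omega>) \<partial>M) = (LINT z|std_normal_distribution. h (sqrt (t - s) * z) :: real)"
    and "integrable std_normal_distribution (\<lambda>z. h (sqrt (t - s) * z)) \<Longrightarrow> integrable M (\<lambda>\<omega>. h (B t \<omega> - B s \<omega>))"
proof -
  have "(\<integral>\<omega>. h (B t \<omega> - B s \<omega>) \<partial>M) = (LINT z|std_normal_distribution. h (sqrt (t - s) * z)) \<and>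
    integrable std_normal_distribution (\<lambda>z. h (sqrt (t - s) * z)) = integrable M (\<lambda>\<omega>. h (B t \<omega> - B s \<omega>))"
  proof (cases "s = t")
    \<comment> \<open>There is no normal density of variance 0; here both integrands are the
      constant \<open>h 0\<close>.\<close>
    case True
    then show ?thesis using prob_space std_normal.prob_space by simp
  next
    case False
    with st have "s < t" by simp
    have [measurable]: "(\<lambda>\<omega>. (B t \<omega> - B s \<omega>) / sqrt (t - s)) \<in> borel_measurable M"
      using st by auto
    show ?thesis
      unfolding normalized_increment_distr[OF st(1) \<open>s < t\<close>, symmetric]
      by (subst integral_distr, simp, simp, subst integrable_distr_eq) (use \<open>s < t\<close> in auto)
  qed
  then show "(\<integral>\<omega>. h (B t \<omega> - B s \<omega>) \<partial>M) = (LINT z|std_normal_distribution. h (sqrt (t - s) * z) :: real)"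
    "integrable std_normal_distribution (\<lambda>z. h (sqrt (t - s) * z)) \<Longrightarrow> integrable M (\<lambda>\<omega>. h (B t \<omega> - B s \<omega>))"
    by auto
qed

lemma increment_abs_moment:
  assumes "0 \<le> s" "s \<le> t"
  shows "integrable M (\<lambda>\<omega>. \<bar>B t \<omega> - B s \<omega>\<bar>)"
    and "(\<integral>\<omega>. \<bar>B t \<omega> - B s \<omega>\<bar> \<partial>M) = abs_moment 1 * sqrt (t - s)"
  using integral_increment[OF assms, of abs] assms by (simp_all add: abs_mult abs_moment_def)

lemma increment_second_moment:
  assumes "0 \<le> s" "s \<le> t"
  shows "integrable M (\<lambda>\<omega>. (B t \<omega> - B s \<omega>)\<^sup>2)"
    and "(\<integral>\<omega>. (B t \<omega> - B s \<omega>)\<^sup>2 \<partial>M) = t - s"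
  using integral_increment[OF assms, of "\<lambda>x. x\<^sup>2"] assms by (simp_all add: power_mult_distrib)

text \<open>The Markov property in integrated form: the increment is independent of
  \<open>X\<close>, so their joint law is a product and Fubini integrates out the increment first.
  This is how conditioning on \<open>F s\<close> is carried out throughout.\<close>

lemma increment_expectation:
  assumes st: "0 \<le> s" "s \<le> t" and X: "X \<in> borel_measurable (F s)"
    and f [measurable]: "f \<in> borel_measurable borel" and bd: "\<And>x. \<bar>f x\<bar> \<le> K"
  shows "(\<integral>\<omega>. f (X \<omega> + \<sigma> * (B t \<omega> - B s \<omega>)) \<partial>M) = (\<integral>\<omega>. gauss_smooth (\<sigma> * sqrt (t - s)) f (X \<omega>) \<partial>M)"
proof (cases "s = t")
  case False
  with st have "s < t" by simp
  let ?V = "\<lambda>\<omega>. (B t \<omega> - B s \<omega>) / sqrt (t - s)"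
  let ?g = "\<lambda>(x, v). f (x + \<sigma> * sqrt (t - s) * v)"
  have [measurable]: "X \<in> borel_measurable M" "?V \<in> borel_measurable M"
    using st measurable_F_M[OF X] by auto
  interpret dX: prob_space "distr M borel X" by (rule prob_space_distr) simp
  interpret pair_sigma_finite "distr M borel X" std_normal_distribution ..
  interpret XV: pair_prob_space "distr M borel X" std_normal_distribution ..
  have "distr M borel X \<Otimes>\<^sub>M std_normal_distribution = distr M (borel \<Otimes>\<^sub>M borel) (\<lambda>\<omega>. (X \<omega>, ?V \<omega>))"
    using increment_indep[OF st(1) \<open>s < t\<close> X] normalized_increment_distr[OF st(1) \<open>s < t\<close>]
    by (simp add: indep_var_distribution_eq)
  then have "(\<integral>p. ?g p \<partial>(distr M borel X \<Otimes>\<^sub>M std_normal_distribution)) = (\<integral>\<omega>. ?g (X \<omega>, ?V \<omega>) \<partial>M)"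
    by (simp add: integral_distr)
  moreover have "(\<integral>p. ?g p \<partial>(distr M borel X \<Otimes>\<^sub>M std_normal_distribution)) =
      (\<integral>x. gauss_smooth (\<sigma> * sqrt (t - s)) f x \<partial>distr M borel X)"
  proof -
    have "integrable (distr M borel X \<Otimes>\<^sub>M std_normal_distribution) ?g"
      by (rule XV.integrable_const_bound[where B=K]) (use bd in auto)
    from integral_fst'[OF this] show ?thesis by (simp add: gauss_smooth_def)
  qed
  ultimately show ?thesis
    using \<open>s < t\<close> by (simp add: integral_distr)
qed simp

text \<open>The given Brownian motion serves as the coupling: the mean of \<open>f\<close> at
  \<open>x\<close> plus \<sigma> times the increment over \<open>[0, a + b]\<close> is computed in
  one stage and in two, which avoids convolving densities.\<close>

lemma gauss_smooth_semigroup: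
  assumes ab: "0 \<le> a" "0 \<le> b" and f [measurable]: "f \<in> borel_measurable borel" and bd: "\<And>x. \<bar>f x\<bar> \<le> K"
  shows "gauss_smooth (\<sigma> * sqrt a) (gauss_smooth (\<sigma> * sqrt b) f) x = gauss_smooth (\<sigma> * sqrt (a + b)) f x"
proof -
  have "gauss_smooth (\<sigma> * sqrt a) (gauss_smooth (\<sigma> * sqrt b) f) x
    = (\<integral>\<omega>. gauss_smooth (\<sigma> * sqrt b) f (x + \<sigma> * (B a \<omega> - B 0 \<omega>)) \<partial>M)"
    using increment_expectation[of 0 a "\<lambda>_. x" "gauss_smooth (\<sigma> * sqrt b) f" K \<sigma>] ab gauss_smooth_bound[OF f bd] prob_space
    by simp
  also have "\<dots> = (\<integral>\<omega>. f (x + \<sigma> * (B a \<omega> - B 0 \<omega>) + \<sigma> * (B (a + b) \<omega> - B a \<omega>)) \<partial>M)"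
  proof -
    have [measurable]: "B a \<in> borel_measurable (F a)" "B 0 \<in> borel_measurable (F a)"
      using ab B_adapted' by auto
    show ?thesis
      using increment_expectation[of a "a + b" "\<lambda>\<omega>. x + \<sigma> * (B a \<omega> - B 0 \<omega>)" f K \<sigma>] ab bd by simp
  qed
  also have "\<dots> = (\<integral>\<omega>. f (x + \<sigma> * (B (a + b) \<omega> - B 0 \<omega>)) \<partial>M)"
    by (simp add: algebra_simps)
  also have "\<dots> = gauss_smooth (\<sigma> * sqrt (a + b)) f x"
    using increment_expectation[of 0 "a + b" "\<lambda>_. x" f K \<sigma>] ab bd prob_space by simp
  finally show ?thesis .
qed

end

section \<open>The logarithmic transform of the value function\<close>

lemma abs_divide_diff_le:
  fixes a a' b b' :: real
  assumes "c > 0" "b \<ge> c" "b' \<ge> c" "\<bar>a'\<bar> \<le> A"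
  shows "\<bar>a / b - a' / b'\<bar> \<le> \<bar>a - a'\<bar> / c + A / c\<^sup>2 * \<bar>b - b'\<bar>"
proof -
  have pos: "b > 0" "b' > 0" using assms by auto
  have "a / b - a' / b' = (a - a') / b + a' * (b' - b) / (b * b')"
    using pos by (simp add: field_simps)
  also have "\<bar>\<dots>\<bar> \<le> \<bar>a - a'\<bar> / b + \<bar>a'\<bar> * \<bar>b - b'\<bar> / (b * b')"
    using pos abs_triangle_ineq[of "(a - a') / b" "a' * (b' - b) / (b * b')"]
    by (simp add: abs_mult abs_minus_commute)
  also have "\<dots> \<le> \<bar>a - a'\<bar> / c + A * \<bar>b - b'\<bar> / (c * c)"
    using assms by (intro add_mono frac_le mult_mono mult_nonneg_nonneg) auto
  finally show ?thesis by (simp add: power2_eq_square)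
qed

lemma abs_ln_diff_le:
  fixes a b :: real
  assumes "c > 0" "a \<ge> c" "b \<ge> c"
  shows "\<bar>ln a - ln b\<bar> \<le> \<bar>a - b\<bar> / c"
proof -
  have *: "ln x - ln y \<le> \<bar>x - y\<bar> / c" if "x \<ge> c" "y \<ge> c" for x y :: real
  proof -
    have pos: "x > 0" "y > 0" using that assms by auto
    have "ln x - ln y = ln (x / y)" using pos by (simp add: ln_div)
    also have "\<dots> \<le> x / y - 1" using pos by (intro ln_le_minus_one) auto
    also have "\<dots> = (x - y) / y" using pos by (simp add: field_simps)
    also have "\<dots> \<le> \<bar>x - y\<bar> / c" using pos that assms by (intro frac_le) auto
    finally show ?thesis .
  qed
  from *[OF assms(2,3)] *[OF assms(3,2)] show ?thesis
    by (simp add: abs_le_iff abs_minus_commute)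
qed

lemma lipschitz_of_bounded_deriv:
  fixes f f' :: "real \<Rightarrow> real"
  assumes "\<And>x. (f has_field_derivative f' x) (at x)" "\<And>x. \<bar>f' x\<bar> \<le> L"
  shows "\<bar>f x - f y\<bar> \<le> L * \<bar>x - y\<bar>"
  using field_differentiable_bound[of UNIV f f' L x y] assms by auto

text \<open>Neither \<open>R\<close> nor \<mu> occurs here, so that the same results also apply to
  the perturbed reward \<phi> + \<eta> h in \<open>terminal_expectation\<close>.\<close>

locale terminal_reward = brownian M F B
  for M :: "'w measure" and F :: "real \<Rightarrow> 'w measure" and B :: "real \<Rightarrow> 'w \<Rightarrow> real" +
  fixes T \<sigma> K :: real and \<phi> :: "real \<Rightarrow> real"
  assumes T_pos: "T > 0" and sigma_pos: "\<sigma> > 0"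
    and phi_bound: "\<And>x. \<bar>\<phi> x\<bar> \<le> K" and phi_uc: "uniformly_continuous_on UNIV \<phi>"
begin

definition u :: "real \<Rightarrow> real \<Rightarrow> real" where
  "u t x = gauss_smooth (\<sigma> * sqrt (T - t)) (\<lambda>y. exp (\<phi> y)) x"

definition u_deriv :: "real \<Rightarrow> real \<Rightarrow> real" where
  "u_deriv t x = gauss_smooth_deriv (\<sigma> * sqrt (T - t)) (\<lambda>y. exp (\<phi> y)) x"

definition psi :: "real \<Rightarrow> real \<Rightarrow> real" where
  "psi t x = ln (u t x)"

definition psi_deriv :: "real \<Rightarrow> real \<Rightarrow> real" where
  "psi_deriv t x = u_deriv t x / u t x"

lemma K_nonneg: "0 \<le> K" using phi_bound[of 0] by linarith

lemma phi_measurable [measurable]: "\<phi> \<in> borel_measurable borel"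
  using phi_uc by (intro borel_measurable_continuous_onI uniformly_continuous_imp_continuous)

lemma exp_phi_measurable [measurable]: "(\<lambda>y. exp (\<phi> y)) \<in> borel_measurable borel"
  by measurable

lemma exp_phi_bounds: "exp (- K) \<le> exp (\<phi> x)" "exp (\<phi> x) \<le> exp K" "\<bar>exp (\<phi> x)\<bar> \<le> exp K"
  using phi_bound[of x] by (auto simp: abs_le_iff)

lemma u_measurable [measurable]: "u t \<in> borel_measurable borel"
  unfolding u_def[abs_def] by measurable

lemma u_bounds: "exp (- K) \<le> u t x" "u t x \<le> exp K" "\<bar>u t x\<bar> \<le> exp K"
proof -
  show *: "exp (- K) \<le> u t x"
    using gauss_smooth_mono[of "\<lambda>_. exp (- K)" "exp (- K)" "\<lambda>y. exp (\<phi> y)" "exp K" "\<sigma> * sqrt (T - t)" x] exp_phi_bounds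
    by (simp add: u_def)
  show "\<bar>u t x\<bar> \<le> exp K"
    unfolding u_def by (rule gauss_smooth_bound) (use exp_phi_bounds in auto)
  with * show "u t x \<le> exp K" by simp
qed

lemma u_pos: "0 < u t x"
  using u_bounds(1)[of t x] less_le_trans[OF exp_gt_zero] by blast

lemma exp_psi [simp]: "exp (psi t x) = u t x"
  by (simp add: psi_def u_pos)

lemma psi_bound: "\<bar>psi t x\<bar> \<le> K"
  using u_bounds[of t x] u_pos[of t x] unfolding psi_def abs_le_iff
  by (metis exp_le_cancel_iff exp_ln minus_le_iff)

lemma psi_measurable [measurable]: "psi t \<in> borel_measurable borel"
  unfolding psi_def[abs_def] by measurable

lemma u_semigroup:
  assumes "t \<le> t'" "t' \<le> T"
  shows "u t x = gauss_smooth (\<sigma> * sqrt (t' - t)) (u t') x"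
  using gauss_smooth_semigroup[of "t' - t" "T - t'" "\<lambda>y. exp (\<phi> y)" "exp K" \<sigma> x] exp_phi_bounds assms
  by (simp add: u_def[abs_def])

lemma psi_semigroup:
  assumes "t \<le> t'" "t' \<le> T"
  shows "psi t x = ln (gauss_smooth (\<sigma> * sqrt (t' - t)) (\<lambda>y. exp (psi t' y)) x)"
  using u_semigroup[OF assms] by (simp add: psi_def[of t] )

lemma u_has_deriv: "t < T \<Longrightarrow> (u t has_field_derivative u_deriv t x) (at x)"
  unfolding u_def[abs_def] u_deriv_def
  by (rule gauss_smooth_has_deriv) (use exp_phi_bounds sigma_pos in auto)

lemma psi_has_deriv:
  assumes "t < T" shows "(psi t has_field_derivative psi_deriv t x) (at x)"
  unfolding psi_def[abs_def] psi_deriv_def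
  using DERIV_ln_divide[OF u_pos[of t x]] u_has_deriv[OF assms, of x] u_pos[of t x]
  by (auto intro!: derivative_eq_intros)

lemma u_deriv_bound:
  assumes "t < T" shows "\<bar>u_deriv t x\<bar> \<le> exp K * abs_moment 1 / (\<sigma> * sqrt (T - t))"
  unfolding u_deriv_def
  by (rule gauss_smooth_deriv_bound) (use exp_phi_bounds sigma_pos assms in auto)

text \<open>The singularity at \<open>T\<close> is integrable in time. This makes the drift of a
  solution integrable up to the horizon and the terminal state exist.\<close>

lemma psi_deriv_bound:
  assumes "t < T" shows "\<bar>psi_deriv t x\<bar> \<le> exp (2 * K) * abs_moment 1 / \<sigma> / sqrt (T - t)"
proof -
  have "\<bar>psi_deriv t x\<bar> = \<bar>u_deriv t x\<bar> / u t x"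
    using u_pos[of t x] by (simp add: psi_deriv_def)
  also have "\<dots> \<le> (exp K * abs_moment 1 / (\<sigma> * sqrt (T - t))) / exp (- K)"
    using u_bounds[of t x] abs_moment_nonneg sigma_pos assms by (intro frac_le u_deriv_bound) auto
  also have "\<dots> = exp (2 * K) * abs_moment 1 / \<sigma> / sqrt (T - t)"
    by (simp add: exp_minus mult_exp_exp field_simps)
  finally show ?thesis .
qed

lemma psi_deriv_measurable [measurable]: "psi_deriv t \<in> borel_measurable borel"
  unfolding psi_deriv_def[abs_def] u_deriv_def by measurable

text \<open>Half of the remaining time smooths \<open>exp \<circ> \<phi>\<close> to a Lipschitz function, the other half
  makes its derivative Lipschitz.\<close>

lemma psi_regular:
  assumes "e > 0"
  obtains L where "\<And>t. t \<le> T - e \<Longrightarrow> C11 L (psi t) (psi_deriv t)"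
    and "\<And>t t' x. t \<le> t' \<Longrightarrow> t' \<le> T - e \<Longrightarrow> \<bar>psi_deriv t x - psi_deriv t' x\<bar> \<le> L * sqrt (t' - t)"
proof -
  define r where "r = \<sigma> * sqrt (e / 2)"
  have r: "r > 0" using sigma_pos assms by (simp add: r_def)
  let ?m = "abs_moment 1"
  have m: "?m \<ge> 0" by (rule abs_moment_nonneg)
  define A where "A = exp K * ?m / r"
  have A: "A \<ge> 0" using m r by (simp add: A_def)
  have lip: "\<bar>u t x - u t y\<bar> \<le> A * \<bar>x - y\<bar>" if "t \<le> T - e / 2" for t x y
  proof (rule lipschitz_of_bounded_deriv)
    have t: "t < T" using that assms by simp
    show "(u t has_field_derivative u_deriv t x) (at x)" for x by (rule u_has_deriv[OF t])
    show "\<bar>u_deriv t x\<bar> \<le> A" for x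
    proof -
      have "\<bar>u_deriv t x\<bar> \<le> exp K * ?m / (\<sigma> * sqrt (T - t))" by (rule u_deriv_bound[OF t])
      also have "\<dots> \<le> A"
        unfolding A_def using r m that sigma_pos by (intro divide_left_mono mult_pos_pos) (auto simp: r_def t)
      finally show ?thesis .
    qed
  qed
  \<comment> \<open>Writing \<open>u t\<close> as a smoothing on the fixed scale \<open>r\<close>
    makes the constants independent of \<open>t\<close>. Uniqueness of derivatives identifies the
    two expressions for \<open>u_deriv\<close>.\<close>
  have deriv_eq: "u_deriv t x = gauss_smooth_deriv r (u (t + e / 2)) x" if "t \<le> T - e" for t x
  proof (rule DERIV_unique)
    show "(u t has_field_derivative u_deriv t x) (at x)"
      by (rule u_has_deriv) (use that assms in auto)
    have "u t = gauss_smooth r (u (t + e / 2))"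
      using u_semigroup[of t "t + e / 2"] that assms by (auto simp: r_def)
    then show "(u t has_field_derivative gauss_smooth_deriv r (u (t + e / 2)) x) (at x)"
      using gauss_smooth_has_deriv[of "u (t + e / 2)" "exp K" r x] u_bounds r by simp
  qed
  have db: "\<bar>u_deriv t x\<bar> \<le> A" if "t \<le> T - e" for t x
    unfolding deriv_eq[OF that] A_def by (rule gauss_smooth_deriv_bound) (use u_bounds r in auto)
  have dlip: "\<bar>u_deriv t x - u_deriv t y\<bar> \<le> A * ?m / r * \<bar>x - y\<bar>" if "t \<le> T - e" for t x y
    unfolding deriv_eq[OF that]
    by (rule gauss_smooth_deriv_lipschitz) (use u_bounds r lip that in auto)
  \<comment> \<open>Going back in time by \<open>t' - t\<close> smooths on the scale
    \<open>\<sigma> * sqrt (t' - t)\<close>. The resulting square-root modulus is enough and spares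
    any derivative in time.\<close>
  have tlip: "\<bar>u t x - u t' x\<bar> \<le> A * ?m * \<sigma> * sqrt (t' - t)" if "t \<le> t'" "t' \<le> T - e / 2" for t t' x
  proof -
    have "\<bar>gauss_smooth (\<sigma> * sqrt (t' - t)) (u t') x - u t' x\<bar> \<le> A * ?m * (\<sigma> * sqrt (t' - t))"
      by (rule gauss_smooth_close) (use u_bounds lip that sigma_pos in auto)
    then show ?thesis using u_semigroup[of t t' x] that assms by (simp add: mult.assoc)
  qed
  have tdlip: "\<bar>u_deriv t x - u_deriv t' x\<bar> \<le> A * ?m * \<sigma> * sqrt (t' - t) * ?m / r"
    if "t \<le> t'" "t' \<le> T - e" for t t' x
  proof -
    have "u_deriv t x - u_deriv t' x = gauss_smooth_deriv r (\<lambda>y. u (t + e / 2) y - u (t' + e / 2) y) x"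
      using that by (subst gauss_smooth_deriv_diff[where K="exp K" and K'="exp K"])
        (auto simp: deriv_eq u_bounds)
    also have "\<bar>\<dots>\<bar> \<le> A * ?m * \<sigma> * sqrt (t' - t) * ?m / r"
      using tlip[of "t + e/2" "t' + e/2"] that r by (intro gauss_smooth_deriv_bound) auto
    finally show ?thesis .
  qed
  define c where "c = exp (- K)"
  have c: "c > 0" "\<And>t x. u t x \<ge> c" using u_bounds by (auto simp: c_def)
  define L1 where "L1 = A * ?m / r / c + A / c\<^sup>2 * A"
  define L2 where "L2 = A * ?m * \<sigma> * ?m / r / c + A / c\<^sup>2 * (A * ?m * \<sigma>)"
  define L where "L = K + A / c + L1 + L2"
  have L12: "L1 \<ge> 0" "L2 \<ge> 0" "A / c \<ge> 0" using A c m r sigma_pos by (auto simp: L1_def L2_def)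
  show thesis
  proof (rule that)
    fix t assume t: "t \<le> T - e"
    show "C11 L (psi t) (psi_deriv t)"
      unfolding C11_def
    proof (intro conjI allI)
      show "(psi t has_field_derivative psi_deriv t x) (at x)" for x
        by (rule psi_has_deriv) (use t assms in auto)
      show "\<bar>psi t x\<bar> \<le> L" for x using psi_bound[of t x] L12 by (simp add: L_def)
      show "\<bar>psi_deriv t x\<bar> \<le> L" for x
      proof -
        have "\<bar>psi_deriv t x\<bar> = \<bar>u_deriv t x\<bar> / u t x" using u_pos[of t x] by (simp add: psi_deriv_def)
        also have "\<dots> \<le> A / c" using db[OF t] c A by (intro frac_le) auto
        also have "\<dots> \<le> L" using L12 K_nonneg by (simp add: L_def)
        finally show ?thesis .
      qed
      fix x y
      have "\<bar>psi_deriv t x - psi_deriv t y\<bar> \<le> \<bar>u_deriv t x - u_deriv t y\<bar> / c + A / c\<^sup>2 * \<bar>u t x - u t y\<bar>"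
        unfolding psi_deriv_def by (rule abs_divide_diff_le) (use c db[OF t] in auto)
      also have "\<dots> \<le> (A * ?m / r * \<bar>x - y\<bar>) / c + A / c\<^sup>2 * (A * \<bar>x - y\<bar>)"
        using A c t assms by (intro add_mono divide_right_mono mult_left_mono dlip lip) auto
      also have "\<dots> = L1 * \<bar>x - y\<bar>" by (simp add: L1_def algebra_simps)
      also have "\<dots> \<le> L * \<bar>x - y\<bar>" using L12 K_nonneg by (intro mult_right_mono) (auto simp: L_def)
      finally show "\<bar>psi_deriv t x - psi_deriv t y\<bar> \<le> L * \<bar>x - y\<bar>" .
    qed
  next
    fix t t' x assume t: "t \<le> t'" "t' \<le> T - e"
    have "\<bar>psi_deriv t x - psi_deriv t' x\<bar> \<le> \<bar>u_deriv t x - u_deriv t' x\<bar> / c + A / c\<^sup>2 * \<bar>u t x - u t' x\<bar>"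
      unfolding psi_deriv_def by (rule abs_divide_diff_le) (use c db t in auto)
    also have "\<dots> \<le> (A * ?m * \<sigma> * sqrt (t' - t) * ?m / r) / c + A / c\<^sup>2 * (A * ?m * \<sigma> * sqrt (t' - t))"
      using A c t assms by (intro add_mono divide_right_mono mult_left_mono tdlip tlip) auto
    also have "\<dots> = L2 * sqrt (t' - t)" by (simp add: L2_def algebra_simps)
    also have "\<dots> \<le> L * sqrt (t' - t)" using L12 K_nonneg t by (intro mult_right_mono) (auto simp: L_def)
    finally show "\<bar>psi_deriv t x - psi_deriv t' x\<bar> \<le> L * sqrt (t' - t)" .
  qed
qed

lemma exp_phi_uc: "uniformly_continuous_on UNIV (\<lambda>y. exp (\<phi> y))"
proof -
  have "uniformly_continuous_on {-K..K} (exp :: real \<Rightarrow> real)"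
    by (intro compact_uniformly_continuous continuous_intros) auto
  moreover have "range \<phi> \<subseteq> {-K..K}"
    using phi_bound by (auto simp: abs_le_iff minus_le_iff)
  ultimately have "uniformly_continuous_on (range \<phi>) (exp :: real \<Rightarrow> real)"
    unfolding uniformly_continuous_on_def by (meson subsetD)
  from uniformly_continuous_on_compose[OF phi_uc this] show ?thesis .
qed

text \<open>The second estimate is for controls switched off shortly before \<open>T\<close>: from
  then on only noise acts, and the expected reward is the Gaussian mean of \<phi> rather than
  \<open>psi\<close>.\<close>

lemma terminal_limit:
  assumes "e > 0"
  obtains d where "d > 0" and "\<And>t x. T - d < t \<Longrightarrow> t \<le> T \<Longrightarrow> \<bar>psi t x - \<phi> x\<bar> \<le> e"
    and "\<And>t x. T - d < t \<Longrightarrow> t \<le> T \<Longrightarrow> \<bar>gauss_smooth (\<sigma> * sqrt (T - t)) \<phi> x - \<phi> x\<bar> \<le> e"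
proof -
  obtain s1 where s1: "s1 > 0" "\<And>s x. 0 \<le> s \<Longrightarrow> s < s1 \<Longrightarrow> \<bar>gauss_smooth s \<phi> x - \<phi> x\<bar> \<le> e"
    using gauss_smooth_uniform_limit[OF phi_measurable phi_bound phi_uc \<open>e > 0\<close>] by blast
  obtain s2 where s2: "s2 > 0" "\<And>s x. 0 \<le> s \<Longrightarrow> s < s2 \<Longrightarrow>
      \<bar>gauss_smooth s (\<lambda>y. exp (\<phi> y)) x - exp (\<phi> x)\<bar> \<le> e * exp (- K)"
    using gauss_smooth_uniform_limit[OF exp_phi_measurable exp_phi_bounds(3) exp_phi_uc, of "e * exp (- K)"] \<open>e > 0\<close> by auto
  \<comment> \<open>\<open>T - t < d\<close> means that the smoothing scale
    \<open>\<sigma> * sqrt (T - t)\<close> is below \<open>min s1 s2\<close>. The tolerance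
    \<open>e * exp (- K)\<close> for \<open>s2\<close> compensates the Lipschitz constant
    \<open>exp K\<close> of \<open>ln\<close> on the range of \<open>u\<close>.\<close>
  define d where "d = (min s1 s2 / \<sigma>)\<^sup>2"
  have sm: "0 \<le> \<sigma> * sqrt (T - t) \<and> \<sigma> * sqrt (T - t) < min s1 s2" if "T - d < t" "t \<le> T" for t
  proof -
    have "sqrt (T - t) < min s1 s2 / \<sigma>"
      using that s1 s2 sigma_pos by (intro real_less_lsqrt) (auto simp: d_def)
    then show ?thesis using sigma_pos that by (simp add: pos_less_divide_eq mult.commute)
  qed
  show thesis
  proof (rule that)
    show "d > 0" using s1 s2 sigma_pos by (simp add: d_def)
    fix t x assume t: "T - d < t" "t \<le> T"
    show "\<bar>gauss_smooth (\<sigma> * sqrt (T - t)) \<phi> x - \<phi> x\<bar> \<le> e" using s1(2) sm[OF t] by simp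
    have "\<bar>psi t x - \<phi> x\<bar> = \<bar>ln (u t x) - ln (exp (\<phi> x))\<bar>" by (simp add: psi_def)
    also have "\<dots> \<le> \<bar>u t x - exp (\<phi> x)\<bar> / exp (- K)"
      by (rule abs_ln_diff_le) (use u_bounds exp_phi_bounds in auto)
    also have "\<dots> \<le> (e * exp (- K)) / exp (- K)"
      using s2(2)[of "\<sigma> * sqrt (T - t)" x] sm[OF t] by (intro divide_right_mono) (auto simp: u_def)
    finally show "\<bar>psi t x - \<phi> x\<bar> \<le> e" by simp
  qed
qed

end

section \<open>Integrals along paths\<close>

lemma set_lint_combine:
  fixes f :: "real \<Rightarrow> real"
  assumes f: "set_integrable lborel {a..c} f" and abc: "a \<le> b" "b \<le> c"
  shows "(LINT s:{a..c}|lborel. f s) = (LINT s:{a..b}|lborel. f s) + (LINT s:{b..c}|lborel. f s)"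
proof -
  have "set_integrable lborel {a..b} f" "set_integrable lborel {b..c} f"
    using f abc by (auto intro!: set_integrable_subset[OF f])
  then show ?thesis
    using set_borel_integral_eq_integral[OF f] abc
    by (simp add: set_borel_integral_eq_integral Henstock_Kurzweil_Integration.integral_combine)
qed

lemma set_lint_continuous:
  fixes f :: "real \<Rightarrow> real"
  assumes f: "set_integrable lborel {a..c} f"
  shows "continuous_on {a..c} (\<lambda>r. LINT s:{a..r}|lborel. f s)"
proof (rule continuous_on_eq)
  show "continuous_on {a..c} (\<lambda>r. integral {a..r} f)"
    by (rule indefinite_integral_continuous_1) (rule set_borel_integral_eq_integral[OF f])
  show "integral {a..r} f = (LINT s:{a..r}|lborel. f s)" if "r \<in> {a..c}" for r
    using that by (intro set_borel_integral_eq_integral(2)[symmetric] set_integrable_subset[OF f]) auto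
qed

lemma set_lint_const_real:
  fixes a b k :: real assumes "a \<le> b" shows "(LINT s:{a..b}|lborel. k) = (b - a) * k"
  using assms by (simp add: set_lebesgue_integral_def)

lemma set_integrable_const_real [simp]: "set_integrable lborel {a..b} (\<lambda>_. k :: real)" for a b :: real
  unfolding set_integrable_def
  by (auto intro!: integrable_mult_left integrable_real_indicator simp: emeasure_lborel_Icc_eq)

lemma set_lint_singleton [simp]: "(LINT s:{a..a}|lborel. f s) = (0::real)" for a :: real
  unfolding set_lebesgue_integral_def
  by (rule integral_eq_zero_AE) (use AE_lborel_singleton[of a] in \<open>auto elim: eventually_mono\<close>)

text \<open>Cauchy-Schwarz against the constant 1, read off from the nonnegativity of the integral
  of \<open>(f s - k)^2\<close> with \<open>k\<close> the mean of \<open>f\<close>.\<close>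

lemma set_lint_square_le:
  fixes f :: "real \<Rightarrow> real"
  assumes f: "set_integrable lborel {a..b} f" and f2: "set_integrable lborel {a..b} (\<lambda>s. (f s)\<^sup>2)"
    and "a < b"
  shows "(LINT s:{a..b}|lborel. f s)\<^sup>2 \<le> (b - a) * (LINT s:{a..b}|lborel. (f s)\<^sup>2)"
proof -
  define A where "A = (LINT s:{a..b}|lborel. f s)"
  define k where "k = A / (b - a)"
  have "0 \<le> (LINT s:{a..b}|lborel. (f s - k)\<^sup>2)"
    unfolding set_lebesgue_integral_def by (intro integral_nonneg_AE) auto
  also have "(LINT s:{a..b}|lborel. (f s - k)\<^sup>2) = (LINT s:{a..b}|lborel. (f s)\<^sup>2 - (2 * k) * f s + k\<^sup>2)"
    by (intro set_lebesgue_integral_cong) (auto simp: power2_diff)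
  also have "\<dots> = (LINT s:{a..b}|lborel. (f s)\<^sup>2) - (2 * k) * A + (b - a) * k\<^sup>2"
    using f f2 \<open>a < b\<close>
    by (simp add: set_integral_add set_integral_diff set_integral_mult_right A_def set_lint_const_real del: mult_2 mult_2_right)
  also have "\<dots> = (LINT s:{a..b}|lborel. (f s)\<^sup>2) - A\<^sup>2 / (b - a)"
  proof -
    have "(b - a) * k = A" using \<open>a < b\<close> by (simp add: k_def)
    then have "(b - a) * k\<^sup>2 = A * k" "A\<^sup>2 / (b - a) = A * k"
      by (simp_all add: k_def power2_eq_square)
    then show ?thesis by simp
  qed
  finally show ?thesis
    using \<open>a < b\<close> by (simp add: A_def field_simps)
qed

lemma sequence_at_left:
  fixes a b :: real
  assumes "a < b"
  obtains c :: "nat \<Rightarrow> real" where "\<And>n. a < c n" "\<And>n. c n < b" "c \<longlonglongrightarrow> b"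
    "filterlim c (at_left b) sequentially" "strict_mono c"
proof -
  \<comment> \<open>The shift by 2 puts already \<open>c 0\<close> strictly between \<open>a\<close>
    and \<open>b\<close>.\<close>
  define c where "c n = b - (b - a) / (real n + 2)" for n
  have "(\<lambda>n. (b - a) / (real n + 2)) \<longlonglongrightarrow> 0"
    using LIMSEQ_ignore_initial_segment[OF lim_const_over_n[of "b - a"], of 2] by (simp add: add.commute)
  then have lim: "c \<longlonglongrightarrow> b"
    unfolding c_def using tendsto_diff[OF tendsto_const[of b]] by fastforce
  have c: "a < c n" "c n < b" for n
    using assms divide_strict_left_mono[of 1 "real n + 2" "b - a"] by (auto simp: c_def)
  moreover have "filterlim c (at_left b) sequentially"
    using lim c(2) by (auto simp: filterlim_at intro!: always_eventually)
  moreover have "strict_mono c"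
    unfolding c_def using assms by (intro strict_monoI diff_strict_left_mono divide_strict_left_mono) auto
  ultimately show thesis using lim by (intro that)
qed

text \<open>Over \<open>n + 1\<close> equal steps of length \<delta> the errors add up to
  \<open>C * (b - a) * sqrt \<delta>\<close>, which vanishes as \<open>n\<close> grows. This turns
  one-step estimates into inequalities between distant times without differentiating in
  time.\<close>

lemma almost_decreasing_imp_le:
  fixes g :: "real \<Rightarrow> real"
  assumes "a \<le> b" "\<eta> > 0"
    and step: "\<And>s s'. a \<le> s \<Longrightarrow> s < s' \<Longrightarrow> s' \<le> b \<Longrightarrow> s' - s \<le> \<eta> \<Longrightarrow> g s' \<le> g s + C * ((s' - s) * sqrt (s' - s))"
  shows "g b \<le> g a"
proof (cases "a = b")
  case False
  with \<open>a \<le> b\<close> have "a < b" by simp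
  define \<delta> where "\<delta> n = (b - a) / real (Suc n)" for n
  have lim: "\<delta> \<longlonglongrightarrow> 0"
    unfolding \<delta>_def using LIMSEQ_Suc[OF lim_const_over_n[of "b - a"]] by simp
  have bound: "g b \<le> g a + C * (b - a) * sqrt (\<delta> n)" if n: "\<delta> n < \<eta>" for n
  proof -
    have "i \<le> Suc n \<Longrightarrow> g (a + real i * \<delta> n) \<le> g a + real i * (C * (\<delta> n * sqrt (\<delta> n)))" for i
    proof (induction i)
      case (Suc i)
      have pos: "\<delta> n > 0" using \<open>a < b\<close> by (simp add: \<delta>_def)
      have "real (Suc i) * \<delta> n \<le> real (Suc n) * \<delta> n"
        using Suc.prems pos by (intro mult_right_mono) auto
      also have "\<dots> = b - a" by (simp add: \<delta>_def)
      finally have "g (a + real (Suc i) * \<delta> n) \<le> g (a + real i * \<delta> n) + C * (\<delta> n * sqrt (\<delta> n))"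
        using step[of "a + real i * \<delta> n" "a + real (Suc i) * \<delta> n"] pos n
        by (simp add: algebra_simps)
      with Suc show ?case by (simp add: algebra_simps)
    qed simp
    from this[of "Suc n"] have "g b \<le> g a + real (Suc n) * (C * (\<delta> n * sqrt (\<delta> n)))"
      by (simp add: \<delta>_def)
    also have "real (Suc n) * (C * (\<delta> n * sqrt (\<delta> n))) = C * (b - a) * sqrt (\<delta> n)"
      by (simp add: \<delta>_def)
    finally show ?thesis .
  qed
  have "(\<lambda>n. g a + C * (b - a) * sqrt (\<delta> n)) \<longlonglongrightarrow> g a + C * (b - a) * sqrt 0"
    by (intro tendsto_intros lim)
  moreover have "eventually (\<lambda>n. g b \<le> g a + C * (b - a) * sqrt (\<delta> n)) sequentially"
    using order_tendstoD(2)[OF lim \<open>\<eta> > 0\<close>] by eventually_elim (rule bound)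
  ultimately show ?thesis
    by (intro tendsto_lowerbound[of _ "g a" sequentially]) auto
qed simp

text \<open>With \<open>w = 2 * L * r^2\<close> the left side is
  \<open>p * A - (1 - w) * A^2 / (2 * r^2)\<close>, whose maximum over \<open>A\<close> is
  \<open>r^2 * p^2 / (2 * (1 - w))\<close>; for \<open>w \<le> 1/2\<close> the factor
  \<open>1 / (1 - w)\<close> is at most \<open>1 + 2 * w\<close>. The term \<open>L * A^2\<close> is
  the Taylor error of \<open>psi\<close>.\<close>

lemma quadratic_control_le:
  fixes p A r L :: real
  assumes "r > 0" "4 * L * r\<^sup>2 \<le> 1" "\<bar>p\<bar> \<le> L"
  shows "p * A + L * A\<^sup>2 - A\<^sup>2 / (2 * r\<^sup>2) \<le> r\<^sup>2 / 2 * p\<^sup>2 + 2 * L ^ 3 * r ^ 4"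
proof -
  have L: "0 \<le> L" using assms(3) by linarith
  define w where "w = 2 * L * r\<^sup>2"
  have w: "0 \<le> w" "w \<le> 1 / 2" using assms L by (auto simp: w_def)
  have "p\<^sup>2 \<le> L\<^sup>2" using power_mono[OF assms(3), of 2] by simp
  have sq: "2 * (A * p * r\<^sup>2) \<le> (1 - w) * A\<^sup>2 + (1 + 2 * w) * (p * r\<^sup>2)\<^sup>2"
  proof -
    have "0 \<le> (sqrt (1 - w) * A - (p * r\<^sup>2) / sqrt (1 - w))\<^sup>2" by simp
    also have "\<dots> = (1 - w) * A\<^sup>2 - 2 * (A * p * r\<^sup>2) + (p * r\<^sup>2)\<^sup>2 / (1 - w)"
      using w by (simp add: power2_diff power_mult_distrib power_divide)
    also have "(p * r\<^sup>2)\<^sup>2 / (1 - w) \<le> (1 + 2 * w) * (p * r\<^sup>2)\<^sup>2"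
    proof -
      have "1 \<le> (1 + 2 * w) * (1 - w)" using w mult_nonneg_nonneg[of w "1 - 2 * w"] by (simp add: algebra_simps)
      then have "(p * r\<^sup>2)\<^sup>2 * 1 \<le> (p * r\<^sup>2)\<^sup>2 * ((1 + 2 * w) * (1 - w))"
        by (intro mult_left_mono) auto
      then show ?thesis using w by (simp add: pos_divide_le_eq mult_ac)
    qed
    finally show ?thesis by simp
  qed
  have "2 * r\<^sup>2 * (p * A + L * A\<^sup>2 - A\<^sup>2 / (2 * r\<^sup>2)) = 2 * (A * p * r\<^sup>2) + w * A\<^sup>2 - A\<^sup>2"
    using \<open>r > 0\<close> by (simp add: w_def algebra_simps)
  also have "\<dots> \<le> (1 + 2 * w) * (p * r\<^sup>2)\<^sup>2" using sq by (simp add: algebra_simps)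
  also have "\<dots> = 2 * r\<^sup>2 * (r\<^sup>2 / 2 * p\<^sup>2 + 2 * L * r ^ 4 * p\<^sup>2)"
    by (simp add: w_def power_mult_distrib algebra_simps power2_eq_square eval_nat_numeral)
  finally have "p * A + L * A\<^sup>2 - A\<^sup>2 / (2 * r\<^sup>2) \<le> r\<^sup>2 / 2 * p\<^sup>2 + 2 * L * r ^ 4 * p\<^sup>2"
    using \<open>r > 0\<close> by (simp add: mult_le_cancel_left_pos)
  also have "2 * L * r ^ 4 * p\<^sup>2 \<le> 2 * L * r ^ 4 * L\<^sup>2"
    using L \<open>p\<^sup>2 \<le> L\<^sup>2\<close> by (intro mult_left_mono) auto
  finally show ?thesis by (simp add: eval_nat_numeral mult_ac)
qed

section \<open>Measurability of controlled states\<close>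

context brownian
begin

text \<open>Progressive measurability lives on the restricted time interval \<open>{0..r}\<close>.
  Clamping the time extends the control to the whole line, where integrals with a parameter are
  measurable; on \<open>{0..r}\<close> nothing changes.\<close>

lemma progressive_clamp_measurable:
  assumes "progressively_measurable F T a" and r: "0 \<le> r" "r \<le> T"
  shows "(\<lambda>(\<omega>, s). a (max 0 (min r s)) \<omega>) \<in> borel_measurable (F r \<Otimes>\<^sub>M borel)"
proof -
  have 1: "(\<lambda>(s, \<omega>). a s \<omega>) \<in> borel_measurable (restrict_space borel {0..r} \<Otimes>\<^sub>M F r)"
    using assms by (auto simp: progressively_measurable_def)
  have 2: "(\<lambda>(\<omega>, s). (max 0 (min r s), \<omega>)) \<in> measurable (F r \<Otimes>\<^sub>M borel) (restrict_space borel {0..r} \<Otimes>\<^sub>M F r)"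
  proof -
    have [measurable]: "(\<lambda>s. max 0 (min r s)) \<in> borel \<rightarrow>\<^sub>M restrict_space borel {0..r}"
      using r by (intro measurable_restrict_space2) auto
    show ?thesis by measurable
  qed
  show ?thesis
    using measurable_compose[OF 2 1] by (simp add: case_prod_unfold)
qed

lemma progressive_integral_measurable:
  assumes a: "progressively_measurable F T a" and t: "0 \<le> t" "t \<le> r" "r \<le> T"
  shows "(\<lambda>\<omega>. LINT s:{t..r}|lborel. a s \<omega>) \<in> borel_measurable (F r)"
proof -
  have [measurable]: "(\<lambda>(\<omega>, s). a (max 0 (min r s)) \<omega>) \<in> borel_measurable (F r \<Otimes>\<^sub>M borel)"
    using progressive_clamp_measurable[OF a, of r] t by simp
  have "(\<lambda>\<omega>. LINT s|lborel. indicator {t..r} s * a (max 0 (min r s)) \<omega>) \<in> borel_measurable (F r)"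
    by measurable
  also have "(\<lambda>\<omega>. LINT s|lborel. indicator {t..r} s * a (max 0 (min r s)) \<omega>) = (\<lambda>\<omega>. LINT s:{t..r}|lborel. a s \<omega>)"
    unfolding set_lebesgue_integral_def using t
    by (intro ext Bochner_Integration.integral_cong) (auto simp: indicator_def max_def min_def)
  finally show ?thesis .
qed

lemma progressive_square:
  "progressively_measurable F T a \<Longrightarrow> progressively_measurable F T (\<lambda>s \<omega>. (a s \<omega>)\<^sup>2)"
  unfolding progressively_measurable_def case_prod_unfold by (auto intro: borel_measurable_power)

lemma controlled_state_adapted:
  assumes "progressively_measurable F T a" and t: "0 \<le> t" "t \<le> r" "r \<le> T"
  shows "controlled_state B \<sigma> t x a r \<in> borel_measurable (F r)"
proof -
  have [measurable]: "B t \<in> borel_measurable (F r)" "B r \<in> borel_measurable (F r)"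
    using t by (auto intro: B_adapted')
  note [measurable] = progressive_integral_measurable[OF assms]
  show ?thesis unfolding controlled_state_def[abs_def] by measurable
qed

end

section \<open>The upper bound for arbitrary controls\<close>

context terminal_reward
begin

text \<open>A discrete Hamilton-Jacobi-Bellman equation. The squared derivative is placed under the
  Gaussian mean, at the cost of one more error of order \<open>r ^ 3\<close>, because both bounds
  below compare pathwise with a function of the state after the noise. \<open>L\<close> is returned
  together with \<open>C\<close> so that all estimates of a step share it.\<close>

lemma one_step:
  assumes "e > 0"
  obtains L C where "C \<ge> 0" and "\<And>t. t \<le> T - e \<Longrightarrow> C11 L (psi t) (psi_deriv t)"
    and "\<And>t t' x. t \<le> t' \<Longrightarrow> t' \<le> T - e \<Longrightarrow> \<bar>psi_deriv t x - psi_deriv t' x\<bar> \<le> L * sqrt (t' - t)"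
    and "\<And>s s' x r. s \<le> s' \<Longrightarrow> s' \<le> T - e \<Longrightarrow> r = \<sigma> * sqrt (s' - s) \<Longrightarrow> r \<le> 1 \<Longrightarrow>
      \<bar>gauss_smooth r (\<lambda>y. psi s' y + r\<^sup>2 / 2 * (psi_deriv s' y)\<^sup>2) x - psi s x\<bar> \<le> C * r ^ 3"
proof -
  obtain L where L: "\<And>t. t \<le> T - e \<Longrightarrow> C11 L (psi t) (psi_deriv t)"
    and Lt: "\<And>t t' x. t \<le> t' \<Longrightarrow> t' \<le> T - e \<Longrightarrow> \<bar>psi_deriv t x - psi_deriv t' x\<bar> \<le> L * sqrt (t' - t)"
    using psi_regular[OF assms] by metis
  have "L \<ge> 0" using C11_nonneg[OF L[of "T - e"]] by simp
  obtain C where C: "C \<ge> 0" "\<And>\<psi> \<psi>' s x. C11 L \<psi> \<psi>' \<Longrightarrow> 0 \<le> s \<Longrightarrow> s \<le> 1 \<Longrightarrow>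
      \<bar>ln (gauss_smooth s (\<lambda>y. exp (\<psi> y)) x) - gauss_smooth s \<psi> x - s\<^sup>2 / 2 * (\<psi>' x)\<^sup>2\<bar> \<le> C * s ^ 3"
    using log_gauss_smooth_expansion[OF \<open>L \<ge> 0\<close>] by metis
  have step: "\<bar>gauss_smooth r (\<lambda>y. psi s' y + r\<^sup>2 / 2 * (psi_deriv s' y)\<^sup>2) x - psi s x\<bar> \<le> (C + L\<^sup>2 * abs_moment 1) * r ^ 3"
    if s: "s \<le> s'" "s' \<le> T - e" and r: "r = \<sigma> * sqrt (s' - s)" "r \<le> 1" for s s' x r
  proof -
    note reg = L[OF s(2)]
    have r0: "0 \<le> r" using s sigma_pos by (simp add: r)
    have sq: "\<bar>gauss_smooth r (\<lambda>y. (psi_deriv s' y)\<^sup>2) x - (psi_deriv s' x)\<^sup>2\<bar> \<le> (2 * L\<^sup>2) * abs_moment 1 * r"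
      by (rule gauss_smooth_close[OF _ C11_deriv_square_bound[OF reg] C11_deriv_square_lipschitz[OF reg] r0])
        measurable
    have "psi s x = ln (gauss_smooth r (\<lambda>y. exp (psi s' y)) x)"
      unfolding r by (rule psi_semigroup) (use s assms in auto)
    moreover note C(2)[OF reg r0 r(2), of x]
    moreover have "gauss_smooth r (\<lambda>y. psi s' y + r\<^sup>2 / 2 * (psi_deriv s' y)\<^sup>2) x =
      gauss_smooth r (psi s') x + r\<^sup>2 / 2 * gauss_smooth r (\<lambda>y. (psi_deriv s' y)\<^sup>2) x"
    proof (subst gauss_smooth_add[where K=K and K'="r\<^sup>2 / 2 * L\<^sup>2"])
      show "\<bar>r\<^sup>2 / 2 * (psi_deriv s' y)\<^sup>2\<bar> \<le> r\<^sup>2 / 2 * L\<^sup>2" for y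
        using C11_deriv_square_bound[OF reg, of y] unfolding abs_mult by (intro mult_mono) auto
      show "gauss_smooth r (psi s') x + gauss_smooth r (\<lambda>y. r\<^sup>2 / 2 * (psi_deriv s' y)\<^sup>2) x =
        gauss_smooth r (psi s') x + r\<^sup>2 / 2 * gauss_smooth r (\<lambda>y. (psi_deriv s' y)\<^sup>2) x"
        by (simp only: gauss_smooth_cmult)
    qed (auto simp: psi_bound)
    moreover have "\<bar>r\<^sup>2 / 2 * gauss_smooth r (\<lambda>y. (psi_deriv s' y)\<^sup>2) x - r\<^sup>2 / 2 * (psi_deriv s' x)\<^sup>2\<bar> \<le> L\<^sup>2 * abs_moment 1 * r ^ 3"
    proof -
      have "\<bar>r\<^sup>2 / 2 * gauss_smooth r (\<lambda>y. (psi_deriv s' y)\<^sup>2) x - r\<^sup>2 / 2 * (psi_deriv s' x)\<^sup>2\<bar>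
        = r\<^sup>2 / 2 * \<bar>gauss_smooth r (\<lambda>y. (psi_deriv s' y)\<^sup>2) x - (psi_deriv s' x)\<^sup>2\<bar>"
        by (simp only: right_diff_distrib[symmetric] abs_mult) simp
      also have "\<dots> \<le> r\<^sup>2 / 2 * ((2 * L\<^sup>2) * abs_moment 1 * r)"
        by (intro mult_left_mono sq) simp
      finally show ?thesis by (simp add: power2_eq_square power3_eq_cube mult_ac)
    qed
    ultimately show ?thesis unfolding distrib_right by linarith
  qed
  have "0 \<le> C + L\<^sup>2 * abs_moment 1" using C(1) abs_moment_nonneg by simp
  then show thesis by (rule that[OF _ L Lt step])
qed

text \<open>Within a time step the control may depend on the Brownian increment. The anticipating
  maximum over the displacement \<open>A\<close> still exceeds the value only by a negligible amount.\<close>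

lemma control_upper_bound:
  assumes prog: "progressively_measurable F T a" and t0: "0 \<le> t0" "t0 < T"
    and int1: "AE \<omega> in M. set_integrable lborel {t0..T} (\<lambda>s. a s \<omega>)"
    and int2: "AE \<omega> in M. set_integrable lborel {t0..T} (\<lambda>s. (a s \<omega>)\<^sup>2)"
    and energy: "integrable M (\<lambda>\<omega>. LINT s:{t0..T}|lborel. (a s \<omega>)\<^sup>2)"
  shows "(\<integral>\<omega>. \<phi> (controlled_state B \<sigma> t0 x a T \<omega>) \<partial>M)
    - (\<integral>\<omega>. (LINT s:{t0..T}|lborel. (a s \<omega>)\<^sup>2) \<partial>M) / (2 * \<sigma>\<^sup>2) \<le> psi t0 x"
proof -
  define X where "X = controlled_state B \<sigma> t0 x a"
  define en where "en r \<omega> = (LINT s:{t0..r}|lborel. (a s \<omega>)\<^sup>2)" for r \<omega>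
  have X_F: "X r \<in> borel_measurable (F r)" if "t0 \<le> r" "r \<le> T" for r
    unfolding X_def using prog t0 that by (intro controlled_state_adapted)
  have X_M [measurable]: "X r \<in> borel_measurable M" if "t0 \<le> r" "r \<le> T" for r
    by (rule measurable_F_M[OF X_F[OF that]]) (use that t0 in auto)
  have en_M [measurable]: "en r \<in> borel_measurable M" if "t0 \<le> r" "r \<le> T" for r
    unfolding en_def[abs_def] using that t0
    by (intro measurable_F_M[of _ r] progressive_integral_measurable[OF progressive_square[OF prog]]) auto
  have en_mono: "AE \<omega> in M. 0 \<le> en r \<omega> \<and> en r \<omega> \<le> en T \<omega>" if "t0 \<le> r" "r \<le> T" for r
    using int2
  proof eventually_elim
    case (elim \<omega>)
    have "en T \<omega> = en r \<omega> + (LINT s:{r..T}|lborel. (a s \<omega>)\<^sup>2)"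
      unfolding en_def using elim that by (intro set_lint_combine)
    moreover have "0 \<le> (LINT s:{r..T}|lborel. (a s \<omega>)\<^sup>2)" "0 \<le> en r \<omega>"
      unfolding set_lebesgue_integral_def en_def by (auto intro!: integral_nonneg_AE)
    ultimately show ?case by simp
  qed
  have en_int: "integrable M (en r)" if "t0 \<le> r" "r \<le> T" for r
  proof (rule Bochner_Integration.integrable_bound)
    show "integrable M (en T)" using energy by (simp add: en_def[abs_def])
    show "AE \<omega> in M. norm (en r \<omega>) \<le> norm (en T \<omega>)"
      using en_mono[OF that] by eventually_elim auto
  qed (use that in measurable)
  have bounded_int: "integrable M (\<lambda>\<omega>. f (X r \<omega>))"
    if "t0 \<le> r" "r \<le> T" "\<And>y. \<bar>f y\<bar> \<le> K'" "f \<in> borel_measurable borel" for r and f :: "real \<Rightarrow> real" and K'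
    by (rule integrable_const_bound[where B=K']) (use that in auto)

  have sub: "(\<integral>\<omega>. psi (T - e) (X (T - e) \<omega>) \<partial>M) - (\<integral>\<omega>. en (T - e) \<omega> \<partial>M) / (2 * \<sigma>\<^sup>2) \<le> psi t0 x"
    if e: "0 < e" "e < T - t0" for e
  proof -
    obtain L C where C: "C \<ge> 0" and reg: "\<And>t. t \<le> T - e \<Longrightarrow> C11 L (psi t) (psi_deriv t)"
      and "\<And>t t' x. t \<le> t' \<Longrightarrow> t' \<le> T - e \<Longrightarrow> \<bar>psi_deriv t x - psi_deriv t' x\<bar> \<le> L * sqrt (t' - t)"
      and one: "\<And>s s' x r. s \<le> s' \<Longrightarrow> s' \<le> T - e \<Longrightarrow> r = \<sigma> * sqrt (s' - s) \<Longrightarrow> r \<le> 1 \<Longrightarrow>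
        \<bar>gauss_smooth r (\<lambda>y. psi s' y + r\<^sup>2 / 2 * (psi_deriv s' y)\<^sup>2) x - psi s x\<bar> \<le> C * r ^ 3"
      by (rule one_step[OF e(1)], rule that, assumption+)
    have L: "L \<ge> 0" using C11_nonneg[OF reg[of "T - e"]] by simp
    define g where "g s = (\<integral>\<omega>. psi s (X s \<omega>) \<partial>M) - (\<integral>\<omega>. en s \<omega> \<partial>M) / (2 * \<sigma>\<^sup>2)" for s
    \<comment> \<open>Chosen so that \<open>r^2 * (1 + 4 * L) \<le> 1\<close>, which contains both
      \<open>r \<le> 1\<close> for \<open>one_step\<close> and \<open>4 * L * r^2 \<le> 1\<close>
      for \<open>quadratic_control_le\<close>.\<close>
    define \<eta> where "\<eta> = 1 / (\<sigma>\<^sup>2 * (1 + 4 * L))"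
    have "g (T - e) \<le> g t0"
    proof (rule almost_decreasing_imp_le[where g=g and a=t0 and b="T - e" and \<eta>=\<eta> and C="(C + 2 * L ^ 3) * \<sigma> ^ 3"])
      show "\<eta> > 0" using sigma_pos L by (simp add: \<eta>_def)
      fix s s' assume s: "t0 \<le> s" "s < s'" "s' \<le> T - e" "s' - s \<le> \<eta>"
      define r where "r = \<sigma> * sqrt (s' - s)"
      have r2: "r\<^sup>2 = \<sigma>\<^sup>2 * (s' - s)" using s by (simp add: r_def power_mult_distrib)
      have r_small: "r\<^sup>2 * (1 + 4 * L) \<le> 1"
        using mult_left_mono[OF s(4), of "\<sigma>\<^sup>2 * (1 + 4 * L)"] sigma_pos L by (simp add: r2 \<eta>_def mult_ac)
      have r: "r > 0" using sigma_pos s by (simp add: r_def)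
      have "0 \<le> 4 * L * r\<^sup>2" using L by simp
      moreover have "r\<^sup>2 + 4 * L * r\<^sup>2 \<le> 1" using r_small by (simp add: algebra_simps)
      ultimately have r_small': "4 * L * r\<^sup>2 \<le> 1" "r\<^sup>2 \<le> 1"
        using zero_le_power2[of r] by linarith+
      have r1: "r \<le> 1" using r_small'(2) r by (simp add: power_le_one_iff)
      note reg' = reg[OF s(3)]
      define G where "G y = psi s' y + r\<^sup>2 / 2 * (psi_deriv s' y)\<^sup>2" for y
      have [measurable]: "G \<in> borel_measurable borel" unfolding G_def[abs_def] by measurable
      have G_bound: "\<bar>G y\<bar> \<le> K + r\<^sup>2 / 2 * L\<^sup>2" for y
      proof -
        have "\<bar>r\<^sup>2 / 2 * (psi_deriv s' y)\<^sup>2\<bar> \<le> r\<^sup>2 / 2 * L\<^sup>2"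
          using C11_deriv_square_bound[OF reg', of y] unfolding abs_mult by (intro mult_mono) auto
        then show ?thesis using psi_bound[of s' y] unfolding G_def by linarith
      qed
      have ss: "t0 \<le> s'" "s \<le> T" "s' \<le> T" using s e by auto
      \<comment> \<open>\<open>Y\<close> is the state after the noise alone and \<open>A\<close> the
        displacement due to the control. By Cauchy-Schwarz the energy of the step is at least
        \<open>A^2 / (s' - s)\<close>; \<open>psi s'\<close> is expanded at \<open>Y\<close>, and
        the worst \<open>A\<close> is taken for each \<omega>, so the joint law of control and noise
        never enters.\<close>
      have path: "AE \<omega> in M. psi s' (X s' \<omega>) - (en s' \<omega> - en s \<omega>) / (2 * \<sigma>\<^sup>2)
          \<le> G (X s \<omega> + \<sigma> * (B s' \<omega> - B s \<omega>)) + 2 * L ^ 3 * r ^ 4"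
        using int1 int2
      proof eventually_elim
        case (elim \<omega>)
        define A where "A = (LINT q:{s..s'}|lborel. a q \<omega>)"
        define Y where "Y = X s \<omega> + \<sigma> * (B s' \<omega> - B s \<omega>)"
        have i1: "set_integrable lborel {t0..s'} (\<lambda>q. a q \<omega>)" "set_integrable lborel {s..s'} (\<lambda>q. a q \<omega>)"
          using s ss by (auto intro!: set_integrable_subset[OF elim(1)])
        have i2: "set_integrable lborel {t0..s'} (\<lambda>q. (a q \<omega>)\<^sup>2)" "set_integrable lborel {s..s'} (\<lambda>q. (a q \<omega>)\<^sup>2)"
          using s ss by (auto intro!: set_integrable_subset[OF elim(2)])
        have X': "X s' \<omega> = Y + A"
          unfolding X_def controlled_state_def Y_def A_def
          using set_lint_combine[OF i1(1), of s] s by (simp add: algebra_simps)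
        have "A\<^sup>2 \<le> (s' - s) * (en s' \<omega> - en s \<omega>)"
          using set_lint_square_le[OF i1(2) i2(2) s(2)] set_lint_combine[OF i2(1), of s] s
          by (simp add: A_def en_def)
        then have "A\<^sup>2 / (2 * r\<^sup>2) \<le> ((s' - s) * (en s' \<omega> - en s \<omega>)) / (2 * r\<^sup>2)"
          by (intro divide_right_mono) auto
        also have "\<dots> = (en s' \<omega> - en s \<omega>) / (2 * \<sigma>\<^sup>2)"
          using s sigma_pos by (simp add: r2)
        finally have "A\<^sup>2 / (2 * r\<^sup>2) \<le> (en s' \<omega> - en s \<omega>) / (2 * \<sigma>\<^sup>2)" .
        moreover have "psi s' (Y + A) \<le> psi s' Y + psi_deriv s' Y * A + L * A\<^sup>2"
          using C11_taylor[OF reg', of Y A] by linarith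
        moreover have "psi_deriv s' Y * A + L * A\<^sup>2 - A\<^sup>2 / (2 * r\<^sup>2) \<le> r\<^sup>2 / 2 * (psi_deriv s' Y)\<^sup>2 + 2 * L ^ 3 * r ^ 4"
          by (rule quadratic_control_le) (use r r_small' C11_deriv_bound[OF reg'] in auto)
        ultimately show ?case unfolding X' G_def Y_def[symmetric] by linarith
      qed
      have [measurable]: "X s \<in> borel_measurable M" "B s' \<in> borel_measurable M" "B s \<in> borel_measurable M"
        using s ss t0 by (auto intro!: X_M B_measurable)
      have intG: "integrable M (\<lambda>\<omega>. G (X s \<omega> + \<sigma> * (B s' \<omega> - B s \<omega>)))"
        by (rule integrable_const_bound[where B="K + r\<^sup>2 / 2 * L\<^sup>2"]) (use G_bound in auto)
      have ipsi: "integrable M (\<lambda>\<omega>. psi s' (X s' \<omega>))" "integrable M (\<lambda>\<omega>. psi s (X s \<omega>))"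
        using s ss by (auto intro!: bounded_int psi_bound)
      have ien: "integrable M (en s')" "integrable M (en s)" using s ss by (auto intro!: en_int)
      have "(\<integral>\<omega>. psi s' (X s' \<omega>) - (en s' \<omega> - en s \<omega>) / (2 * \<sigma>\<^sup>2) \<partial>M)
        \<le> (\<integral>\<omega>. G (X s \<omega> + \<sigma> * (B s' \<omega> - B s \<omega>)) + 2 * L ^ 3 * r ^ 4 \<partial>M)"
        by (intro integral_mono_AE path Bochner_Integration.integrable_add Bochner_Integration.integrable_diff
            integrable_divide_zero intG ipsi ien integrable_const)
      also have "(\<integral>\<omega>. psi s' (X s' \<omega>) - (en s' \<omega> - en s \<omega>) / (2 * \<sigma>\<^sup>2) \<partial>M)
        = (\<integral>\<omega>. psi s' (X s' \<omega>) \<partial>M) - ((\<integral>\<omega>. en s' \<omega> \<partial>M) - (\<integral>\<omega>. en s \<omega> \<partial>M)) / (2 * \<sigma>\<^sup>2)"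
        using ipsi ien by (simp add: Bochner_Integration.integral_diff)
      also have "(\<integral>\<omega>. G (X s \<omega> + \<sigma> * (B s' \<omega> - B s \<omega>)) + 2 * L ^ 3 * r ^ 4 \<partial>M)
        = (\<integral>\<omega>. gauss_smooth r G (X s \<omega>) \<partial>M) + 2 * L ^ 3 * r ^ 4"
        using intG increment_expectation[of s s' "X s" G "K + r\<^sup>2 / 2 * L\<^sup>2" \<sigma>] G_bound s ss t0 prob_space X_F[of s]
        by (simp add: r_def)
      also have "(\<integral>\<omega>. gauss_smooth r G (X s \<omega>) \<partial>M) \<le> (\<integral>\<omega>. psi s (X s \<omega>) + C * r ^ 3 \<partial>M)"
      proof (intro integral_mono Bochner_Integration.integrable_add ipsi integrable_const)
        show "integrable M (\<lambda>\<omega>. gauss_smooth r G (X s \<omega>))"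
          using s ss by (intro bounded_int[OF _ _ gauss_smooth_bound[OF _ G_bound]]) auto
        show "gauss_smooth r G (X s \<omega>) \<le> psi s (X s \<omega>) + C * r ^ 3" for \<omega>
          using one[of s s' r "X s \<omega>"] s r_def r1 unfolding G_def[abs_def] by auto
      qed
      also have "\<dots> = (\<integral>\<omega>. psi s (X s \<omega>) \<partial>M) + C * r ^ 3"
        using ipsi prob_space by simp
      finally have "g s' \<le> g s + C * r ^ 3 + 2 * L ^ 3 * r ^ 4"
        unfolding g_def by (simp add: diff_divide_distrib)
      also have "2 * L ^ 3 * r ^ 4 \<le> 2 * L ^ 3 * r ^ 3"
        using L r r1 by (intro mult_left_mono power_decreasing) auto
      also have "g s + C * r ^ 3 + 2 * L ^ 3 * r ^ 3 = g s + ((C + 2 * L ^ 3) * \<sigma> ^ 3) * ((s' - s) * sqrt (s' - s))"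
        using s by (simp add: r_def power_mult_distrib power3_eq_cube algebra_simps)
      finally show "g s' \<le> g s + ((C + 2 * L ^ 3) * \<sigma> ^ 3) * ((s' - s) * sqrt (s' - s))" by simp
    qed (use e in simp)
    also have "g t0 = psi t0 x"
      by (simp only: g_def X_def controlled_state_def en_def set_lint_singleton) (simp add: prob_space)
    finally show ?thesis unfolding g_def .
  qed

  obtain d where d: "\<And>n. t0 < d n" "\<And>n. d n < T" and d_lim: "d \<longlonglongrightarrow> T"
    and "filterlim d (at_left T) sequentially" and "strict_mono d"
    using sequence_at_left[OF t0(2)] by metis
  have lim: "(\<lambda>n. \<integral>\<omega>. \<phi> (X (d n) \<omega>) \<partial>M) \<longlonglongrightarrow> (\<integral>\<omega>. \<phi> (X T \<omega>) \<partial>M)"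
  proof (rule integral_dominated_convergence[where w="\<lambda>_. K"])
    have r: "t0 \<le> d n" "d n \<le> T" for n
      using d(1)[of n] d(2)[of n] by auto
    show "AE \<omega> in M. (\<lambda>n. \<phi> (X (d n) \<omega>)) \<longlonglongrightarrow> \<phi> (X T \<omega>)"
      using int1 AE_space
    proof eventually_elim
      case (elim \<omega>)
      have "continuous_on {t0..T} (\<lambda>q. X q \<omega>)"
        unfolding X_def controlled_state_def
        by (intro continuous_intros set_lint_continuous elim(1) continuous_on_subset[OF B_continuous[OF elim(2)]])
          (use t0 in auto)
      then have "continuous_on {t0..T} (\<lambda>q. \<phi> (X q \<omega>))"
        by (rule continuous_on_compose2[OF uniformly_continuous_imp_continuous[OF phi_uc]]) auto
      then show ?case
        by (rule continuous_on_tendsto_compose[OF _ d_lim]) (use r t0 in auto)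
    qed
    show "(\<lambda>\<omega>. \<phi> (X (d n) \<omega>)) \<in> borel_measurable M" for n
      using X_M[OF r(1) r(2)] by measurable
    show "AE \<omega> in M. norm (\<phi> (X (d n) \<omega>)) \<le> K" for n using phi_bound by simp
  qed (use t0 in \<open>auto intro!: X_M\<close>)

  \<comment> \<open>At time \<open>T - q\<close> the function \<open>psi\<close> may be exchanged
    for \<phi> up to \<open>e\<close>, uniformly in space, and the energy spent so far is at most
    the total. Both are compatible with the direction of the inequality as \<open>q\<close> tends to
    0.\<close>
  have "(\<integral>\<omega>. \<phi> (X T \<omega>) \<partial>M) \<le> psi t0 x + (\<integral>\<omega>. en T \<omega> \<partial>M) / (2 * \<sigma>\<^sup>2)"
  proof (rule field_le_epsilon)
    fix e :: real assume "e > 0"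
    obtain b where b: "b > 0" "\<And>t x. T - b < t \<Longrightarrow> t \<le> T \<Longrightarrow> \<bar>psi t x - \<phi> x\<bar> \<le> e"
      using terminal_limit[OF \<open>e > 0\<close>] by metis
    have "T - b < T" using b(1) by simp
    from order_tendstoD(1)[OF d_lim this]
    have "eventually (\<lambda>n. (\<integral>\<omega>. \<phi> (X (d n) \<omega>) \<partial>M)
      \<le> psi t0 x + (\<integral>\<omega>. en T \<omega> \<partial>M) / (2 * \<sigma>\<^sup>2) + e) sequentially"
    proof eventually_elim
      case (elim n)
      define q where "q = T - d n"
      have q: "0 < q" "q < T - t0" "q < b" using elim d(1)[of n] d(2)[of n] by (auto simp: q_def)
      have "(\<integral>\<omega>. \<phi> (X (T - q) \<omega>) \<partial>M) \<le> (\<integral>\<omega>. psi (T - q) (X (T - q) \<omega>) + e \<partial>M)"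
      proof (intro integral_mono Bochner_Integration.integrable_add integrable_const)
        show "integrable M (\<lambda>\<omega>. \<phi> (X (T - q) \<omega>))" "integrable M (\<lambda>\<omega>. psi (T - q) (X (T - q) \<omega>))"
          using q phi_bound psi_bound by (auto intro!: bounded_int)
        show "\<phi> (X (T - q) \<omega>) \<le> psi (T - q) (X (T - q) \<omega>) + e" for \<omega>
          using b(2)[of "T - q" "X (T - q) \<omega>"] q by auto
      qed
      also have "\<dots> = (\<integral>\<omega>. psi (T - q) (X (T - q) \<omega>) \<partial>M) + e"
        using q psi_bound prob_space by (subst Bochner_Integration.integral_add) (auto intro!: bounded_int)
      also have "(\<integral>\<omega>. psi (T - q) (X (T - q) \<omega>) \<partial>M) \<le> psi t0 x + (\<integral>\<omega>. en (T - q) \<omega> \<partial>M) / (2 * \<sigma>\<^sup>2)"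
        using sub[OF q(1,2)] by simp
      also have "(\<integral>\<omega>. en (T - q) \<omega> \<partial>M) \<le> (\<integral>\<omega>. en T \<omega> \<partial>M)"
        using en_mono[of "T - q"] q t0 by (intro integral_mono_AE en_int) (auto elim: eventually_mono)
      finally show ?case by (simp add: q_def divide_right_mono)
    qed
    with lim show "(\<integral>\<omega>. \<phi> (X T \<omega>) \<partial>M) \<le> psi t0 x + (\<integral>\<omega>. en T \<omega> \<partial>M) / (2 * \<sigma>\<^sup>2) + e"
      by (intro tendsto_upperbound) auto
  qed
  then show ?thesis by (simp add: X_def en_def)
qed

end

section \<open>Pathwise solution of the state equation\<close>

lemma set_lint_abs_le:
  fixes f :: "real \<Rightarrow> real"
  assumes f: "set_integrable lborel {a..b} f" and g: "set_integrable lborel {a..b} g"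
    and le: "\<And>s. s \<in> {a..b} \<Longrightarrow> \<bar>f s\<bar> \<le> g s"
  shows "\<bar>LINT s:{a..b}|lborel. f s\<bar> \<le> (LINT s:{a..b}|lborel. g s)"
proof -
  have "\<bar>LINT s:{a..b}|lborel. f s\<bar> \<le> (LINT s|lborel. \<bar>indicator {a..b} s *\<^sub>R f s\<bar>)"
    unfolding set_lebesgue_integral_def by (rule integral_abs_bound)
  also have "\<dots> \<le> (LINT s:{a..b}|lborel. g s)"
    using f g le unfolding set_lebesgue_integral_def set_integrable_def
    by (intro integral_mono integrable_abs) (auto simp: indicator_def)
  finally show ?thesis .
qed

lemma set_lint_abs_le_const:
  fixes f :: "real \<Rightarrow> real"
  assumes "set_integrable lborel {a..b} f" "\<And>s. s \<in> {a..b} \<Longrightarrow> \<bar>f s\<bar> \<le> k" "a \<le> b"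
  shows "\<bar>LINT s:{a..b}|lborel. f s\<bar> \<le> (b - a) * k"
  using set_lint_abs_le[OF assms(1) set_integrable_const_real, of k] assms(2,3)
  by (simp add: set_lint_const_real)

lemma continuous_on_Ico:
  fixes f :: "real \<Rightarrow> real"
  assumes "\<And>c. c < b \<Longrightarrow> continuous_on {a..c} f"
  shows "continuous_on {a..<b} f"
  unfolding continuous_on_eq_continuous_within
proof
  fix x assume x: "x \<in> {a..<b}"
  then obtain c where c: "x < c" "c < b" using dense[of x b] by auto
  have "continuous (at x within {a..c}) f"
    using assms[OF c(2)] x c by (auto simp: continuous_on_eq_continuous_within)
  moreover have "at x within {a..c} = at x within {a..<b}"
    by (rule at_within_nhd[of x "{..<c}"]) (use c x in auto)
  ultimately show "continuous (at x within {a..<b}) f" by simp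
qed

lemma set_lint_continuous_Ico:
  fixes f :: "real \<Rightarrow> real"
  assumes "continuous_on {a..<b} f"
  shows "continuous_on {a..<b} (\<lambda>r. LINT s:{a..r}|lborel. f s)"
proof (rule continuous_on_Ico)
  fix c assume "c < b"
  then show "continuous_on {a..c} (\<lambda>r. LINT s:{a..r}|lborel. f s)"
    by (intro set_lint_continuous borel_integrable_atLeastAtMost' continuous_on_subset[OF assms]) auto
qed

text \<open>With additive noise the state equation is, for each \<omega>, a Volterra equation with
  forcing \<open>w\<close>. The Lipschitz constant may depend on \<open>c\<close>, since it explodes
  as \<open>c\<close> approaches \<open>T\<close>. Continuity is assumed directly in the form in
  which it is used, along continuous paths.\<close>

locale path_ode =
  fixes b :: "real \<Rightarrow> real \<Rightarrow> real" and t0 T :: real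
  assumes drift_continuous: "\<And>c x. c < T \<Longrightarrow> continuous_on {t0..c} x \<Longrightarrow> continuous_on {t0..c} (\<lambda>s. b s (x s))"
    and drift_lipschitz: "\<And>c. c < T \<Longrightarrow> \<exists>L. \<forall>s\<in>{t0..c}. \<forall>x y. \<bar>b s x - b s y\<bar> \<le> L * \<bar>x - y\<bar>"
begin

primrec picard :: "(real \<Rightarrow> real) \<Rightarrow> nat \<Rightarrow> real \<Rightarrow> real" where
  "picard w 0 = w"
| "picard w (Suc n) = (\<lambda>r. w r + (LINT s:{t0..r}|lborel. b s (picard w n s)))"

lemma drift_continuous_Ico:
  assumes "continuous_on {t0..<T} x" shows "continuous_on {t0..<T} (\<lambda>s. b s (x s))"
  using assms by (intro continuous_on_Ico drift_continuous) (auto elim: continuous_on_subset)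

lemma picard_continuous:
  assumes "continuous_on {t0..<T} w" shows "continuous_on {t0..<T} (picard w n)"
  by (induction n) (auto intro!: continuous_intros assms set_lint_continuous_Ico drift_continuous_Ico)

definition solution :: "(real \<Rightarrow> real) \<Rightarrow> real \<Rightarrow> real" where
  "solution w r = lim (\<lambda>n. picard w n r)"

context
  fixes w :: "real \<Rightarrow> real"
  assumes w: "continuous_on {t0..<T} w"
begin

lemma drift_integrable:
  assumes "continuous_on {t0..<T} x" "r < T"
  shows "set_integrable lborel {t0..r} (\<lambda>s. b s (x s))"
  by (rule borel_integrable_atLeastAtMost', rule continuous_on_subset[OF drift_continuous_Ico[OF assms(1)]])
    (use assms in auto)

text \<open>In the norm with weight \<open>exp (- 2 * L * (r - t0))\<close> the Picard map contracts
  by 1/2, whatever the length of the interval; hence no subdivision of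
  \<open>{t0..c}\<close>.\<close>

lemma picard_difference:
  assumes c: "c < T" and L: "L > 0" "\<And>s x y. s \<in> {t0..c} \<Longrightarrow> \<bar>b s x - b s y\<bar> \<le> L * \<bar>x - y\<bar>"
    and K: "\<And>r. r \<in> {t0..c} \<Longrightarrow> \<bar>picard w 1 r - picard w 0 r\<bar> \<le> K" and "K \<ge> 0"
  shows "r \<in> {t0..c} \<Longrightarrow> \<bar>picard w (Suc n) r - picard w n r\<bar> \<le> K * (1 / 2) ^ n * exp (2 * L * (r - t0))"
proof (induction n arbitrary: r)
  case 0
  have "K * 1 \<le> K * exp (2 * L * (r - t0))"
    using L 0 \<open>K \<ge> 0\<close> by (intro mult_left_mono) auto
  then show ?case using K[OF 0] by simp
next
  case (Suc n)
  let ?g = "\<lambda>s. L * (K * (1 / 2) ^ n * exp (2 * L * (s - t0)))"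
  have int: "set_integrable lborel {t0..r} (\<lambda>s. b s (picard w n s))" for n
    using Suc.prems c by (intro drift_integrable picard_continuous w) auto
  have eq: "picard w (Suc (Suc n)) r - picard w (Suc n) r
    = (LINT s:{t0..r}|lborel. b s (picard w (Suc n) s) - b s (picard w n s))"
    using int[of "Suc n"] int[of n] by (simp add: set_integral_diff)
  have "\<bar>picard w (Suc (Suc n)) r - picard w (Suc n) r\<bar> \<le> (LINT s:{t0..r}|lborel. ?g s)"
    unfolding eq
  proof (rule set_lint_abs_le)
    show "set_integrable lborel {t0..r} (\<lambda>s. b s (picard w (Suc n) s) - b s (picard w n s))"
      using int[of "Suc n"] int[of n] by (rule set_integral_diff)
    show "set_integrable lborel {t0..r} ?g"
      by (intro borel_integrable_atLeastAtMost' continuous_intros)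
    fix s assume s: "s \<in> {t0..r}"
    then have s': "s \<in> {t0..c}" using Suc.prems by auto
    have "\<bar>b s (picard w (Suc n) s) - b s (picard w n s)\<bar> \<le> L * \<bar>picard w (Suc n) s - picard w n s\<bar>"
      by (rule L(2)[OF s'])
    also have "\<dots> \<le> ?g s"
      using L(1) Suc.IH[OF s'] by (intro mult_left_mono) auto
    finally show "\<bar>b s (picard w (Suc n) s) - b s (picard w n s)\<bar> \<le> ?g s" .
  qed
  also have "(LINT s:{t0..r}|lborel. ?g s) =
      K * (1 / 2) ^ Suc n * exp (2 * L * (r - t0)) - K * (1 / 2) ^ Suc n * exp (2 * L * (t0 - t0))"
    unfolding set_lebesgue_integral_def
  proof (rule integral_FTC_atLeastAtMost)
    show "t0 \<le> r" using Suc.prems by simp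
    have "((\<lambda>s. K * (1 / 2) ^ Suc n * exp (2 * L * (s - t0))) has_real_derivative
        K * (1 / 2) ^ Suc n * (exp (2 * L * (s - t0)) * (2 * L))) (at s within {t0..r})" for s
      by (rule derivative_eq_intros refl | simp)+
    moreover have "K * (1 / 2) ^ Suc n * (exp (2 * L * (s - t0)) * (2 * L)) = ?g s" for s
      by simp
    ultimately show "((\<lambda>s. K * (1 / 2) ^ Suc n * exp (2 * L * (s - t0))) has_vector_derivative ?g s) (at s within {t0..r})" for s
      by (simp only: has_real_derivative_iff_has_vector_derivative)
    show "continuous_on {t0..r} ?g" by (intro continuous_intros)
  qed
  also have "\<dots> \<le> K * (1 / 2) ^ Suc n * exp (2 * L * (r - t0))"
    using \<open>K \<ge> 0\<close> by simp
  finally show ?case .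
qed

lemma picard_uniform_limit:
  assumes c: "c < T" shows "uniform_limit {t0..c} (picard w) (solution w) sequentially"
proof -
  obtain L0 where L0: "\<And>s x y. s \<in> {t0..c} \<Longrightarrow> \<bar>b s x - b s y\<bar> \<le> L0 * \<bar>x - y\<bar>"
    using drift_lipschitz[OF c] by blast
  define L where "L = \<bar>L0\<bar> + 1"
  have L: "L > 0" "\<And>s x y. s \<in> {t0..c} \<Longrightarrow> \<bar>b s x - b s y\<bar> \<le> L * \<bar>x - y\<bar>"
  proof -
    show "L > 0" by (simp add: L_def)
    show "\<bar>b s x - b s y\<bar> \<le> L * \<bar>x - y\<bar>" if "s \<in> {t0..c}" for s x y
    proof -
      have "L0 * \<bar>x - y\<bar> \<le> L * \<bar>x - y\<bar>" by (intro mult_right_mono) (auto simp: L_def)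
      then show ?thesis using L0[OF that, of x y] by linarith
    qed
  qed
  have "continuous_on {t0..c} (\<lambda>r. \<bar>picard w 1 r - picard w 0 r\<bar>)"
    by (intro continuous_intros continuous_on_subset[OF picard_continuous[OF w]]) (use c in auto)
  then have "bounded ((\<lambda>r. \<bar>picard w 1 r - picard w 0 r\<bar>) ` {t0..c})"
    by (intro compact_imp_bounded compact_continuous_image) auto
  then obtain K0 where "\<forall>y\<in>(\<lambda>r. \<bar>picard w 1 r - picard w 0 r\<bar>) ` {t0..c}. norm y \<le> K0"
    unfolding bounded_iff by blast
  then have K0: "\<And>r. r \<in> {t0..c} \<Longrightarrow> \<bar>picard w 1 r - picard w 0 r\<bar> \<le> K0" by simp
  define K where "K = max K0 0"
  have K: "K \<ge> 0" "\<And>r. r \<in> {t0..c} \<Longrightarrow> \<bar>picard w 1 r - picard w 0 r\<bar> \<le> K"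
    using K0 by (force simp: K_def)+
  define D where "D n r = picard w (Suc n) r - picard w n r" for n r
  have sum_D: "picard w n r = w r + (\<Sum>i<n. D i r)" for n r
    by (induction n) (auto simp: D_def)
  \<comment> \<open>The iterates are partial sums of their increments, and these have a geometric
    majorant on \<open>{t0..c}\<close>.\<close>
  have "uniform_limit {t0..c} (\<lambda>n r. \<Sum>i<n. D i r) (\<lambda>r. \<Sum>i. D i r) sequentially"
  proof (rule Weierstrass_m_test)
    fix n r assume r: "r \<in> {t0..c}"
    have "\<bar>D n r\<bar> \<le> K * (1 / 2) ^ n * exp (2 * L * (r - t0))"
      unfolding D_def by (rule picard_difference[OF c L K(2,1) r])
    also have "\<dots> \<le> K * (1 / 2) ^ n * exp (2 * L * (c - t0))"
      using r L(1) K(1) by (intro mult_left_mono) auto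
    finally show "norm (D n r) \<le> (K * exp (2 * L * (c - t0))) * (1 / 2) ^ n"
      by (simp add: mult_ac)
  next
    show "summable (\<lambda>n. (K * exp (2 * L * (c - t0))) * (1 / 2) ^ n)"
      by (intro summable_mult summable_geometric) auto
  qed
  then have lim: "uniform_limit {t0..c} (\<lambda>n r. w r + (\<Sum>i<n. D i r)) (\<lambda>r. w r + (\<Sum>i. D i r)) sequentially"
    by (intro uniform_limit_add uniform_limit_const)
  then have lim': "uniform_limit {t0..c} (picard w) (\<lambda>r. w r + (\<Sum>i. D i r)) sequentially"
    using sum_D by (auto cong: uniform_limit_cong')
  have eq: "solution w r = w r + (\<Sum>i. D i r)" if "r \<in> {t0..c}" for r
    unfolding solution_def by (rule limI) (rule tendsto_uniform_limitI[OF lim' that])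
  show ?thesis
    by (rule uniform_limit_cong'[THEN iffD2, OF _ _ lim']) (use eq in auto)
qed

lemma picard_tendsto: "t0 \<le> r \<Longrightarrow> r < T \<Longrightarrow> (\<lambda>n. picard w n r) \<longlonglongrightarrow> solution w r"
  by (rule tendsto_uniform_limitI[OF picard_uniform_limit[of r]]) auto

lemma solution_continuous: "continuous_on {t0..<T} (solution w)"
proof (rule continuous_on_Ico)
  fix c assume c: "c < T"
  show "continuous_on {t0..c} (solution w)"
  proof (rule uniform_limit_theorem[OF _ picard_uniform_limit[OF c]])
    show "\<forall>\<^sub>F n in sequentially. continuous_on {t0..c} (picard w n)"
      by (intro always_eventually allI continuous_on_subset[OF picard_continuous[OF w]]) (use c in auto)
  qed simp
qed

lemma solution_equation:
  assumes r: "t0 \<le> r" "r < T"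
  shows "solution w r = w r + (LINT s:{t0..r}|lborel. b s (solution w s))"
proof (rule LIMSEQ_unique)
  show "(\<lambda>n. picard w (Suc n) r) \<longlonglongrightarrow> solution w r"
    using LIMSEQ_Suc[OF picard_tendsto[OF r]] .
  obtain L where L: "\<And>s x y. s \<in> {t0..r} \<Longrightarrow> \<bar>b s x - b s y\<bar> \<le> L * \<bar>x - y\<bar>"
    using drift_lipschitz[OF r(2)] by blast
  have int: "set_integrable lborel {t0..r} (\<lambda>s. b s (picard w n s))"
    "set_integrable lborel {t0..r} (\<lambda>s. b s (solution w s))" for n
    by (intro drift_integrable picard_continuous solution_continuous w r)+
  have "(\<lambda>n. LINT s:{t0..r}|lborel. b s (picard w n s)) \<longlonglongrightarrow> (LINT s:{t0..r}|lborel. b s (solution w s))"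
  proof (rule metric_LIMSEQ_I)
    fix e :: real assume "e > 0"
    define d where "d = e / ((r - t0 + 1) * (\<bar>L\<bar> + 1))"
    have "d > 0" using \<open>e > 0\<close> r by (simp add: d_def)
    have "\<forall>\<^sub>F n in sequentially. \<forall>s\<in>{t0..r}. dist (picard w n s) (solution w s) < d"
      using picard_uniform_limit[OF r(2)] \<open>d > 0\<close> by (rule uniform_limitD)
    then obtain N where N: "\<And>n s. n \<ge> N \<Longrightarrow> s \<in> {t0..r} \<Longrightarrow> \<bar>picard w n s - solution w s\<bar> < d"
      unfolding eventually_sequentially dist_real_def by blast
    have "dist (LINT s:{t0..r}|lborel. b s (picard w n s)) (LINT s:{t0..r}|lborel. b s (solution w s)) < e"
      if n: "n \<ge> N" for n
    proof -
      have "\<bar>LINT s:{t0..r}|lborel. b s (picard w n s) - b s (solution w s)\<bar> \<le> (r - t0) * ((\<bar>L\<bar> + 1) * d)"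
      proof (rule set_lint_abs_le_const)
        show "set_integrable lborel {t0..r} (\<lambda>s. b s (picard w n s) - b s (solution w s))"
          by (intro set_integral_diff int)
        fix s assume s: "s \<in> {t0..r}"
        have "\<bar>b s (picard w n s) - b s (solution w s)\<bar> \<le> L * \<bar>picard w n s - solution w s\<bar>"
          by (rule L[OF s])
        also have "\<dots> \<le> (\<bar>L\<bar> + 1) * d"
          using N[OF n s] by (intro mult_mono) auto
        finally show "\<bar>b s (picard w n s) - b s (solution w s)\<bar> \<le> (\<bar>L\<bar> + 1) * d" .
      qed (use r in simp)
      also have "\<dots> < (r - t0 + 1) * ((\<bar>L\<bar> + 1) * d)"
        using \<open>d > 0\<close> by (intro mult_strict_right_mono) auto
      also have "\<dots> = e" using r by (simp add: d_def)
      finally show ?thesis using int by (simp add: dist_real_def set_integral_diff)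
    qed
    then show "\<exists>N. \<forall>n\<ge>N. dist (LINT s:{t0..r}|lborel. b s (picard w n s)) (LINT s:{t0..r}|lborel. b s (solution w s)) < e"
      by blast
  qed
  then show "(\<lambda>n. picard w (Suc n) r) \<longlonglongrightarrow> w r + (LINT s:{t0..r}|lborel. b s (solution w s))"
    by (auto intro!: tendsto_intros)
qed

end

end

text \<open>Approximation by piecewise constant paths.\<close>

lemma caratheodory_measurable:
  fixes f :: "real \<Rightarrow> 'a \<Rightarrow> real"
  assumes "a \<le> b" and meas: "\<And>s. s \<in> {a..b} \<Longrightarrow> f s \<in> borel_measurable G"
    and cont: "\<And>\<omega>. \<omega> \<in> space G \<Longrightarrow> continuous_on {a..b} (\<lambda>s. f s \<omega>)"
  shows "(\<lambda>(\<omega>, s). f (max a (min b s)) \<omega>) \<in> borel_measurable (G \<Otimes>\<^sub>M borel)"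
proof -
  define q where "q n s = real_of_int \<lfloor>real (Suc n) * s\<rfloor> / real (Suc n)" for n s
  have q: "(\<lambda>n. q n s) \<longlonglongrightarrow> s" for s
  proof (rule tendsto_sandwich)
    have "q n s \<le> s \<and> s - 1 / real (Suc n) \<le> q n s" for n
    proof -
      have "real_of_int \<lfloor>real (Suc n) * s\<rfloor> \<le> real (Suc n) * s" "real (Suc n) * s - 1 \<le> real_of_int \<lfloor>real (Suc n) * s\<rfloor>"
        by linarith+
      then have "real_of_int \<lfloor>real (Suc n) * s\<rfloor> / real (Suc n) \<le> (real (Suc n) * s) / real (Suc n)"
        "(real (Suc n) * s - 1) / real (Suc n) \<le> real_of_int \<lfloor>real (Suc n) * s\<rfloor> / real (Suc n)"
        by (intro divide_right_mono; simp)+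
      then show ?thesis by (simp add: q_def diff_divide_distrib)
    qed
    then show "\<forall>\<^sub>F n in sequentially. q n s \<le> s" "\<forall>\<^sub>F n in sequentially. s - 1 / real (Suc n) \<le> q n s"
      by auto
    show "(\<lambda>n. s - 1 / real (Suc n)) \<longlonglongrightarrow> s"
      using tendsto_diff[OF tendsto_const LIMSEQ_Suc[OF lim_const_over_n[of 1]], of s] by simp
  qed simp
  show ?thesis
  proof (rule borel_measurable_LIMSEQ_real)
    fix p :: "'a \<times> real" assume p: "p \<in> space (G \<Otimes>\<^sub>M borel)"
    have "continuous_on UNIV (\<lambda>s. f (max a (min b s)) (fst p))"
      by (rule continuous_on_compose2[OF cont]) (use p \<open>a \<le> b\<close> in \<open>auto simp: space_pair_measure intro!: continuous_intros\<close>)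
    then have "(\<lambda>n. f (max a (min b (q n (snd p)))) (fst p)) \<longlonglongrightarrow> f (max a (min b (snd p))) (fst p)"
      by (rule continuous_on_tendsto_compose[OF _ q]) auto
    then show "(\<lambda>n. (\<lambda>(\<omega>, s). f (max a (min b (q n s))) \<omega>) p) \<longlonglongrightarrow> (\<lambda>(\<omega>, s). f (max a (min b s)) \<omega>) p"
      by (simp add: case_prod_unfold)
  next
    fix n
    \<comment> \<open>The discretised time takes countably many values, indexed by integers, and for
      each of them the process is measurable in \<omega> alone.\<close>
    have "(\<lambda>p :: 'a \<times> real. f (max a (min b (real_of_int \<lfloor>real (Suc n) * snd p\<rfloor> / real (Suc n)))) (fst p)) \<in> borel_measurable (G \<Otimes>\<^sub>M borel)"
    proof (rule measurable_compose_countable[where f="\<lambda>i p. f (max a (min b (real_of_int i / real (Suc n)))) (fst p)"])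
      fix i :: int
      have [measurable]: "f (max a (min b (real_of_int i / real (Suc n)))) \<in> borel_measurable G"
        using \<open>a \<le> b\<close> by (intro meas) auto
      show "(\<lambda>p. f (max a (min b (real_of_int i / real (Suc n)))) (fst p)) \<in> borel_measurable (G \<Otimes>\<^sub>M borel)"
        by measurable
    qed measurable
    then show "(\<lambda>(\<omega>, s). f (max a (min b (q n s))) \<omega>) \<in> borel_measurable (G \<Otimes>\<^sub>M borel)"
      by (simp add: case_prod_unfold q_def)
  qed
qed

lemma caratheodory_integral_measurable:
  fixes f :: "real \<Rightarrow> 'a \<Rightarrow> real"
  assumes "a \<le> b" "\<And>s. s \<in> {a..b} \<Longrightarrow> f s \<in> borel_measurable G"
    and "\<And>\<omega>. \<omega> \<in> space G \<Longrightarrow> continuous_on {a..b} (\<lambda>s. f s \<omega>)"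
  shows "(\<lambda>\<omega>. LINT s:{a..b}|lborel. f s \<omega>) \<in> borel_measurable G"
proof -
  have [measurable]: "(\<lambda>(\<omega>, s). f (max a (min b s)) \<omega>) \<in> borel_measurable (G \<Otimes>\<^sub>M borel)"
    by (rule caratheodory_measurable[OF assms])
  have "(\<lambda>\<omega>. LINT s|lborel. indicator {a..b} s * f (max a (min b s)) \<omega>) \<in> borel_measurable G"
    by measurable
  also have "(\<lambda>\<omega>. LINT s|lborel. indicator {a..b} s * f (max a (min b s)) \<omega>) = (\<lambda>\<omega>. LINT s:{a..b}|lborel. f s \<omega>)"
    unfolding set_lebesgue_integral_def
    by (intro ext Bochner_Integration.integral_cong) (auto simp: indicator_def max_def min_def)
  finally show ?thesis .
qed

section \<open>Optimality of the feedback control\<close>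

context brownian
begin

text \<open>Fubini, with \<open>q - s\<close> as the second moment at time \<open>q\<close>;
  bounding it by \<open>s' - s\<close> loses a factor 2. Nonnegative integrals come first, so that
  the exchange of integrals precedes integrability.\<close>

lemma increment_energy:
  assumes s: "0 \<le> s" "s \<le> s'"
  shows "integrable M (\<lambda>\<omega>. LINT q:{s..s'}|lborel. (B q \<omega> - B s \<omega>)\<^sup>2)"
    and "(\<integral>\<omega>. (LINT q:{s..s'}|lborel. (B q \<omega> - B s \<omega>)\<^sup>2) \<partial>M) \<le> (s' - s)\<^sup>2"
proof -
  define f where "f q \<omega> = (B q \<omega> - B s \<omega>)\<^sup>2" for q \<omega>
  have f_meas: "f q \<in> borel_measurable M" if "q \<in> {s..s'}" for q
  proof -
    have [measurable]: "B q \<in> borel_measurable M" "B s \<in> borel_measurable M"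
      using that s by (auto intro: B_measurable)
    show ?thesis unfolding f_def[abs_def] by measurable
  qed
  have f_cont: "continuous_on {s..s'} (\<lambda>q. f q \<omega>)" if "\<omega> \<in> space M" for \<omega>
    unfolding f_def by (intro continuous_intros continuous_on_subset[OF B_continuous[OF that]]) (use s in auto)
  have joint [measurable]: "(\<lambda>(\<omega>, q). f (max s (min s' q)) \<omega>) \<in> borel_measurable (M \<Otimes>\<^sub>M borel)"
    by (rule caratheodory_measurable[OF s(2) f_meas f_cont])
  define V where "V \<omega> = (LINT q:{s..s'}|lborel. f q \<omega>)" for \<omega>
  have V_meas [measurable]: "V \<in> borel_measurable M"
    unfolding V_def[abs_def] by (rule caratheodory_integral_measurable[OF s(2) f_meas f_cont])
  have V_nonneg: "0 \<le> V \<omega>" for \<omega>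
    unfolding V_def set_lebesgue_integral_def f_def by (intro integral_nonneg_AE) auto
  interpret MB: pair_sigma_finite M lborel ..
  have "(\<integral>\<^sup>+\<omega>. ennreal (V \<omega>) \<partial>M) = (\<integral>\<^sup>+\<omega>. \<integral>\<^sup>+q. ennreal (indicator {s..s'} q * f (max s (min s' q)) \<omega>) \<partial>lborel \<partial>M)"
  proof (intro nn_integral_cong)
    fix \<omega> assume "\<omega> \<in> space M"
    then have "integrable lborel (\<lambda>q. indicator {s..s'} q *\<^sub>R f q \<omega>)"
      using borel_integrable_atLeastAtMost'[OF f_cont] by (simp add: set_integrable_def)
    then have "ennreal (V \<omega>) = (\<integral>\<^sup>+q. ennreal (indicator {s..s'} q *\<^sub>R f q \<omega>) \<partial>lborel)"
      unfolding V_def set_lebesgue_integral_def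
      by (intro nn_integral_eq_integral[symmetric]) (auto simp: f_def)
    also have "\<dots> = (\<integral>\<^sup>+q. ennreal (indicator {s..s'} q * f (max s (min s' q)) \<omega>) \<partial>lborel)"
      by (intro nn_integral_cong) (auto simp: indicator_def max_def min_def)
    finally show "ennreal (V \<omega>) = (\<integral>\<^sup>+q. ennreal (indicator {s..s'} q * f (max s (min s' q)) \<omega>) \<partial>lborel)" .
  qed
  also have "\<dots> = (\<integral>\<^sup>+q. \<integral>\<^sup>+\<omega>. ennreal (indicator {s..s'} q * f (max s (min s' q)) \<omega>) \<partial>M \<partial>lborel)"
    by (rule MB.Fubini'[symmetric]) measurable
  also have "\<dots> \<le> (\<integral>\<^sup>+q. ennreal (s' - s) * indicator {s..s'} q \<partial>lborel)"
  proof (intro nn_integral_mono)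
    fix q
    show "(\<integral>\<^sup>+\<omega>. ennreal (indicator {s..s'} q * f (max s (min s' q)) \<omega>) \<partial>M) \<le> ennreal (s' - s) * indicator {s..s'} q"
    proof (cases "q \<in> {s..s'}")
      case True
      then have "(\<integral>\<^sup>+\<omega>. ennreal (indicator {s..s'} q * f (max s (min s' q)) \<omega>) \<partial>M) = (\<integral>\<^sup>+\<omega>. ennreal ((B q \<omega> - B s \<omega>)\<^sup>2) \<partial>M)"
        by (auto simp: f_def max_def min_def intro!: nn_integral_cong)
      also have "\<dots> = ennreal (q - s)"
        using increment_second_moment[of s q] True s by (subst nn_integral_eq_integral) auto
      finally show ?thesis using True by (simp add: ennreal_leI)
    qed simp
  qed
  also have "\<dots> = ennreal ((s' - s)\<^sup>2)"
    using s by (simp add: nn_integral_cmult_indicator ennreal_mult[symmetric] power2_eq_square)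
  finally have le: "(\<integral>\<^sup>+\<omega>. ennreal (V \<omega>) \<partial>M) \<le> ennreal ((s' - s)\<^sup>2)" .
  show "integrable M (\<lambda>\<omega>. LINT q:{s..s'}|lborel. (B q \<omega> - B s \<omega>)\<^sup>2)"
    using V_nonneg le unfolding V_def[symmetric] f_def[symmetric]
    by (intro integrableI_bounded) (auto intro: le_less_trans)
  have "(\<integral>\<omega>. V \<omega> \<partial>M) \<le> (s' - s)\<^sup>2"
    using le by (subst integral_eq_nn_integral) (auto simp: V_nonneg enn2real_leI)
  then show "(\<integral>\<omega>. (LINT q:{s..s'}|lborel. (B q \<omega> - B s \<omega>)\<^sup>2) \<partial>M) \<le> (s' - s)\<^sup>2"
    by (simp add: V_def f_def)
qed

end

lemma square_add3_le:
  fixes a b c :: real shows "(a + b + c)\<^sup>2 \<le> 3 * (a\<^sup>2 + b\<^sup>2 + c\<^sup>2)"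
  using zero_le_power2[of "a - b"] zero_le_power2[of "b - c"] zero_le_power2[of "a - c"]
  by (simp add: power2_eq_square algebra_simps)

section \<open>The state equation with feedback drift\<close>

context terminal_reward
begin

text \<open>This is \<open>v_x / (2 * c)\<close> for \<open>v = 2 * c * \<sigma>^2 * psi\<close>. It
  has a name of its own because that formula for \<open>v\<close> is established later, with the
  help of solutions of this very equation.\<close>

definition drift :: "real \<Rightarrow> real \<Rightarrow> real" where
  "drift s y = \<sigma>\<^sup>2 * psi_deriv s y"

text \<open>Arbitrary starting points are allowed because the value function is needed at every time
  and place, to be differentiated in space.\<close>

definition solves :: "real \<Rightarrow> real \<Rightarrow> (real \<Rightarrow> 'w \<Rightarrow> real) \<Rightarrow> bool" where
  "solves t0 x X \<longleftrightarrow>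
     (\<forall>t\<in>{t0..<T}. X t \<in> borel_measurable (F t)) \<and>
     (\<forall>\<omega>\<in>space M. continuous_on {t0..<T} (\<lambda>t. X t \<omega>)) \<and>
     (AE \<omega> in M. \<forall>t\<in>{t0..<T}.
        X t \<omega> = x + (LINT s:{t0..t}|lborel. drift s (X s \<omega>)) + \<sigma> * (B t \<omega> - B t0 \<omega>))"

lemma drift_measurable [measurable]: "drift s \<in> borel_measurable borel"
  unfolding drift_def[abs_def] by measurable

lemma drift_regular:
  assumes "c < T"
  obtains D where "D \<ge> 0" "\<And>s x. s \<le> c \<Longrightarrow> \<bar>drift s x\<bar> \<le> D"
    "\<And>s s' x y. s \<le> c \<Longrightarrow> s' \<le> c \<Longrightarrow> \<bar>drift s x - drift s' y\<bar> \<le> D * (sqrt \<bar>s - s'\<bar> + \<bar>x - y\<bar>)"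
proof -
  have "T - c > 0" using assms by simp
  then obtain L where L: "\<And>t. t \<le> T - (T - c) \<Longrightarrow> C11 L (psi t) (psi_deriv t)"
    and Lt: "\<And>t t' x. t \<le> t' \<Longrightarrow> t' \<le> T - (T - c) \<Longrightarrow> \<bar>psi_deriv t x - psi_deriv t' x\<bar> \<le> L * sqrt (t' - t)"
    using psi_regular by metis
  have L0: "L \<ge> 0" using C11_nonneg[OF L[of c]] by simp
  have time: "\<bar>psi_deriv s x - psi_deriv s' x\<bar> \<le> L * sqrt \<bar>s - s'\<bar>" if "s \<le> c" "s' \<le> c" for s s' x
    using Lt[of s s' x] Lt[of s' s x] that by (cases "s \<le> s'") (auto simp: abs_minus_commute)
  show thesis
  proof (rule that[of "\<sigma>\<^sup>2 * L"])
    show "0 \<le> \<sigma>\<^sup>2 * L" using L0 by simp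
    show "\<bar>drift s x\<bar> \<le> \<sigma>\<^sup>2 * L" if "s \<le> c" for s x
      using C11_deriv_bound[OF L, of s x] that by (simp add: drift_def abs_mult mult_left_mono)
    show "\<bar>drift s x - drift s' y\<bar> \<le> \<sigma>\<^sup>2 * L * (sqrt \<bar>s - s'\<bar> + \<bar>x - y\<bar>)" if "s \<le> c" "s' \<le> c" for s s' x y
    proof -
      have "\<bar>psi_deriv s x - psi_deriv s' y\<bar> \<le> \<bar>psi_deriv s x - psi_deriv s y\<bar> + \<bar>psi_deriv s y - psi_deriv s' y\<bar>"
        by simp
      also have "\<dots> \<le> L * (sqrt \<bar>s - s'\<bar> + \<bar>x - y\<bar>)"
        using C11_deriv_lipschitz[OF L, of s x y] time[OF that, of y] that by (simp add: distrib_left)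
      finally have "\<sigma>\<^sup>2 * \<bar>psi_deriv s x - psi_deriv s' y\<bar> \<le> \<sigma>\<^sup>2 * (L * (sqrt \<bar>s - s'\<bar> + \<bar>x - y\<bar>))"
        by (intro mult_left_mono) auto
      then show ?thesis
        by (simp add: drift_def abs_mult mult.assoc flip: right_diff_distrib)
    qed
  qed
qed

lemma path_ode_drift: "path_ode drift t0 T"
proof
  fix c and x :: "real \<Rightarrow> real" assume c: "c < T" and x: "continuous_on {t0..c} x"
  obtain D where D: "\<And>s s' x y. s \<le> c \<Longrightarrow> s' \<le> c \<Longrightarrow> \<bar>drift s x - drift s' y\<bar> \<le> D * (sqrt \<bar>s - s'\<bar> + \<bar>x - y\<bar>)"
    using drift_regular[OF c] by metis
  show "continuous_on {t0..c} (\<lambda>s. drift s (x s))"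
    unfolding continuous_on_def
  proof
    fix s0 assume s0: "s0 \<in> {t0..c}"
    have "((\<lambda>s. D * (sqrt \<bar>s - s0\<bar> + \<bar>x s - x s0\<bar>)) \<longlongrightarrow> D * (sqrt \<bar>s0 - s0\<bar> + \<bar>x s0 - x s0\<bar>)) (at s0 within {t0..c})"
      using x s0 by (intro tendsto_intros) (auto simp: continuous_on_def)
    then have *: "((\<lambda>s. D * (sqrt \<bar>s - s0\<bar> + \<bar>x s - x s0\<bar>)) \<longlongrightarrow> 0) (at s0 within {t0..c})" by simp
    have "((\<lambda>s. drift s (x s) - drift s0 (x s0)) \<longlongrightarrow> 0) (at s0 within {t0..c})"
    proof (rule Lim_null_comparison[OF _ *])
      show "\<forall>\<^sub>F s in at s0 within {t0..c}. norm (drift s (x s) - drift s0 (x s0)) \<le> D * (sqrt \<bar>s - s0\<bar> + \<bar>x s - x s0\<bar>)"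
        unfolding eventually_at_filter using D s0 by (intro always_eventually) auto
    qed
    then show "((\<lambda>s. drift s (x s)) \<longlongrightarrow> drift s0 (x s0)) (at s0 within {t0..c})"
      by (simp add: LIM_zero_iff)
  qed
next
  fix c assume c: "c < T"
  obtain D where D: "\<And>s s' x y. s \<le> c \<Longrightarrow> s' \<le> c \<Longrightarrow> \<bar>drift s x - drift s' y\<bar> \<le> D * (sqrt \<bar>s - s'\<bar> + \<bar>x - y\<bar>)"
    using drift_regular[OF c] by metis
  then show "\<exists>L. \<forall>s\<in>{t0..c}. \<forall>x y. \<bar>drift s x - drift s y\<bar> \<le> L * \<bar>x - y\<bar>"
    by (intro exI[of _ D]) (metis abs_zero add_0 atLeastAtMost_iff diff_self real_sqrt_zero)
qed

text \<open>The Picard iterate at time \<open>r\<close> involves the Brownian path up to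
  \<open>r\<close> only, so adaptedness is proved for the iterates and passes to the pathwise
  limit.\<close>

lemma solution_exists:
  assumes t0: "0 \<le> t0" "t0 < T"
  shows "\<exists>X. solves t0 x X"
proof -
  interpret ode: path_ode drift t0 T by (rule path_ode_drift)
  define w where "w \<omega> r = x + \<sigma> * (B r \<omega> - B t0 \<omega>)" for \<omega> r
  define X where "X r \<omega> = ode.solution (w \<omega>) r" for r \<omega>
  have w: "continuous_on {t0..<T} (w \<omega>)" if "\<omega> \<in> space M" for \<omega>
    unfolding w_def by (intro continuous_intros continuous_on_subset[OF B_continuous[OF that]]) (use t0 in auto)
  have picard_adapted: "(\<lambda>\<omega>. ode.picard (w \<omega>) n r) \<in> borel_measurable (F r)" if "r \<in> {t0..<T}" for n r
    using that
  proof (induction n arbitrary: r)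
    case 0
    then have [measurable]: "B r \<in> borel_measurable (F r)" "B t0 \<in> borel_measurable (F r)"
      using t0 by (auto intro: B_adapted')
    show ?case by (simp add: w_def)
  next
    case (Suc n)
    have [measurable]: "(\<lambda>\<omega>. w \<omega> r) \<in> borel_measurable (F r)"
    proof -
      have [measurable]: "B r \<in> borel_measurable (F r)" "B t0 \<in> borel_measurable (F r)"
        using t0 Suc.prems by (auto intro: B_adapted')
      show ?thesis by (simp add: w_def)
    qed
    have [measurable]: "(\<lambda>\<omega>. LINT s:{t0..r}|lborel. drift s (ode.picard (w \<omega>) n s)) \<in> borel_measurable (F r)"
    proof (rule caratheodory_integral_measurable)
      show "t0 \<le> r" using Suc.prems by simp
      show "(\<lambda>\<omega>. drift s (ode.picard (w \<omega>) n s)) \<in> borel_measurable (F r)" if "s \<in> {t0..r}" for s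
      proof -
        have "(\<lambda>\<omega>. ode.picard (w \<omega>) n s) \<in> borel_measurable (F r)"
          by (rule measurable_F_mono[OF Suc.IH]) (use that Suc.prems in auto)
        then show ?thesis by measurable
      qed
      show "continuous_on {t0..r} (\<lambda>s. drift s (ode.picard (w \<omega>) n s))" if "\<omega> \<in> space (F r)" for \<omega>
        by (rule continuous_on_subset[OF ode.drift_continuous_Ico[OF ode.picard_continuous[OF w]]])
          (use that Suc.prems in auto)
    qed
    show ?case by simp
  qed
  have "solves t0 x X"
    unfolding solves_def
  proof (intro conjI ballI)
    fix t assume t: "t \<in> {t0..<T}"
    show "X t \<in> borel_measurable (F t)"
    proof (rule borel_measurable_LIMSEQ_real)
      show "(\<lambda>n. ode.picard (w \<omega>) n t) \<longlonglongrightarrow> X t \<omega>" if "\<omega> \<in> space (F t)" for \<omega>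
        unfolding X_def using that t w by (intro ode.picard_tendsto) auto
    qed (rule picard_adapted[OF t])
  next
    show "continuous_on {t0..<T} (\<lambda>t. X t \<omega>)" if "\<omega> \<in> space M" for \<omega>
      unfolding X_def using ode.solution_continuous[OF w[OF that]] by (simp add: eta_contract_eq)
  next
    show "AE \<omega> in M. \<forall>t\<in>{t0..<T}. X t \<omega> = x + (LINT s:{t0..t}|lborel. drift s (X s \<omega>)) + \<sigma> * (B t \<omega> - B t0 \<omega>)"
      using AE_space
    proof eventually_elim
      case (elim \<omega>)
      show ?case
        using ode.solution_equation[OF w[OF elim]] unfolding X_def by (auto simp: w_def)
    qed
  qed
  then show ?thesis by blast
qed

end

locale solution_process = terminal_reward M F B T \<sigma> K \<phi>
  for M :: "'w measure" and F :: "real \<Rightarrow> 'w measure" and B :: "real \<Rightarrow> 'w \<Rightarrow> real"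
    and T \<sigma> K :: real and \<phi> :: "real \<Rightarrow> real" +
  fixes t0 x :: real and X :: "real \<Rightarrow> 'w \<Rightarrow> real"
  assumes t0: "0 \<le> t0" "t0 < T" and solves: "solves t0 x X"
begin

sublocale ode: path_ode drift t0 T by (rule path_ode_drift)

lemma X_adapted: "t0 \<le> r \<Longrightarrow> r < T \<Longrightarrow> X r \<in> borel_measurable (F r)"
  and X_continuous: "\<omega> \<in> space M \<Longrightarrow> continuous_on {t0..<T} (\<lambda>r. X r \<omega>)"
  and X_equation: "AE \<omega> in M. \<forall>t\<in>{t0..<T}.
        X t \<omega> = x + (LINT s:{t0..t}|lborel. drift s (X s \<omega>)) + \<sigma> * (B t \<omega> - B t0 \<omega>)"
  using solves by (auto simp: solves_def)

lemma X_measurable: "t0 \<le> r \<Longrightarrow> r < T \<Longrightarrow> X r \<in> borel_measurable M"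
  using X_adapted t0 by (meson measurable_F_M order_trans)

lemma drift_path_continuous:
  "\<omega> \<in> space M \<Longrightarrow> r < T \<Longrightarrow> continuous_on {t0..r} (\<lambda>s. drift s (X s \<omega>))"
  by (rule continuous_on_subset[OF ode.drift_continuous_Ico[OF X_continuous]]) auto

lemma drift_path_integrable:
  assumes "\<omega> \<in> space M" "t0 \<le> s" "s' < T"
  shows "set_integrable lborel {s..s'} (\<lambda>q. drift q (X q \<omega>))"
    and "set_integrable lborel {s..s'} (\<lambda>q. (drift q (X q \<omega>))\<^sup>2)"
  using assms by (auto intro!: borel_integrable_atLeastAtMost' continuous_intros
      continuous_on_subset[OF drift_path_continuous[of \<omega> s']])

definition energy :: "real \<Rightarrow> 'w \<Rightarrow> real" where
  "energy r \<omega> = (LINT s:{t0..r}|lborel. (drift s (X s \<omega>))\<^sup>2)"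

lemma energy_measurable: "t0 \<le> r \<Longrightarrow> r < T \<Longrightarrow> energy r \<in> borel_measurable M"
  unfolding energy_def[abs_def]
proof (rule caratheodory_integral_measurable)
  fix s assume "t0 \<le> r" "r < T" "s \<in> {t0..r}"
  then have [measurable]: "X s \<in> borel_measurable M" by (auto intro: X_measurable)
  show "(\<lambda>\<omega>. (drift s (X s \<omega>))\<^sup>2) \<in> borel_measurable M" by measurable
qed (auto intro!: continuous_intros drift_path_continuous)

lemma energy_bound:
  assumes "t0 \<le> r" "r < T" obtains E where "\<And>\<omega>. \<omega> \<in> space M \<Longrightarrow> \<bar>energy r \<omega>\<bar> \<le> E"
proof -
  obtain D where D: "D \<ge> 0" "\<And>s x. s \<le> r \<Longrightarrow> \<bar>drift s x\<bar> \<le> D"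
    using drift_regular[OF assms(2)] by metis
  have "\<bar>energy r \<omega>\<bar> \<le> (r - t0) * D\<^sup>2" if "\<omega> \<in> space M" for \<omega>
    unfolding energy_def
  proof (rule set_lint_abs_le_const)
    show "\<bar>(drift s (X s \<omega>))\<^sup>2\<bar> \<le> D\<^sup>2" if "s \<in> {t0..r}" for s
      using power_mono[OF D(2)[of s "X s \<omega>"], of 2] that by simp
  qed (use drift_path_integrable[OF that _ assms(2)] assms in auto)
  then show thesis by (rule that)
qed

lemma energy_integrable: "t0 \<le> r \<Longrightarrow> r < T \<Longrightarrow> integrable M (energy r)"
proof -
  assume r: "t0 \<le> r" "r < T"
  obtain E where "\<And>\<omega>. \<omega> \<in> space M \<Longrightarrow> \<bar>energy r \<omega>\<bar> \<le> E" using energy_bound[OF r] by metis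
  then show ?thesis
    by (intro integrable_const_bound[where B=E] energy_measurable r) (auto intro: AE_I2)
qed

text \<open>Along a solution the displacement over a time step is the optimal one up to a
  mean-square error; the loss is computed by completing the square.\<close>

lemma solution_lower_bound:
  assumes t1: "t0 \<le> t1" "t1 < T"
  shows "psi t0 x \<le> (\<integral>\<omega>. psi t1 (X t1 \<omega>) \<partial>M) - (\<integral>\<omega>. energy t1 \<omega> \<partial>M) / (2 * \<sigma>\<^sup>2)"
proof -
  have e: "0 < T - t1" using t1 by simp
  obtain L C where C: "C \<ge> 0" and reg': "\<And>t. t \<le> T - (T - t1) \<Longrightarrow> C11 L (psi t) (psi_deriv t)"
    and "\<And>t t' x. t \<le> t' \<Longrightarrow> t' \<le> T - (T - t1) \<Longrightarrow> \<bar>psi_deriv t x - psi_deriv t' x\<bar> \<le> L * sqrt (t' - t)"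
    and one: "\<And>s s' x r. s \<le> s' \<Longrightarrow> s' \<le> T - (T - t1) \<Longrightarrow> r = \<sigma> * sqrt (s' - s) \<Longrightarrow> r \<le> 1 \<Longrightarrow>
      \<bar>gauss_smooth r (\<lambda>y. psi s' y + r\<^sup>2 / 2 * (psi_deriv s' y)\<^sup>2) x - psi s x\<bar> \<le> C * r ^ 3"
    by (rule one_step[OF e], rule that, assumption+)
  have reg: "C11 L (psi t) (psi_deriv t)" if "t \<le> t1" for t using reg'[of t] that by simp
  have L: "L \<ge> 0" using C11_nonneg[OF reg[of t1]] by simp
  obtain D where D: "D \<ge> 0" "\<And>s x. s \<le> t1 \<Longrightarrow> \<bar>drift s x\<bar> \<le> D"
    and Dlip: "\<And>s s' x y. s \<le> t1 \<Longrightarrow> s' \<le> t1 \<Longrightarrow> \<bar>drift s x - drift s' y\<bar> \<le> D * (sqrt \<bar>s - s'\<bar> + \<bar>x - y\<bar>)"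
    by (rule drift_regular[OF t1(2)], rule that, assumption+)
  \<comment> \<open>\<open>c3\<close> belongs to the deviation of the drift from a constant over the
    step. \<open>c1\<close> collects the errors made by moving the gradient of \<open>psi\<close>
    from the noisy point \<open>Y\<close> to \<open>X s\<close>, once in the linear term and once in
    its square.\<close>
  define c3 where "c3 = 3 * D\<^sup>2 / (2 * \<sigma>\<^sup>2)"
  have c3: "c3 \<ge> 0" by (simp add: c3_def)
  define c1 where "c1 = (L * D + \<sigma>\<^sup>2 * L\<^sup>2) * \<sigma>"
  have c1: "c1 \<ge> 0" using L D sigma_pos by (simp add: c1_def)
  define C' where "C' = C * \<sigma> ^ 3 + c1 * abs_moment 1 + L * D\<^sup>2 + c3 + c3 * D\<^sup>2 + c3 * \<sigma>\<^sup>2"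
  \<comment> \<open>Energy minus value, the reverse of the quantity in
    \<open>control_upper_bound\<close>: that it almost decreases is the lower bound.\<close>
  define g where "g s = (\<integral>\<omega>. energy s \<omega> \<partial>M) / (2 * \<sigma>\<^sup>2) - (\<integral>\<omega>. psi s (X s \<omega>) \<partial>M)" for s
  have "g t1 \<le> g t0"
  \<comment> \<open>Steps of length at most 1 allow higher powers of \<delta> to be estimated by
    \<delta> sqrt \<delta>; length at most \<open>1 / \<sigma>^2\<close> gives
    \<open>r \<le> 1\<close>.\<close>
  proof (rule almost_decreasing_imp_le[where g=g and a=t0 and b=t1 and \<eta>="min 1 (1 / \<sigma>\<^sup>2)" and C=C'])
    show "min 1 (1 / \<sigma>\<^sup>2) > 0" using sigma_pos by simp
    fix s s' assume s: "t0 \<le> s" "s < s'" "s' \<le> t1" "s' - s \<le> min 1 (1 / \<sigma>\<^sup>2)"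
    define \<delta> where "\<delta> = s' - s"
    define r where "r = \<sigma> * sqrt \<delta>"
    have \<delta>: "0 < \<delta>" "\<delta> \<le> 1" "\<delta> \<le> 1 / \<sigma>\<^sup>2" using s by (auto simp: \<delta>_def)
    have r2: "r\<^sup>2 = \<sigma>\<^sup>2 * \<delta>" using \<delta> by (simp add: r_def power_mult_distrib)
    have r: "r > 0" using sigma_pos \<delta> by (simp add: r_def)
    have "r\<^sup>2 \<le> 1" using \<delta>(3) sigma_pos by (simp add: r2 field_simps)
    then have r1: "r \<le> 1" using r by (simp add: power_le_one_iff)
    have ss: "s < T" "s' < T" "t0 \<le> s'" using s t1 by auto
    note reg_s' = reg[OF s(3)]
    define G where "G y = psi s' y + r\<^sup>2 / 2 * (psi_deriv s' y)\<^sup>2" for y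
    have [measurable]: "G \<in> borel_measurable borel" unfolding G_def[abs_def] by measurable
    have G_bound: "\<bar>G y\<bar> \<le> K + r\<^sup>2 / 2 * L\<^sup>2" for y
    proof -
      have "\<bar>r\<^sup>2 / 2 * (psi_deriv s' y)\<^sup>2\<bar> \<le> r\<^sup>2 / 2 * L\<^sup>2"
        using C11_deriv_square_bound[OF reg_s', of y] unfolding abs_mult by (intro mult_mono) auto
      then show ?thesis using psi_bound[of s' y] unfolding G_def by linarith
    qed
    define V where "V \<omega> = (LINT q:{s..s'}|lborel. (B q \<omega> - B s \<omega>)\<^sup>2)" for \<omega>
    define err where "err \<omega> = c1 * \<delta> * \<bar>B s' \<omega> - B s \<omega>\<bar> + L * D\<^sup>2 * \<delta>\<^sup>2 + c3 * (\<delta>\<^sup>2 + D\<^sup>2 * \<delta> ^ 3 + \<sigma>\<^sup>2 * V \<omega>)" for \<omega>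
    have path: "AE \<omega> in M. G (X s \<omega> + \<sigma> * (B s' \<omega> - B s \<omega>)) - err \<omega>
        \<le> psi s' (X s' \<omega>) - (energy s' \<omega> - energy s \<omega>) / (2 * \<sigma>\<^sup>2)"
      using X_equation AE_space
    proof eventually_elim
      case (elim \<omega>)
      define \<beta> where "\<beta> q = drift q (X q \<omega>)" for q
      define p where "p = psi_deriv s' (X s \<omega>)"
      define N where "N = \<sigma> * (B s' \<omega> - B s \<omega>)"
      define Y where "Y = X s \<omega> + N"
      define A where "A = (LINT q:{s..s'}|lborel. \<beta> q)"
      have int: "set_integrable lborel {a..b} \<beta>" "set_integrable lborel {a..b} (\<lambda>q. (\<beta> q)\<^sup>2)"
        if "t0 \<le> a" "b < T" for a b
        using drift_path_integrable[OF elim(2) that] by (simp_all add: \<beta>_def[abs_def])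
      have incr: "X q \<omega> - X s \<omega> = (LINT q:{s..q}|lborel. \<beta> q) + \<sigma> * (B q \<omega> - B s \<omega>)"
        if "s \<le> q" "q < T" for q
      proof -
        have "X q \<omega> = x + (LINT q:{t0..q}|lborel. \<beta> q) + \<sigma> * (B q \<omega> - B t0 \<omega>)"
          "X s \<omega> = x + (LINT q:{t0..s}|lborel. \<beta> q) + \<sigma> * (B s \<omega> - B t0 \<omega>)"
          using elim(1) s that ss unfolding \<beta>_def by auto
        moreover have "(LINT q:{t0..q}|lborel. \<beta> q) = (LINT q:{t0..s}|lborel. \<beta> q) + (LINT q:{s..q}|lborel. \<beta> q)"
          using s that by (intro set_lint_combine int) auto
        ultimately show ?thesis by (simp add: algebra_simps)
      qed
      have drift_small: "\<bar>LINT q:{s..q}|lborel. \<beta> q\<bar> \<le> \<delta> * D" if "s \<le> q" "q \<le> s'" for q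
      proof -
        have "\<bar>LINT q:{s..q}|lborel. \<beta> q\<bar> \<le> (q - s) * D"
          by (rule set_lint_abs_le_const[OF int(1)]) (use that s t1 D in \<open>auto simp: \<beta>_def\<close>)
        also have "\<dots> \<le> \<delta> * D" using that D by (intro mult_right_mono) (auto simp: \<delta>_def)
        finally show ?thesis .
      qed
      have X': "X s' \<omega> = Y + A" using incr[of s'] s ss by (simp add: Y_def N_def A_def)
      have A: "\<bar>A\<bar> \<le> \<delta> * D" using drift_small[of s'] s by (simp add: A_def)
      have 1: "psi s' (Y + A) \<ge> psi s' Y + psi_deriv s' Y * A - L * A\<^sup>2"
        using C11_taylor[OF reg_s', of Y A] by linarith
      have 2: "L * A\<^sup>2 \<le> L * D\<^sup>2 * \<delta>\<^sup>2"
        using mult_left_mono[OF power_mono[OF A, of 2] L] by (simp add: power_mult_distrib mult_ac)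
      have 3: "psi_deriv s' Y * A \<ge> p * A - L * \<bar>N\<bar> * (\<delta> * D)"
      proof -
        have "\<bar>p * A - psi_deriv s' Y * A\<bar> = \<bar>psi_deriv s' (X s \<omega>) - psi_deriv s' Y\<bar> * \<bar>A\<bar>"
          by (simp add: p_def left_diff_distrib flip: abs_mult)
        also have "\<dots> \<le> (L * \<bar>N\<bar>) * (\<delta> * D)"
          using C11_deriv_lipschitz[OF reg_s', of "X s \<omega>" Y] A L by (intro mult_mono) (auto simp: Y_def)
        finally show ?thesis by linarith
      qed
      have 4: "r\<^sup>2 / 2 * p\<^sup>2 \<ge> r\<^sup>2 / 2 * (psi_deriv s' Y)\<^sup>2 - r\<^sup>2 * L\<^sup>2 * \<bar>N\<bar>"
      proof -
        have "\<bar>(psi_deriv s' Y)\<^sup>2 - p\<^sup>2\<bar> \<le> 2 * L\<^sup>2 * \<bar>N\<bar>"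
          using C11_deriv_square_lipschitz[OF reg_s', of Y "X s \<omega>"] by (simp add: Y_def p_def)
        then have "r\<^sup>2 / 2 * ((psi_deriv s' Y)\<^sup>2 - p\<^sup>2) \<le> r\<^sup>2 / 2 * (2 * L\<^sup>2 * \<bar>N\<bar>)"
          by (intro mult_left_mono) auto
        then show ?thesis by (simp add: algebra_simps)
      qed
      define Q where "Q = (LINT q:{s..s'}|lborel. (\<beta> q - \<sigma>\<^sup>2 * p)\<^sup>2)"
      \<comment> \<open>The square is completed around the constant drift
        \<open>\<sigma>^2 * p\<close>, which maximises gain minus cost over the step.
        \<open>Q\<close> measures how far the actual drift is from it.\<close>
      have 5: "p * A - (energy s' \<omega> - energy s \<omega>) / (2 * \<sigma>\<^sup>2) = r\<^sup>2 / 2 * p\<^sup>2 - Q / (2 * \<sigma>\<^sup>2)"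
      proof -
        have "energy s' \<omega> - energy s \<omega> = (LINT q:{s..s'}|lborel. (\<beta> q)\<^sup>2)"
          using set_lint_combine[OF int(2)[of t0 s'], of s] s ss by (simp add: energy_def \<beta>_def)
        moreover have "Q = (LINT q:{s..s'}|lborel. (\<beta> q)\<^sup>2 - (2 * \<sigma>\<^sup>2 * p) * \<beta> q + (\<sigma>\<^sup>2 * p)\<^sup>2)"
          unfolding Q_def by (intro set_lebesgue_integral_cong) (auto simp: power2_diff)
        moreover have "\<dots> = (LINT q:{s..s'}|lborel. (\<beta> q)\<^sup>2) - (2 * \<sigma>\<^sup>2 * p) * A + \<delta> * (\<sigma>\<^sup>2 * p)\<^sup>2"
          using int[of s s'] s ss
          by (simp add: set_integral_add set_integral_diff set_integral_mult_right A_def set_lint_const_real \<delta>_def)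
        moreover have "r * r = \<delta> * (\<sigma> * \<sigma>)" using r2 by (simp add: power2_eq_square mult_ac)
        ultimately show ?thesis
          using sigma_pos by (simp add: field_simps power2_eq_square)
      qed
      \<comment> \<open>The drift has a square-root modulus in time and is Lipschitz in space, and
        the state moves by at most \<open>\<delta> * D\<close> plus noise. So its squared deviation
        has mean of order \<delta>, and \<open>Q\<close> has mean of order
        \<open>\<delta>^2\<close>.\<close>
      have 6: "Q / (2 * \<sigma>\<^sup>2) \<le> c3 * (\<delta>\<^sup>2 + D\<^sup>2 * \<delta> ^ 3 + \<sigma>\<^sup>2 * V \<omega>)"
      proof -
        let ?h = "\<lambda>q. (3 * D\<^sup>2) * ((\<delta> + D\<^sup>2 * \<delta>\<^sup>2) + \<sigma>\<^sup>2 * (B q \<omega> - B s \<omega>)\<^sup>2)"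
        have Bint: "set_integrable lborel {s..s'} (\<lambda>q. (B q \<omega> - B s \<omega>)\<^sup>2)"
          by (intro borel_integrable_atLeastAtMost' continuous_intros continuous_on_subset[OF B_continuous[OF elim(2)]])
            (use s t0 in auto)
        have "\<bar>Q\<bar> \<le> (LINT q:{s..s'}|lborel. ?h q)"
          unfolding Q_def
        proof (rule set_lint_abs_le)
          show "set_integrable lborel {s..s'} (\<lambda>q. (\<beta> q - \<sigma>\<^sup>2 * p)\<^sup>2)"
            unfolding \<beta>_def
            by (intro borel_integrable_atLeastAtMost' continuous_intros
                continuous_on_subset[OF drift_path_continuous[OF elim(2) ss(2)]]) (use s in auto)
          show "set_integrable lborel {s..s'} ?h"
            using Bint by (intro set_integrable_mult_right set_integral_add(1) set_integrable_const_real)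
          fix q assume q: "q \<in> {s..s'}"
          have "\<bar>\<beta> q - \<sigma>\<^sup>2 * p\<bar> \<le> D * (sqrt \<bar>q - s'\<bar> + \<bar>X q \<omega> - X s \<omega>\<bar>)"
            using Dlip[of q s' "X q \<omega>" "X s \<omega>"] q s by (simp add: \<beta>_def p_def drift_def)
          also have "\<dots> \<le> D * (sqrt \<delta> + \<delta> * D + \<bar>\<sigma> * (B q \<omega> - B s \<omega>)\<bar>)"
          proof (intro mult_left_mono D(1))
            have "sqrt \<bar>q - s'\<bar> \<le> sqrt \<delta>" using q by (simp add: \<delta>_def)
            moreover have "\<bar>X q \<omega> - X s \<omega>\<bar> \<le> \<delta> * D + \<bar>\<sigma> * (B q \<omega> - B s \<omega>)\<bar>"
              using incr[of q] drift_small[of q] q ss by simp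
            ultimately show "sqrt \<bar>q - s'\<bar> + \<bar>X q \<omega> - X s \<omega>\<bar> \<le> sqrt \<delta> + \<delta> * D + \<bar>\<sigma> * (B q \<omega> - B s \<omega>)\<bar>"
              by linarith
          qed
          finally have "(\<beta> q - \<sigma>\<^sup>2 * p)\<^sup>2 \<le> (D * (sqrt \<delta> + \<delta> * D + \<bar>\<sigma> * (B q \<omega> - B s \<omega>)\<bar>))\<^sup>2"
            using power_mono[of "\<bar>\<beta> q - \<sigma>\<^sup>2 * p\<bar>" _ 2] by simp
          also have "\<dots> = D\<^sup>2 * (sqrt \<delta> + \<delta> * D + \<bar>\<sigma> * (B q \<omega> - B s \<omega>)\<bar>)\<^sup>2"
            by (simp add: power_mult_distrib)
          also have "\<dots> \<le> D\<^sup>2 * (3 * ((sqrt \<delta>)\<^sup>2 + (\<delta> * D)\<^sup>2 + \<bar>\<sigma> * (B q \<omega> - B s \<omega>)\<bar>\<^sup>2))"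
            by (intro mult_left_mono square_add3_le) auto
          also have "\<dots> = ?h q" using \<delta> by (simp add: power_mult_distrib mult_ac)
          finally show "\<bar>(\<beta> q - \<sigma>\<^sup>2 * p)\<^sup>2\<bar> \<le> ?h q" by simp
        qed
        also have "\<dots> = (3 * D\<^sup>2) * (\<delta> * (\<delta> + D\<^sup>2 * \<delta>\<^sup>2) + \<sigma>\<^sup>2 * V \<omega>)"
        proof -
          have "(LINT q:{s..s'}|lborel. m + \<sigma>\<^sup>2 * (B q \<omega> - B s \<omega>)\<^sup>2) = \<delta> * m + \<sigma>\<^sup>2 * V \<omega>" for m
            using Bint s by (simp add: set_integral_add set_integral_mult_right set_lint_const_real V_def \<delta>_def)
          then show ?thesis by (simp only: set_integral_mult_right)
        qed
        finally have "Q \<le> (3 * D\<^sup>2) * (\<delta> * (\<delta> + D\<^sup>2 * \<delta>\<^sup>2) + \<sigma>\<^sup>2 * V \<omega>)" by simp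
        then have "Q / (2 * \<sigma>\<^sup>2) \<le> (3 * D\<^sup>2) * (\<delta> * (\<delta> + D\<^sup>2 * \<delta>\<^sup>2) + \<sigma>\<^sup>2 * V \<omega>) / (2 * \<sigma>\<^sup>2)"
          by (intro divide_right_mono) auto
        also have "\<dots> = c3 * (\<delta> * (\<delta> + D\<^sup>2 * \<delta>\<^sup>2) + \<sigma>\<^sup>2 * V \<omega>)" by (simp add: c3_def)
        also have "\<delta> * (\<delta> + D\<^sup>2 * \<delta>\<^sup>2) = \<delta>\<^sup>2 + D\<^sup>2 * \<delta> ^ 3"
          by (simp add: power2_eq_square power3_eq_cube algebra_simps)
        finally show ?thesis .
      qed
      have 7: "L * \<bar>N\<bar> * (\<delta> * D) + r\<^sup>2 * L\<^sup>2 * \<bar>N\<bar> = c1 * \<delta> * \<bar>B s' \<omega> - B s \<omega>\<bar>"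
      proof -
        have "\<bar>N\<bar> = \<sigma> * \<bar>B s' \<omega> - B s \<omega>\<bar>" using sigma_pos by (simp add: N_def abs_mult)
        then show ?thesis by (simp add: c1_def r2 distrib_left distrib_right mult_ac)
      qed
      show ?case
        using 1 2 3 4 5 6 7 unfolding X' G_def Y_def[symmetric] N_def[symmetric] err_def by linarith
    qed
    have Xm [measurable]: "X s \<in> borel_measurable M" "X s' \<in> borel_measurable M"
      "B s' \<in> borel_measurable M" "B s \<in> borel_measurable M"
      using s ss t0 by (auto intro!: X_measurable B_measurable)
    have intG: "integrable M (\<lambda>\<omega>. G (X s \<omega> + \<sigma> * (B s' \<omega> - B s \<omega>)))"
      by (rule integrable_const_bound[where B="K + r\<^sup>2 / 2 * L\<^sup>2"]) (use G_bound in auto)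
    have ipsi: "integrable M (\<lambda>\<omega>. psi s' (X s' \<omega>))" "integrable M (\<lambda>\<omega>. psi s (X s \<omega>))"
      by (rule integrable_const_bound[where B=K]; use psi_bound in auto)+
    have ien: "integrable M (energy s')" "integrable M (energy s)" using s ss by (auto intro!: energy_integrable)
    have V: "integrable M V" "(\<integral>\<omega>. V \<omega> \<partial>M) \<le> \<delta>\<^sup>2"
      using increment_energy[of s s'] s t0 by (simp_all add: V_def[abs_def] \<delta>_def)
    have dB: "integrable M (\<lambda>\<omega>. \<bar>B s' \<omega> - B s \<omega>\<bar>)" "(\<integral>\<omega>. \<bar>B s' \<omega> - B s \<omega>\<bar> \<partial>M) = abs_moment 1 * sqrt \<delta>"
      using increment_abs_moment[of s s'] s t0 by (simp_all add: \<delta>_def)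
    have ierr: "integrable M err"
      unfolding err_def[abs_def] using V dB by (intro Bochner_Integration.integrable_add integrable_mult_right) auto
    have "(\<integral>\<omega>. err \<omega> \<partial>M) = c1 * \<delta> * (abs_moment 1 * sqrt \<delta>) + L * D\<^sup>2 * \<delta>\<^sup>2 + c3 * (\<delta>\<^sup>2 + D\<^sup>2 * \<delta> ^ 3 + \<sigma>\<^sup>2 * (\<integral>\<omega>. V \<omega> \<partial>M))"
      unfolding err_def[abs_def] using V(1) dB prob_space by simp
    also have "\<dots> \<le> (C' - C * \<sigma> ^ 3) * (\<delta> * sqrt \<delta>)"
    proof -
      have sq: "\<delta> \<le> sqrt \<delta>" using \<delta> by (intro real_le_rsqrt) (simp add: power2_eq_square mult_left_le)
      have d2: "\<delta>\<^sup>2 \<le> \<delta> * sqrt \<delta>" using \<delta> sq by (simp add: power2_eq_square)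
      have d3: "\<delta> ^ 3 \<le> \<delta> * sqrt \<delta>" using d2 \<delta> power_decreasing[of 2 3 \<delta>] by simp
      have "c3 * (\<delta>\<^sup>2 + D\<^sup>2 * \<delta> ^ 3 + \<sigma>\<^sup>2 * (\<integral>\<omega>. V \<omega> \<partial>M)) \<le> c3 * (\<delta> * sqrt \<delta> + D\<^sup>2 * (\<delta> * sqrt \<delta>) + \<sigma>\<^sup>2 * (\<delta> * sqrt \<delta>))"
        using d2 d3 V(2) c3 by (intro mult_left_mono add_mono) auto
      moreover have "L * D\<^sup>2 * \<delta>\<^sup>2 \<le> L * D\<^sup>2 * (\<delta> * sqrt \<delta>)"
        using d2 L by (intro mult_left_mono) auto
      ultimately show ?thesis by (simp add: C'_def algebra_simps)
    qed
    finally have err: "(\<integral>\<omega>. err \<omega> \<partial>M) \<le> (C' - C * \<sigma> ^ 3) * (\<delta> * sqrt \<delta>)" .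
    have "(\<integral>\<omega>. psi s (X s \<omega>) \<partial>M) - C * r ^ 3 = (\<integral>\<omega>. psi s (X s \<omega>) - C * r ^ 3 \<partial>M)"
      using ipsi prob_space by simp
    also have "\<dots> \<le> (\<integral>\<omega>. gauss_smooth r G (X s \<omega>) \<partial>M)"
    proof (intro integral_mono Bochner_Integration.integrable_diff ipsi integrable_const)
      show "integrable M (\<lambda>\<omega>. gauss_smooth r G (X s \<omega>))"
        by (rule integrable_const_bound[where B="K + r\<^sup>2 / 2 * L\<^sup>2"]) (use gauss_smooth_bound[OF _ G_bound] in auto)
      show "psi s (X s \<omega>) - C * r ^ 3 \<le> gauss_smooth r G (X s \<omega>)" for \<omega>
        using one[of s s' r "X s \<omega>"] s r_def r1 unfolding G_def[abs_def] \<delta>_def by auto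
    qed
    also have "\<dots> = (\<integral>\<omega>. G (X s \<omega> + \<sigma> * (B s' \<omega> - B s \<omega>)) \<partial>M)"
      using increment_expectation[of s s' "X s" G "K + r\<^sup>2 / 2 * L\<^sup>2" \<sigma>] G_bound s ss t0 X_adapted[of s]
      by (simp add: r_def \<delta>_def)
    finally have lowG: "(\<integral>\<omega>. psi s (X s \<omega>) \<partial>M) - C * r ^ 3 \<le> (\<integral>\<omega>. G (X s \<omega> + \<sigma> * (B s' \<omega> - B s \<omega>)) \<partial>M)" .
    have "(\<integral>\<omega>. G (X s \<omega> + \<sigma> * (B s' \<omega> - B s \<omega>)) - err \<omega> \<partial>M)
      \<le> (\<integral>\<omega>. psi s' (X s' \<omega>) - (energy s' \<omega> - energy s \<omega>) / (2 * \<sigma>\<^sup>2) \<partial>M)"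
      by (intro integral_mono_AE path Bochner_Integration.integrable_diff integrable_divide_zero intG ipsi ien ierr)
    then have "(\<integral>\<omega>. G (X s \<omega> + \<sigma> * (B s' \<omega> - B s \<omega>)) \<partial>M) - (\<integral>\<omega>. err \<omega> \<partial>M)
      \<le> (\<integral>\<omega>. psi s' (X s' \<omega>) \<partial>M) - ((\<integral>\<omega>. energy s' \<omega> \<partial>M) - (\<integral>\<omega>. energy s \<omega> \<partial>M)) / (2 * \<sigma>\<^sup>2)"
      using intG ierr ipsi ien by (simp add: Bochner_Integration.integral_diff)
    moreover have "C * r ^ 3 = C * \<sigma> ^ 3 * (\<delta> * sqrt \<delta>)"
      using \<delta> by (simp add: r_def power_mult_distrib power3_eq_cube)
    ultimately show "g s' \<le> g s + C' * ((s' - s) * sqrt (s' - s))"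
      using lowG err unfolding g_def \<delta>_def[symmetric] diff_divide_distrib left_diff_distrib by linarith
  qed (use t1 in simp)
  moreover have "(\<integral>\<omega>. psi t0 (X t0 \<omega>) \<partial>M) = psi t0 x"
  proof -
    have "AE \<omega> in M. psi t0 (X t0 \<omega>) = psi t0 x"
      using X_equation
    proof eventually_elim
      case (elim \<omega>)
      then have "X t0 \<omega> = x + (LINT s:{t0..t0}|lborel. drift s (X s \<omega>)) + \<sigma> * (B t0 \<omega> - B t0 \<omega>)"
        using t0 by auto
      then show ?case by (simp only: set_lint_singleton) simp
    qed
    then have "(\<integral>\<omega>. psi t0 (X t0 \<omega>) \<partial>M) = (\<integral>\<omega>. psi t0 x \<partial>M)"
      using X_measurable[of t0] t0 by (intro integral_cong_AE) auto
    then show ?thesis using prob_space by simp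
  qed
  moreover have "(\<integral>\<omega>. energy t0 \<omega> \<partial>M) = 0"
    by (simp only: energy_def set_lint_singleton) simp
  ultimately show ?thesis unfolding g_def by simp
qed

end

section \<open>Controls of finite energy and truncated feedback\<close>

context brownian
begin

text \<open>\<open>payoff\<close> measures cost by extended nonnegative integrals, the estimates by
  Bochner integrals; finite cost makes the two agree. Integrability of the control itself follows
  from \<open>\<bar>y\<bar> \<le> 1 + y^2\<close> on a bounded interval.\<close>

lemma finite_energy:
  assumes prog: "progressively_measurable F T a" and t: "0 \<le> t" "t < T" and "c > 0"
    and fin: "(\<integral>\<^sup>+\<omega>. (\<integral>\<^sup>+s\<in>{t..T}. ennreal (c * (a s \<omega>)\<^sup>2) \<partial>lborel) \<partial>M) < \<infinity>"
  shows "AE \<omega> in M. set_integrable lborel {t..T} (\<lambda>s. a s \<omega>)"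
    and "AE \<omega> in M. set_integrable lborel {t..T} (\<lambda>s. (a s \<omega>)\<^sup>2)"
    and "integrable M (\<lambda>\<omega>. LINT s:{t..T}|lborel. (a s \<omega>)\<^sup>2)"
    and "(\<integral>\<^sup>+\<omega>. (\<integral>\<^sup>+s\<in>{t..T}. ennreal (c * (a s \<omega>)\<^sup>2) \<partial>lborel) \<partial>M)
      = ennreal (c * (\<integral>\<omega>. (LINT s:{t..T}|lborel. (a s \<omega>)\<^sup>2) \<partial>M))"
proof -
  let ?I = "\<lambda>\<omega>. LINT s:{t..T}|lborel. (a s \<omega>)\<^sup>2"
  let ?J = "\<lambda>\<omega>. \<integral>\<^sup>+s. ennreal (indicator {t..T} s * (c * (a (max 0 (min T s)) \<omega>)\<^sup>2)) \<partial>lborel"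
  have T: "0 \<le> T" using t by simp
  have "(\<lambda>(\<omega>, s). a (max 0 (min T s)) \<omega>) \<in> borel_measurable (F T \<Otimes>\<^sub>M borel)"
    using progressive_clamp_measurable[OF prog T] by simp
  moreover have "borel_measurable (F T \<Otimes>\<^sub>M borel) \<subseteq> (borel_measurable (M \<Otimes>\<^sub>M borel) :: ('w \<times> real \<Rightarrow> real) set)"
  proof (rule measurable_mono)
    show "sets (F T \<Otimes>\<^sub>M borel) \<subseteq> sets (M \<Otimes>\<^sub>M (borel :: real measure))"
      unfolding sets_pair_measure space_F using sets_F_subset[OF T] by (intro sigma_sets_mono') auto
  qed (auto simp: space_pair_measure)
  ultimately have joint [measurable]: "(\<lambda>(\<omega>, s). a (max 0 (min T s)) \<omega>) \<in> borel_measurable (M \<Otimes>\<^sub>M borel)"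
    by blast
  have J_eq: "(\<integral>\<^sup>+s\<in>{t..T}. ennreal (c * (a s \<omega>)\<^sup>2) \<partial>lborel) = ?J \<omega>" for \<omega>
    using t by (intro nn_integral_cong) (auto simp: indicator_def max_def min_def)
  have J_meas [measurable]: "?J \<in> borel_measurable M" by measurable
  have "AE \<omega> in M. ?J \<omega> \<noteq> \<infinity>"
    by (rule nn_integral_noteq_infinite) (use fin J_eq in auto)
  then have main: "AE \<omega> in M. set_integrable lborel {t..T} (\<lambda>s. (a s \<omega>)\<^sup>2) \<and> set_integrable lborel {t..T} (\<lambda>s. a s \<omega>)
      \<and> ?J \<omega> = ennreal (c * ?I \<omega>)"
    using AE_space
  proof eventually_elim
    case (elim \<omega>)
    have [measurable]: "(\<lambda>s. a (max 0 (min T s)) \<omega>) \<in> borel_measurable borel"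
      using measurable_Pair2[OF joint elim(2)] by simp
    have eq: "(\<lambda>s. indicator {t..T} s *\<^sub>R (c * (a s \<omega>)\<^sup>2)) = (\<lambda>s. indicator {t..T} s * (c * (a (max 0 (min T s)) \<omega>)\<^sup>2))"
      using t by (auto simp: indicator_def max_def min_def)
    have eq1: "(\<lambda>s. indicator {t..T} s *\<^sub>R a s \<omega>) = (\<lambda>s. indicator {t..T} s * a (max 0 (min T s)) \<omega>)"
      using t by (auto simp: indicator_def max_def min_def)
    have int: "set_integrable lborel {t..T} (\<lambda>s. c * (a s \<omega>)\<^sup>2)"
      unfolding set_integrable_def eq
      by (rule integrableI_nonneg) (use elim(1) \<open>c > 0\<close> in \<open>auto simp: less_top\<close>)
    then have int2: "set_integrable lborel {t..T} (\<lambda>s. (a s \<omega>)\<^sup>2)"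
      using \<open>c > 0\<close> by simp
    have "set_integrable lborel {t..T} (\<lambda>s. a s \<omega>)"
    proof (rule set_integrable_bound)
      show "set_integrable lborel {t..T} (\<lambda>s. 1 + (a s \<omega>)\<^sup>2)"
        by (intro set_integral_add set_integrable_const_real int2)
      show "set_borel_measurable lborel {t..T} (\<lambda>s. a s \<omega>)"
        unfolding set_borel_measurable_def eq1 by measurable
      have "\<bar>y\<bar> \<le> 1 + y\<^sup>2" for y :: real
        using zero_le_power2[of "\<bar>y\<bar> - 1"] zero_le_power2[of y] by (simp add: power2_diff) 
      then show "AE s in lborel. s \<in> {t..T} \<longrightarrow> norm (a s \<omega>) \<le> norm (1 + (a s \<omega>)\<^sup>2)"
        by (auto simp: abs_of_nonneg add_nonneg_nonneg)
    qed
    moreover have "?J \<omega> = ennreal (c * ?I \<omega>)"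
    proof -
      have "?J \<omega> = ennreal (LINT s:{t..T}|lborel. c * (a s \<omega>)\<^sup>2)"
        unfolding set_lebesgue_integral_def eq
        using int \<open>c > 0\<close> unfolding set_integrable_def eq by (intro nn_integral_eq_integral) auto
      then show ?thesis by simp
    qed
    ultimately show ?case using int2 by blast
  qed
  show "AE \<omega> in M. set_integrable lborel {t..T} (\<lambda>s. a s \<omega>)"
    and "AE \<omega> in M. set_integrable lborel {t..T} (\<lambda>s. (a s \<omega>)\<^sup>2)"
    using main by (auto elim: eventually_mono)
  have I_meas [measurable]: "?I \<in> borel_measurable M"
    using progressive_integral_measurable[OF progressive_square[OF prog], of t T] t
    by (intro measurable_F_M[of _ T]) auto
  have I_nonneg: "0 \<le> ?I \<omega>" for \<omega>
    unfolding set_lebesgue_integral_def by (intro integral_nonneg_AE) auto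
  have nn: "(\<integral>\<^sup>+\<omega>. (\<integral>\<^sup>+s\<in>{t..T}. ennreal (c * (a s \<omega>)\<^sup>2) \<partial>lborel) \<partial>M) = (\<integral>\<^sup>+\<omega>. ennreal (c * ?I \<omega>) \<partial>M)"
    unfolding J_eq using main by (intro nn_integral_cong_AE) (auto elim: eventually_mono)
  have "integrable M (\<lambda>\<omega>. c * ?I \<omega>)"
    using fin I_nonneg \<open>c > 0\<close> unfolding nn by (intro integrableI_nonneg) (auto simp: less_top)
  then show I_int: "integrable M ?I" using \<open>c > 0\<close> by simp
  show "(\<integral>\<^sup>+\<omega>. (\<integral>\<^sup>+s\<in>{t..T}. ennreal (c * (a s \<omega>)\<^sup>2) \<partial>lborel) \<partial>M) = ennreal (c * (\<integral>\<omega>. ?I \<omega> \<partial>M))"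
    unfolding nn using I_int I_nonneg \<open>c > 0\<close> by (subst nn_integral_eq_integral) auto
qed

end

context solution_process
begin

text \<open>The drift blows up at \<open>T\<close>, so the feedback control is switched off at a time \<open>d < T\<close>.\<close>

definition feedback :: "real \<Rightarrow> real \<Rightarrow> 'w \<Rightarrow> real" where
  "feedback d s \<omega> = (if s \<in> {t0..d} then drift s (X s \<omega>) else 0)"

lemma feedback_progressive:
  assumes d: "t0 \<le> d" "d < T"
  shows "progressively_measurable F T (feedback d)"
  unfolding progressively_measurable_def
proof
  fix t assume t: "t \<in> {0..T}"
  show "(\<lambda>(s, \<omega>). feedback d s \<omega>) \<in> borel_measurable (restrict_space borel {0..t} \<Otimes>\<^sub>M F t)"
  proof (cases "t0 \<le> t")
    case False
    have "(\<lambda>_. 0) \<in> borel_measurable (restrict_space borel {0..t} \<Otimes>\<^sub>M F t)" by simp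
    then show ?thesis
      by (rule measurable_cong[THEN iffD1, rotated])
        (use False in \<open>auto simp: feedback_def space_pair_measure space_restrict_space\<close>)
  next
    case True
    \<comment> \<open>On \<open>{t0..m}\<close> the states are measurable with respect to
      \<open>F t\<close> and the drift is still regular; clamping the time to this interval keeps
      both properties.\<close>
    define m where "m = min t d"
    have m: "t0 \<le> m" "m < T" "m \<le> t" using True d by (auto simp: m_def)
    have [measurable]: "(\<lambda>(\<omega>, s). drift (max t0 (min m s)) (X (max t0 (min m s)) \<omega>)) \<in> borel_measurable (F t \<Otimes>\<^sub>M borel)"
    proof (rule caratheodory_measurable[OF m(1)])
      show "(\<lambda>\<omega>. drift s (X s \<omega>)) \<in> borel_measurable (F t)" if "s \<in> {t0..m}" for s
      proof -
        have [measurable]: "X s \<in> borel_measurable (F t)"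
          by (rule measurable_F_mono[OF X_adapted]) (use that m in auto)
        show ?thesis by measurable
      qed
    qed (use m in \<open>auto intro: drift_path_continuous\<close>)
    have [measurable]: "fst \<in> borel_measurable (restrict_space borel {0..t} \<Otimes>\<^sub>M F t)"
      using measurable_fst by (rule measurable_compose) (simp add: measurable_restrict_space1)
    have "(\<lambda>p. (\<lambda>(\<omega>, s). drift (max t0 (min m s)) (X (max t0 (min m s)) \<omega>)) (snd p, fst p))
      \<in> borel_measurable (restrict_space borel {0..t} \<Otimes>\<^sub>M F t)"
      by (rule measurable_compose[of _ _ "F t \<Otimes>\<^sub>M borel"]) measurable
    then have "(\<lambda>p. indicator {t0..m} (fst p) * (\<lambda>(\<omega>, s). drift (max t0 (min m s)) (X (max t0 (min m s)) \<omega>)) (snd p, fst p))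
      \<in> borel_measurable (restrict_space borel {0..t} \<Otimes>\<^sub>M F t)"
      by measurable
    then show ?thesis
      by (rule measurable_cong[THEN iffD1, rotated])
        (auto simp: feedback_def space_pair_measure space_restrict_space indicator_def m_def max_def min_def)
  qed
qed

lemma set_lint_feedback:
  assumes "d < T" "f 0 = 0"
  shows "(LINT s:{t0..T}|lborel. f (feedback d s \<omega>)) = (LINT s:{t0..d}|lborel. f (drift s (X s \<omega>)) :: real)"
  unfolding set_lebesgue_integral_def
  by (intro Bochner_Integration.integral_cong) (use assms in \<open>auto simp: feedback_def indicator_def\<close>)

text \<open>The controlled state follows the solution until \<open>d\<close> and is moved by noise
  alone afterwards, so at \<open>T\<close> it is only close to the limit of
  \<open>X\<close>.\<close>

lemma feedback_state:
  assumes d: "t0 \<le> d" "d < T"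
  shows "AE \<omega> in M. controlled_state B \<sigma> t0 x (feedback d) T \<omega> = X d \<omega> + \<sigma> * (B T \<omega> - B d \<omega>)"
  using X_equation
proof eventually_elim
  case (elim \<omega>)
  then have "X d \<omega> = x + (LINT s:{t0..d}|lborel. drift s (X s \<omega>)) + \<sigma> * (B d \<omega> - B t0 \<omega>)"
    using d by auto
  then show ?case
    using set_lint_feedback[OF d(2), of "\<lambda>y. y" \<omega>] by (simp add: controlled_state_def algebra_simps)
qed

lemma feedback_bounded:
  assumes "d < T" obtains D where "D \<ge> 0" "\<And>s \<omega>. \<bar>feedback d s \<omega>\<bar> \<le> D"
proof -
  obtain D where "D \<ge> 0" "\<And>s x. s \<le> d \<Longrightarrow> \<bar>drift s x\<bar> \<le> D"
    using drift_regular[OF assms] by metis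
  then show thesis by (intro that[of D]) (auto simp: feedback_def)
qed

lemma bounded_nn_integral_finite:
  assumes "\<And>s \<omega>. f s \<omega> \<le> (k :: real)"
  shows "(\<integral>\<^sup>+\<omega>. (\<integral>\<^sup>+s\<in>{t..T}. ennreal (f s \<omega>) \<partial>lborel) \<partial>M) < \<infinity>"
proof -
  have "(\<integral>\<^sup>+\<omega>. (\<integral>\<^sup>+s\<in>{t..T}. ennreal (f s \<omega>) \<partial>lborel) \<partial>M) \<le> (\<integral>\<^sup>+\<omega>. (\<integral>\<^sup>+s\<in>{t..T}. ennreal k \<partial>lborel) \<partial>M)"
    using assms by (intro nn_integral_mono mult_right_mono ennreal_leI) auto
  also have "\<dots> = ennreal k * emeasure lborel {t..T}"
    by (simp add: nn_integral_cmult_indicator emeasure_space_1)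
  also have "\<dots> < \<infinity>" by (simp add: ennreal_mult_less_top emeasure_lborel_Icc_eq)
  finally show ?thesis .
qed

lemma feedback_in_controls:
  assumes d: "t0 \<le> d" "d < T"
  shows "feedback d \<in> controls M F T"
proof -
  obtain D where "\<And>s \<omega>. \<bar>feedback d s \<omega>\<bar> \<le> D" using feedback_bounded[OF d(2)] by metis
  then show ?thesis
    using bounded_nn_integral_finite[of "\<lambda>s \<omega>. \<bar>feedback d s \<omega>\<bar>" D 0] feedback_progressive[OF d]
    by (simp add: controls_def)
qed

lemma feedback_energy_finite:
  assumes d: "t0 \<le> d" "d < T" and "c > 0"
  shows "(\<integral>\<^sup>+\<omega>. (\<integral>\<^sup>+s\<in>{t0..T}. ennreal (c * (feedback d s \<omega>)\<^sup>2) \<partial>lborel) \<partial>M) < \<infinity>"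
proof -
  obtain D where D: "\<And>s \<omega>. \<bar>feedback d s \<omega>\<bar> \<le> D" using feedback_bounded[OF d(2)] by metis
  have "c * (feedback d s \<omega>)\<^sup>2 \<le> c * D\<^sup>2" for s \<omega>
    using power_mono[OF D[of s \<omega>], of 2] \<open>c > 0\<close> by (intro mult_left_mono) auto
  then show ?thesis by (rule bounded_nn_integral_finite)
qed

lemma X_step_measurable:
  assumes d: "t0 \<le> d" "d < T"
  shows "(\<lambda>\<omega>. X d \<omega> + \<sigma> * (B T \<omega> - B d \<omega>)) \<in> borel_measurable M"
proof -
  have [measurable]: "X d \<in> borel_measurable M" "B T \<in> borel_measurable M" "B d \<in> borel_measurable M"
    using d t0 by (auto intro: X_measurable B_measurable)
  show ?thesis by measurable
qed

text \<open>After \<open>d\<close> only noise acts, so the expected reward is a Gaussian mean of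
  \<phi> at \<open>X d\<close>. That mean and \<open>psi d\<close> both lie within
  \<open>e / 2\<close> of \<phi> when \<open>d\<close> is close to \<open>T\<close>, and up to
  \<open>d\<close> the bound \<open>solution_lower_bound\<close> applies.\<close>

lemma near_optimal:
  assumes "e > 0"
  obtains b where "b > 0" "\<And>d. t0 \<le> d \<Longrightarrow> T - b < d \<Longrightarrow> d < T \<Longrightarrow>
    psi t0 x - e \<le> (\<integral>\<omega>. \<phi> (X d \<omega> + \<sigma> * (B T \<omega> - B d \<omega>)) \<partial>M) - (\<integral>\<omega>. energy d \<omega> \<partial>M) / (2 * \<sigma>\<^sup>2)"
proof -
  have e2: "e / 2 > 0" using assms by simp
  obtain b where b: "b > 0" "\<And>t x. T - b < t \<Longrightarrow> t \<le> T \<Longrightarrow> \<bar>psi t x - \<phi> x\<bar> \<le> e / 2"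
    "\<And>t x. T - b < t \<Longrightarrow> t \<le> T \<Longrightarrow> \<bar>gauss_smooth (\<sigma> * sqrt (T - t)) \<phi> x - \<phi> x\<bar> \<le> e / 2"
    by (rule terminal_limit[OF e2], rule that, assumption+)
  show thesis
  proof (rule that[OF b(1)])
    fix d assume d: "t0 \<le> d" "T - b < d" "d < T"
    have [measurable]: "X d \<in> borel_measurable M" using d by (intro X_measurable)
    have "(\<integral>\<omega>. psi d (X d \<omega>) \<partial>M) - e = (\<integral>\<omega>. psi d (X d \<omega>) - e \<partial>M)"
      using prob_space psi_bound
      by (subst Bochner_Integration.integral_diff) (auto intro!: integrable_const_bound[where B=K])
    also have "\<dots> \<le> (\<integral>\<omega>. gauss_smooth (\<sigma> * sqrt (T - d)) \<phi> (X d \<omega>) \<partial>M)"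
    proof (intro integral_mono Bochner_Integration.integrable_diff integrable_const)
      show "integrable M (\<lambda>\<omega>. psi d (X d \<omega>))"
        by (rule integrable_const_bound[where B=K]) (use psi_bound in auto)
      show "integrable M (\<lambda>\<omega>. gauss_smooth (\<sigma> * sqrt (T - d)) \<phi> (X d \<omega>))"
        by (rule integrable_const_bound[where B=K]) (use gauss_smooth_bound[OF phi_measurable phi_bound] in auto)
      show "psi d (X d \<omega>) - e \<le> gauss_smooth (\<sigma> * sqrt (T - d)) \<phi> (X d \<omega>)" for \<omega>
        using b(2)[OF d(2) less_imp_le[OF d(3)], of "X d \<omega>"] b(3)[OF d(2) less_imp_le[OF d(3)], of "X d \<omega>"]
        unfolding abs_le_iff by linarith
    qed
    also have "\<dots> = (\<integral>\<omega>. \<phi> (X d \<omega> + \<sigma> * (B T \<omega> - B d \<omega>)) \<partial>M)"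
      using increment_expectation[of d T "X d" \<phi> K \<sigma>] phi_bound d t0 X_adapted[of d] by simp
    finally show "psi t0 x - e \<le> (\<integral>\<omega>. \<phi> (X d \<omega> + \<sigma> * (B T \<omega> - B d \<omega>)) \<partial>M) - (\<integral>\<omega>. energy d \<omega> \<partial>M) / (2 * \<sigma>\<^sup>2)"
      using solution_lower_bound[of d] d by simp
  qed
qed

end

context terminal_reward
begin

text \<open>The explicit formula for the value function. Controls of infinite energy have payoff
  \<open>-\<infinity>\<close> and satisfy the upper bound trivially; the supremum is approached by
  truncated feedback controls as the truncation time tends to \<open>T\<close>.\<close>

lemma value_fun_eq:
  assumes "c > 0" and t: "0 \<le> t" "t < T" and reward: "\<And>y. rank_reward R \<mu> y = 2 * c * \<sigma>\<^sup>2 * \<phi> y"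
  shows "value_fun M F B T c \<sigma> R \<mu> t x = 2 * c * \<sigma>\<^sup>2 * psi t x"
proof -
  \<comment> \<open>As \<open>c = ?\<gamma> / (2 * \<sigma>^2)\<close>, reward and cost share this
    factor, and a finite payoff is \<open>?\<gamma>\<close> times the quantity in
    \<open>control_upper_bound\<close>.\<close>
  let ?\<gamma> = "2 * c * \<sigma>\<^sup>2"
  have \<gamma>: "?\<gamma> > 0" using \<open>c > 0\<close> sigma_pos by simp
  have payoff_eq: "payoff M B T c \<sigma> R \<mu> t x a = ereal (?\<gamma> * ((\<integral>\<omega>. \<phi> (controlled_state B \<sigma> t x a T \<omega>) \<partial>M)
      - (\<integral>\<omega>. (LINT s:{t..T}|lborel. (a s \<omega>)\<^sup>2) \<partial>M) / (2 * \<sigma>\<^sup>2)))"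
    if "progressively_measurable F T a"
      "(\<integral>\<^sup>+\<omega>. (\<integral>\<^sup>+s\<in>{t..T}. ennreal (c * (a s \<omega>)\<^sup>2) \<partial>lborel) \<partial>M) < \<infinity>" for a
  proof -
    have "0 \<le> (\<integral>\<omega>. (LINT s:{t..T}|lborel. (a s \<omega>)\<^sup>2) \<partial>M)"
      unfolding set_lebesgue_integral_def by (intro integral_nonneg_AE AE_I2) (auto intro!: integral_nonneg_AE)
    then show ?thesis
      unfolding payoff_def finite_energy(4)[OF that(1) t \<open>c > 0\<close> that(2)]
      using \<open>c > 0\<close> sigma_pos by (simp add: reward enn2ereal_ennreal field_simps)
  qed
  have upper: "payoff M B T c \<sigma> R \<mu> t x a \<le> ereal (?\<gamma> * psi t x)" if a: "a \<in> controls M F T" for a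
  proof (cases "(\<integral>\<^sup>+\<omega>. (\<integral>\<^sup>+s\<in>{t..T}. ennreal (c * (a s \<omega>)\<^sup>2) \<partial>lborel) \<partial>M) < \<infinity>")
    case True
    have prog: "progressively_measurable F T a" using a by (simp add: controls_def)
    show ?thesis
      unfolding payoff_eq[OF prog True] ereal_less_eq
      by (intro mult_left_mono control_upper_bound prog t finite_energy(1,2,3)[OF prog t \<open>c > 0\<close> True])
        (use \<gamma> in simp)
  next
    case False
    then have "(\<integral>\<^sup>+\<omega>. (\<integral>\<^sup>+s\<in>{t..T}. ennreal (c * (a s \<omega>)\<^sup>2) \<partial>lborel) \<partial>M) = \<infinity>"
      by (simp add: less_top[symmetric])
    then show ?thesis by (simp add: payoff_def)
  qed
  obtain X where X: "solves t x X" using solution_exists[OF t] by blast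
  interpret solution_process M F B T \<sigma> K \<phi> t x X by unfold_locales (use t X in auto)
  have lower: "ereal (?\<gamma> * psi t x) \<le> (SUP a\<in>controls M F T. payoff M B T c \<sigma> R \<mu> t x a) + ereal e"
    if "e > 0" for e
  proof -
    have e_pos: "e / ?\<gamma> > 0" using that \<gamma> by simp
    obtain b where b: "b > 0" "\<And>d. t \<le> d \<Longrightarrow> T - b < d \<Longrightarrow> d < T \<Longrightarrow>
      psi t x - e / ?\<gamma> \<le> (\<integral>\<omega>. \<phi> (X d \<omega> + \<sigma> * (B T \<omega> - B d \<omega>)) \<partial>M) - (\<integral>\<omega>. energy d \<omega> \<partial>M) / (2 * \<sigma>\<^sup>2)"
      by (rule near_optimal[OF e_pos], rule that, assumption+)
    define d where "d = max t (T - b / 2)"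
    have d: "t \<le> d" "T - b < d" "d < T" using b(1) t by (auto simp: d_def)
    have "psi t x - e / ?\<gamma> \<le> (\<integral>\<omega>. \<phi> (controlled_state B \<sigma> t x (feedback d) T \<omega>) \<partial>M)
        - (\<integral>\<omega>. (LINT s:{t..T}|lborel. (feedback d s \<omega>)\<^sup>2) \<partial>M) / (2 * \<sigma>\<^sup>2)"
    proof -
      have "(\<integral>\<omega>. \<phi> (controlled_state B \<sigma> t x (feedback d) T \<omega>) \<partial>M) = (\<integral>\<omega>. \<phi> (X d \<omega> + \<sigma> * (B T \<omega> - B d \<omega>)) \<partial>M)"
      proof (rule integral_cong_AE)
        have "controlled_state B \<sigma> t x (feedback d) T \<in> borel_measurable M"
          by (rule measurable_F_M[OF controlled_state_adapted[OF feedback_progressive]]) (use d t in auto)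
        then show "(\<lambda>\<omega>. \<phi> (controlled_state B \<sigma> t x (feedback d) T \<omega>)) \<in> borel_measurable M"
          by measurable
        show "(\<lambda>\<omega>. \<phi> (X d \<omega> + \<sigma> * (B T \<omega> - B d \<omega>))) \<in> borel_measurable M"
          using X_step_measurable[OF d(1,3)] by measurable
        show "AE \<omega> in M. \<phi> (controlled_state B \<sigma> t x (feedback d) T \<omega>) = \<phi> (X d \<omega> + \<sigma> * (B T \<omega> - B d \<omega>))"
          using feedback_state[OF d(1,3)] by eventually_elim simp
      qed
      moreover have "(LINT s:{t..T}|lborel. (feedback d s \<omega>)\<^sup>2) = energy d \<omega>" for \<omega>
        using set_lint_feedback[OF d(3), of "\<lambda>y. y\<^sup>2" \<omega>] by (simp add: energy_def)
      ultimately show ?thesis using b(2)[OF d] by simp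
    qed
    then have "?\<gamma> * (psi t x - e / ?\<gamma>) \<le> ?\<gamma> * ((\<integral>\<omega>. \<phi> (controlled_state B \<sigma> t x (feedback d) T \<omega>) \<partial>M)
        - (\<integral>\<omega>. (LINT s:{t..T}|lborel. (feedback d s \<omega>)\<^sup>2) \<partial>M) / (2 * \<sigma>\<^sup>2))"
      using \<gamma> by (intro mult_left_mono) auto
    then have "ereal (?\<gamma> * (psi t x - e / ?\<gamma>)) \<le> payoff M B T c \<sigma> R \<mu> t x (feedback d)"
      unfolding payoff_eq[OF feedback_progressive[OF d(1,3)] feedback_energy_finite[OF d(1,3) \<open>c > 0\<close>]] by simp
    also have "\<dots> \<le> (SUP a\<in>controls M F T. payoff M B T c \<sigma> R \<mu> t x a)"
      by (rule SUP_upper) (rule feedback_in_controls[OF d(1,3)])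
    finally have "ereal (?\<gamma> * (psi t x - e / ?\<gamma>)) + ereal e \<le> (SUP a\<in>controls M F T. payoff M B T c \<sigma> R \<mu> t x a) + ereal e"
      by (rule add_right_mono)
    moreover have "?\<gamma> * (psi t x - e / ?\<gamma>) + e = ?\<gamma> * psi t x" using \<open>c > 0\<close> sigma_pos by (simp add: right_diff_distrib)
    ultimately show ?thesis by simp
  qed
  have "(SUP a\<in>controls M F T. payoff M B T c \<sigma> R \<mu> t x a) = ereal (?\<gamma> * psi t x)"
  proof (rule antisym)
    show "(SUP a\<in>controls M F T. payoff M B T c \<sigma> R \<mu> t x a) \<le> ereal (?\<gamma> * psi t x)"
      by (rule SUP_least) (rule upper)
    show "ereal (?\<gamma> * psi t x) \<le> (SUP a\<in>controls M F T. payoff M B T c \<sigma> R \<mu> t x a)"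
      by (rule ereal_le_epsilon2) (rule lower)
  qed
  then show ?thesis by (simp add: value_fun_def)
qed

end

section \<open>The law of the terminal state\<close>

text \<open>\<open>\<omega> r\<close> bounds all oscillation after \<open>r\<close>. This makes
  \<open>f\<close> Cauchy along one sequence, and letting the later time run along it carries the
  limit over to the whole left neighbourhood.\<close>

lemma tendsto_at_left_of_modulus:
  fixes f \<omega> :: "real \<Rightarrow> real"
  assumes "a < b" and \<omega>: "(\<omega> \<longlongrightarrow> 0) (at_left b)"
    and f: "\<And>r s. a \<le> r \<Longrightarrow> r < s \<Longrightarrow> s < b \<Longrightarrow> \<bar>f s - f r\<bar> \<le> \<omega> r"
  shows "\<exists>l. (f \<longlongrightarrow> l) (at_left b)"
proof -
  obtain c where c: "\<And>n. a < c n" "\<And>n. c n < b" and "c \<longlonglongrightarrow> b"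
    and c_lim: "filterlim c (at_left b) sequentially" and c_mono: "strict_mono c"
    using sequence_at_left[OF \<open>a < b\<close>] by metis
  have "(\<lambda>n. \<omega> (c n)) \<longlonglongrightarrow> 0" by (rule filterlim_compose[OF \<omega> c_lim])
  have "Cauchy (\<lambda>n. f (c n))"
  proof (rule CauchyI')
    fix e :: real assume "e > 0"
    then obtain N where N: "\<And>n. n \<ge> N \<Longrightarrow> \<bar>\<omega> (c n)\<bar> < e"
      using \<open>(\<lambda>n. \<omega> (c n)) \<longlonglongrightarrow> 0\<close> by (auto simp: LIMSEQ_iff)
    have "dist (f (c m)) (f (c n)) < e" if "m \<ge> N" "n > m" for m n
      using f[of "c m" "c n"] c(1)[of m] c(2)[of n] strict_monoD[OF c_mono that(2)] N[OF that(1)]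
      by (simp add: dist_real_def abs_minus_commute)
    then show "\<exists>N. \<forall>m\<ge>N. \<forall>n>m. dist (f (c m)) (f (c n)) < e" by blast
  qed
  then obtain l where l: "(\<lambda>n. f (c n)) \<longlonglongrightarrow> l"
    using Cauchy_convergent_iff convergent_def by blast
  have le: "\<bar>f r - l\<bar> \<le> \<omega> r" if "a \<le> r" "r < b" for r
  proof (rule tendsto_upperbound)
    show "(\<lambda>n. \<bar>f r - f (c n)\<bar>) \<longlonglongrightarrow> \<bar>f r - l\<bar>" by (intro tendsto_intros l)
    have "\<forall>\<^sub>F n in sequentially. r < c n"
      using \<open>c \<longlonglongrightarrow> b\<close> that(2) by (rule order_tendstoD(1))
    then show "\<forall>\<^sub>F n in sequentially. \<bar>f r - f (c n)\<bar> \<le> \<omega> r"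
    proof eventually_elim
      case (elim n)
      then show ?case using f[OF that(1) elim c(2)] by (simp add: abs_minus_commute)
    qed
  qed simp
  have "\<forall>\<^sub>F r in at_left b. norm (f r - l) \<le> \<omega> r"
    using eventually_at_left_real[OF \<open>a < b\<close>] by eventually_elim (use le in auto)
  then have "((\<lambda>r. f r - l) \<longlongrightarrow> 0) (at_left b)"
    by (rule Lim_null_comparison[OF _ \<omega>])
  then show ?thesis by (auto simp: LIM_zero_iff)
qed

lemma zero_of_quadratic_bound:
  fixes d Q :: real
  assumes "\<And>\<eta>. \<bar>\<eta>\<bar> \<le> 1 \<Longrightarrow> \<eta> * d \<le> Q * \<eta>\<^sup>2"
  shows "d = 0"
proof (rule ccontr)
  assume "d \<noteq> 0"
  \<comment> \<open>The bound is tested at \<eta> = d / Q': \<open>\<bar>d\<bar> \<le> Q'\<close>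
    makes this admissible, and \<open>Q < Q'\<close> makes the resulting inequality false.\<close>
  define Q' where "Q' = \<bar>Q\<bar> + \<bar>d\<bar> + 1"
  have Q': "Q' > 0" "Q < Q'" "\<bar>d\<bar> \<le> Q'" by (auto simp: Q'_def)
  have "\<bar>d / Q'\<bar> \<le> 1" using Q' by (simp add: abs_divide)
  then have "d / Q' * d \<le> Q * (d / Q')\<^sup>2" by (rule assms)
  then have "(d / Q' * d) * Q'\<^sup>2 \<le> (Q * (d / Q')\<^sup>2) * Q'\<^sup>2"
    by (intro mult_right_mono) auto
  then have "d\<^sup>2 * Q' \<le> d\<^sup>2 * Q"
    using Q' by (simp add: power2_eq_square mult_ac)
  moreover have "d\<^sup>2 * Q < d\<^sup>2 * Q'" using \<open>d \<noteq> 0\<close> Q' by simp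
  ultimately show False by simp
qed

context solution_process
begin

text \<open>The drift is at most \<open>k / sqrt (T - s)\<close>, which has the bounded
  antiderivative \<open>- 2 * k * sqrt (T - s)\<close>. Its accumulated effect thus converges for
  every such path, and the Brownian part is continuous at \<open>T\<close>.\<close>

lemma terminal_state_exists:
  obtains X\<^sub>T where "X\<^sub>T \<in> borel_measurable M"
    and "AE \<omega> in M. ((\<lambda>t. X t \<omega>) \<longlongrightarrow> X\<^sub>T \<omega>) (at_left T)"
proof -
  define k where "k = \<sigma>\<^sup>2 * (exp (2 * K) * abs_moment 1 / \<sigma>)"
  have k: "\<bar>drift s y\<bar> \<le> k / sqrt (T - s)" if "s < T" for s y
    using mult_left_mono[OF psi_deriv_bound[OF that, of y], of "\<sigma>\<^sup>2"]
    by (simp add: drift_def abs_mult k_def mult_ac)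
  have k0: "k \<ge> 0" using abs_moment_nonneg sigma_pos by (simp add: k_def)
  have limit: "AE \<omega> in M. \<exists>l. ((\<lambda>t. X t \<omega>) \<longlongrightarrow> l) (at_left T)"
    using X_equation AE_space
  proof eventually_elim
    case (elim \<omega>)
    define Y where "Y r = (LINT s:{t0..r}|lborel. drift s (X s \<omega>))" for r
    have "\<exists>l. (Y \<longlongrightarrow> l) (at_left T)"
    proof (rule tendsto_at_left_of_modulus[OF t0(2)])
      have "((\<lambda>r. 2 * k * sqrt (T - r)) \<longlongrightarrow> 2 * k * sqrt (T - T)) (at_left T)"
        by (intro tendsto_intros)
      then show "((\<lambda>r. 2 * k * sqrt (T - r)) \<longlongrightarrow> 0) (at_left T)" by simp
      fix r s assume rs: "t0 \<le> r" "r < s" "s < T"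
      have cont: "continuous_on {r..s} (\<lambda>q. k / sqrt (T - q))"
        using rs by (intro continuous_intros) auto
      have "Y s - Y r = (LINT q:{r..s}|lborel. drift q (X q \<omega>))"
        unfolding Y_def using set_lint_combine[OF drift_path_integrable(1)[OF elim(2), of t0 s], of r] rs by simp
      moreover have "\<bar>LINT q:{r..s}|lborel. drift q (X q \<omega>)\<bar> \<le> (LINT q:{r..s}|lborel. k / sqrt (T - q))"
        by (rule set_lint_abs_le[OF drift_path_integrable(1)[OF elim(2)] borel_integrable_atLeastAtMost'[OF cont]])
          (use k rs in auto)
      ultimately have "\<bar>Y s - Y r\<bar> \<le> (LINT q:{r..s}|lborel. k / sqrt (T - q))" by simp
      also have "\<dots> = - (2 * k * sqrt (T - s)) - - (2 * k * sqrt (T - r))"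
        unfolding set_lebesgue_integral_def
      proof (rule integral_FTC_atLeastAtMost)
        fix q assume q: "r \<le> q" "q \<le> s"
        have "((\<lambda>q. - (2 * k * sqrt (T - q))) has_real_derivative k / sqrt (T - q)) (at q within {r..s})"
          using q rs by (auto intro!: derivative_eq_intros simp: field_simps)
        then show "((\<lambda>q. - (2 * k * sqrt (T - q))) has_vector_derivative k / sqrt (T - q)) (at q within {r..s})"
          by (simp add: has_real_derivative_iff_has_vector_derivative)
      qed (use rs cont in auto)
      also have "\<dots> \<le> 2 * k * sqrt (T - r)" using k0 rs by simp
      finally show "\<bar>Y s - Y r\<bar> \<le> 2 * k * sqrt (T - r)" .
    qed
    then obtain l where l: "(Y \<longlongrightarrow> l) (at_left T)" by blast
    have "((\<lambda>t. B t \<omega>) \<longlongrightarrow> B T \<omega>) (at T within {0..})"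
      using B_continuous[OF elim(2)] T_pos by (auto simp: continuous_on_def)
    moreover have "at_left T = at T within {0..<T}"
      by (rule at_within_nhd[of T "{0<..}"]) (use T_pos in auto)
    ultimately have "((\<lambda>t. B t \<omega>) \<longlongrightarrow> B T \<omega>) (at_left T)"
      by (auto elim: tendsto_within_subset)
    then have "((\<lambda>t. x + Y t + \<sigma> * (B t \<omega> - B t0 \<omega>)) \<longlongrightarrow> x + l + \<sigma> * (B T \<omega> - B t0 \<omega>)) (at_left T)"
      by (intro tendsto_intros l)
    moreover have "\<forall>\<^sub>F t in at_left T. x + Y t + \<sigma> * (B t \<omega> - B t0 \<omega>) = X t \<omega>"
      using eventually_at_left_real[OF t0(2)] by eventually_elim (use elim(1) in \<open>auto simp: Y_def\<close>)
    ultimately show ?case by (blast intro: Lim_transform_eventually)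
  qed
  obtain c where c: "\<And>n. t0 < c n" "\<And>n. c n < T" and "c \<longlonglongrightarrow> T"
    and c_lim: "filterlim c (at_left T) sequentially" and "strict_mono c"
    using sequence_at_left[OF t0(2)] by metis
  \<comment> \<open>Taken along one fixed sequence, the limit is measurable on the whole space,
    including points where the left limit fails to exist.\<close>
  define X\<^sub>T where "X\<^sub>T \<omega> = lim (\<lambda>n. X (c n) \<omega>)" for \<omega>
  show thesis
  proof (rule that)
    have [measurable]: "X (c n) \<in> borel_measurable M" for n
      using c(1)[of n] c(2)[of n] by (intro X_measurable) auto
    show "X\<^sub>T \<in> borel_measurable M" unfolding X\<^sub>T_def[abs_def] by measurable
    show "AE \<omega> in M. ((\<lambda>t. X t \<omega>) \<longlongrightarrow> X\<^sub>T \<omega>) (at_left T)"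
      using limit
    proof eventually_elim
      case (elim \<omega>)
      then obtain l where l: "((\<lambda>t. X t \<omega>) \<longlongrightarrow> l) (at_left T)" by blast
      have "X\<^sub>T \<omega> = l" unfolding X\<^sub>T_def by (rule limI) (rule filterlim_compose[OF l c_lim])
      with l show ?case by simp
    qed
  qed
qed

text \<open>The process \<open>X\<close> is optimal for the reward \<open>\<phi>\<close>, while for \<open>\<phi> + \<eta> * h\<close> it obeys the upper bound.
  Differentiating at \<open>\<eta> = 0\<close> identifies the law of the terminal state.\<close>

lemma terminal_expectation:
  assumes XT [measurable]: "X\<^sub>T \<in> borel_measurable M"
    and XT_lim: "AE \<omega> in M. ((\<lambda>t. X t \<omega>) \<longlongrightarrow> X\<^sub>T \<omega>) (at_left T)"
    and h: "uniformly_continuous_on UNIV h" "\<And>y. \<bar>h y\<bar> \<le> 1"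
  shows "(\<integral>\<omega>. h (X\<^sub>T \<omega>) \<partial>M) = gauss_smooth (\<sigma> * sqrt (T - t0)) (\<lambda>y. exp (\<phi> y) * h y) x / u t0 x"
proof -
  have h_cont: "continuous_on UNIV h" by (rule uniformly_continuous_imp_continuous[OF h(1)])
  then have h_meas [measurable]: "h \<in> borel_measurable borel" by (rule borel_measurable_continuous_onI)
  let ?s = "\<sigma> * sqrt (T - t0)"
  define S where "S \<eta> = gauss_smooth ?s (\<lambda>y. exp (\<phi> y + \<eta> * h y)) x" for \<eta>
  define m where "m = gauss_smooth ?s (\<lambda>y. exp (\<phi> y) * h y) x"
  define Eh where "Eh = (\<integral>\<omega>. h (X\<^sub>T \<omega>) \<partial>M)"
  have S0: "S 0 = u t0 x" by (simp add: S_def u_def)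
  \<comment> \<open>The feedback for \<phi> is also a control for the perturbed reward. Subtracting
    \<open>near_optimal\<close> from its upper bound cancels the terms with \<phi> and the energy,
    and only \<eta> times the mean of \<open>h\<close> survives.\<close>
  have perturbed: "\<eta> * Eh \<le> ln (S \<eta>) - psi t0 x" for \<eta>
  proof -
    interpret pert: terminal_reward M F B T \<sigma> "K + \<bar>\<eta>\<bar>" "\<lambda>y. \<phi> y + \<eta> * h y"
    proof
      show "\<bar>\<phi> y + \<eta> * h y\<bar> \<le> K + \<bar>\<eta>\<bar>" for y
        using phi_bound[of y] mult_left_mono[OF h(2)[of y], of "\<bar>\<eta>\<bar>"] abs_triangle_ineq[of "\<phi> y" "\<eta> * h y"]
        by (simp add: abs_mult)
      show "uniformly_continuous_on UNIV (\<lambda>y. \<phi> y + \<eta> * h y)"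
        by (intro uniformly_continuous_on_add phi_uc uniformly_continuous_on_cmul_left h(1))
    qed (use T_pos sigma_pos in auto)
    have pert_psi: "pert.psi t0 x = ln (S \<eta>)"
      by (simp add: pert.psi_def pert.u_def S_def)
    obtain c where c: "\<And>n. t0 < c n" "\<And>n. c n < T" and cT: "c \<longlonglongrightarrow> T"
      and c_lim: "filterlim c (at_left T) sequentially" and "strict_mono c"
      using sequence_at_left[OF t0(2)] by metis
    let ?Y = "\<lambda>d \<omega>. X d \<omega> + \<sigma> * (B T \<omega> - B d \<omega>)"
    have Y_meas: "?Y d \<in> borel_measurable M" if "t0 \<le> d" "d < T" for d
      using that by (rule X_step_measurable)
    have bd_int: "integrable M (\<lambda>\<omega>. f (?Y d \<omega>))"
      if "t0 \<le> d" "d < T" "f \<in> borel_measurable borel" "\<And>y. \<bar>f y\<bar> \<le> k" for d k and f :: "real \<Rightarrow> real"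
      by (rule integrable_const_bound[where B=k]) (use that Y_meas[OF that(1,2)] in auto)
    have upper: "(\<integral>\<omega>. \<phi> (?Y d \<omega>) \<partial>M) + \<eta> * (\<integral>\<omega>. h (?Y d \<omega>) \<partial>M) - (\<integral>\<omega>. energy d \<omega> \<partial>M) / (2 * \<sigma>\<^sup>2) \<le> ln (S \<eta>)"
      if d: "t0 \<le> d" "d < T" for d
    proof -
      note fin = finite_energy[OF feedback_progressive[OF d] t0 zero_less_one feedback_energy_finite[OF d zero_less_one]]
      have "(\<integral>\<omega>. \<phi> (controlled_state B \<sigma> t0 x (feedback d) T \<omega>) + \<eta> * h (controlled_state B \<sigma> t0 x (feedback d) T \<omega>) \<partial>M)
        - (\<integral>\<omega>. (LINT s:{t0..T}|lborel. (feedback d s \<omega>)\<^sup>2) \<partial>M) / (2 * \<sigma>\<^sup>2) \<le> pert.psi t0 x"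
        by (rule pert.control_upper_bound[OF feedback_progressive[OF d] t0 fin(1,2,3)])
      moreover have "(\<integral>\<omega>. \<phi> (controlled_state B \<sigma> t0 x (feedback d) T \<omega>) + \<eta> * h (controlled_state B \<sigma> t0 x (feedback d) T \<omega>) \<partial>M)
        = (\<integral>\<omega>. \<phi> (?Y d \<omega>) + \<eta> * h (?Y d \<omega>) \<partial>M)"
      proof (rule integral_cong_AE)
        have [measurable]: "controlled_state B \<sigma> t0 x (feedback d) T \<in> borel_measurable M"
          by (rule measurable_F_M[OF controlled_state_adapted[OF feedback_progressive[OF d]]]) (use t0 in auto)
        show "(\<lambda>\<omega>. \<phi> (controlled_state B \<sigma> t0 x (feedback d) T \<omega>) + \<eta> * h (controlled_state B \<sigma> t0 x (feedback d) T \<omega>)) \<in> borel_measurable M"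
          by measurable
        note [measurable] = Y_meas[OF d]
        show "(\<lambda>\<omega>. \<phi> (?Y d \<omega>) + \<eta> * h (?Y d \<omega>)) \<in> borel_measurable M" by measurable
        show "AE \<omega> in M. \<phi> (controlled_state B \<sigma> t0 x (feedback d) T \<omega>) + \<eta> * h (controlled_state B \<sigma> t0 x (feedback d) T \<omega>)
          = \<phi> (?Y d \<omega>) + \<eta> * h (?Y d \<omega>)"
          using feedback_state[OF d] by eventually_elim simp
      qed
      moreover have "(\<integral>\<omega>. \<phi> (?Y d \<omega>) + \<eta> * h (?Y d \<omega>) \<partial>M) = (\<integral>\<omega>. \<phi> (?Y d \<omega>) \<partial>M) + \<eta> * (\<integral>\<omega>. h (?Y d \<omega>) \<partial>M)"
        using bd_int[OF d phi_measurable phi_bound] bd_int[OF d h_meas h(2)] by simp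
      moreover have "(LINT s:{t0..T}|lborel. (feedback d s \<omega>)\<^sup>2) = energy d \<omega>" for \<omega>
        using set_lint_feedback[OF d(2), of "\<lambda>y. y\<^sup>2" \<omega>] by (simp add: energy_def)
      ultimately show ?thesis using pert_psi by simp
    qed
    have h_lim: "(\<lambda>n. \<integral>\<omega>. h (?Y (c n) \<omega>) \<partial>M) \<longlonglongrightarrow> Eh"
      unfolding Eh_def
    proof (rule integral_dominated_convergence[where w="\<lambda>_. 1"])
      show "(\<lambda>\<omega>. h (X\<^sub>T \<omega>)) \<in> borel_measurable M" by measurable
      show "(\<lambda>\<omega>. h (?Y (c n) \<omega>)) \<in> borel_measurable M" for n
        by (rule measurable_compose[OF Y_meas h_meas]) (use c(1)[of n] c(2)[of n] in auto)
      show "AE \<omega> in M. norm (h (?Y (c n) \<omega>)) \<le> 1" for n using h(2) by simp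
      show "AE \<omega> in M. (\<lambda>n. h (?Y (c n) \<omega>)) \<longlonglongrightarrow> h (X\<^sub>T \<omega>)"
        using XT_lim AE_space
      proof eventually_elim
        case (elim \<omega>)
        have "(\<lambda>n. B (c n) \<omega>) \<longlonglongrightarrow> B T \<omega>"
          by (rule continuous_on_tendsto_compose[OF B_continuous[OF elim(2)] cT])
            (use T_pos t0 c less_imp_le in \<open>auto intro!: always_eventually order_trans[OF t0(1)]\<close>)
        then have "(\<lambda>n. ?Y (c n) \<omega>) \<longlonglongrightarrow> X\<^sub>T \<omega> + \<sigma> * (B T \<omega> - B T \<omega>)"
          by (intro tendsto_intros filterlim_compose[OF elim(1) c_lim])
        then have "(\<lambda>n. h (?Y (c n) \<omega>)) \<longlonglongrightarrow> h (X\<^sub>T \<omega> + \<sigma> * (B T \<omega> - B T \<omega>))"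
          by (rule continuous_on_tendsto_compose[OF h_cont]) auto
        then show ?case by simp
      qed
    qed simp
    show ?thesis
    proof (rule field_le_epsilon)
      fix e :: real assume e: "e > 0"
      obtain b where b: "b > 0" "\<And>d. t0 \<le> d \<Longrightarrow> T - b < d \<Longrightarrow> d < T \<Longrightarrow>
        psi t0 x - e \<le> (\<integral>\<omega>. \<phi> (?Y d \<omega>) \<partial>M) - (\<integral>\<omega>. energy d \<omega> \<partial>M) / (2 * \<sigma>\<^sup>2)"
        by (rule near_optimal[OF e], rule that, assumption+)
      have "T - b < T" using b(1) by simp
      with cT have "\<forall>\<^sub>F n in sequentially. T - b < c n" by (rule order_tendstoD(1))
      then have "\<forall>\<^sub>F n in sequentially. \<eta> * (\<integral>\<omega>. h (?Y (c n) \<omega>) \<partial>M) \<le> ln (S \<eta>) - psi t0 x + e"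
      proof eventually_elim
        case (elim n)
        then show ?case
          using b(2)[of "c n"] upper[of "c n"] c(1)[of n] c(2)[of n] by simp
      qed
      moreover have "(\<lambda>n. \<eta> * (\<integral>\<omega>. h (?Y (c n) \<omega>) \<partial>M)) \<longlonglongrightarrow> \<eta> * Eh"
        by (intro tendsto_intros h_lim)
      ultimately show "\<eta> * Eh \<le> ln (S \<eta>) - psi t0 x + e"
        by (intro tendsto_upperbound) auto
    qed
  qed
  \<comment> \<open>First-order expansion of \<open>S\<close> at 0.
    \<open>\<bar>\<eta> * h y\<bar> \<le> 1\<close> bounds the exponential in the remainder by
    \<open>exp 1\<close>, and \<open>exp K\<close> bounds the weight
    \<open>exp (\<phi> y)\<close>.\<close>
  have S_le: "S \<eta> \<le> u t0 x + \<eta> * m + exp 1 * exp K * \<eta>\<^sup>2" if \<eta>: "\<bar>\<eta>\<bar> \<le> 1" for \<eta>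
  proof -
    have ebd: "\<bar>exp (\<phi> y) * h y\<bar> \<le> exp K * 1" for y
      using h(2)[of y] exp_phi_bounds(3)[of y] unfolding abs_mult by (intro mult_mono) auto
    have "S \<eta> \<le> gauss_smooth ?s (\<lambda>y. (exp (\<phi> y) + \<eta> * (exp (\<phi> y) * h y)) + exp 1 * exp K * \<eta>\<^sup>2) x"
      unfolding S_def
    proof (rule gauss_smooth_mono)
      have hb: "\<bar>\<eta> * h y\<bar> \<le> \<bar>\<eta>\<bar>" for y
        using mult_left_mono[OF h(2)[of y], of "\<bar>\<eta>\<bar>"] by (simp add: abs_mult)
      show "\<bar>exp (\<phi> y + \<eta> * h y)\<bar> \<le> exp (K + 1)" for y
        using phi_bound[of y] hb[of y] \<eta> by (auto simp: abs_le_iff)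
      show "\<bar>exp (\<phi> y) + \<eta> * (exp (\<phi> y) * h y) + exp 1 * exp K * \<eta>\<^sup>2\<bar> \<le> exp K + exp K + exp 1 * exp K * \<eta>\<^sup>2" for y
      proof -
        have "\<bar>\<eta> * (exp (\<phi> y) * h y)\<bar> \<le> 1 * (exp K * 1)"
          unfolding abs_mult[of \<eta>] by (intro mult_mono \<eta> ebd) auto
        moreover have "0 \<le> exp 1 * exp K * \<eta>\<^sup>2" by simp
        ultimately show ?thesis using exp_phi_bounds(3)[of y] unfolding abs_le_iff by linarith
      qed
      show "exp (\<phi> y + \<eta> * h y) \<le> exp (\<phi> y) + \<eta> * (exp (\<phi> y) * h y) + exp 1 * exp K * \<eta>\<^sup>2" for y
      proof -
        have "exp (\<eta> * h y) \<le> 1 + \<eta> * h y + (\<eta> * h y)\<^sup>2 * exp \<bar>\<eta> * h y\<bar>"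
          using abs_exp_minus_one_minus_le[of "\<eta> * h y"] by linarith
        also have "(\<eta> * h y)\<^sup>2 * exp \<bar>\<eta> * h y\<bar> \<le> \<eta>\<^sup>2 * exp 1"
          using power_mono[OF hb[of y], of 2] hb[of y] \<eta> by (intro mult_mono) auto
        finally have "exp (\<phi> y) * exp (\<eta> * h y) \<le> exp (\<phi> y) * (1 + \<eta> * h y + \<eta>\<^sup>2 * exp 1)"
          by (intro mult_left_mono) auto
        also have "\<dots> = exp (\<phi> y) + \<eta> * (exp (\<phi> y) * h y) + exp (\<phi> y) * (exp 1 * \<eta>\<^sup>2)"
          by (simp add: algebra_simps)
        also have "exp (\<phi> y) * (exp 1 * \<eta>\<^sup>2) \<le> exp K * (exp 1 * \<eta>\<^sup>2)"
          using exp_phi_bounds(2)[of y] by (intro mult_right_mono) auto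
        finally show ?thesis by (simp add: exp_add mult_ac)
      qed
    qed measurable
    also have "\<dots> = u t0 x + \<eta> * m + exp 1 * exp K * \<eta>\<^sup>2"
    proof -
      have i1: "integrable std_normal_distribution (\<lambda>z. exp (\<phi> (x + ?s * z)))"
        by (rule gauss_smooth_integrable[OF exp_phi_measurable exp_phi_bounds(3)])
      have i2: "integrable std_normal_distribution (\<lambda>z. exp (\<phi> (x + ?s * z)) * h (x + ?s * z))"
        by (rule gauss_smooth_integrable[OF _ ebd]) measurable
      show ?thesis
        using i1 i2 std_normal.prob_space by (simp add: gauss_smooth_def u_def m_def)
    qed
    finally show ?thesis .
  qed
  have up: "u t0 x > 0" by (rule u_pos)
  have "Eh - m / u t0 x = 0"
  \<comment> \<open>By \<open>ln t \<le> t - 1\<close> the increment of \<open>ln S\<close> is at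
    most \<open>\<eta> * m / u t0 x\<close> plus a quadratic term. Since \<eta> may have either
    sign, the one-sided bound forces equality of the slopes.\<close>
  proof (rule zero_of_quadratic_bound)
    fix \<eta> :: real assume \<eta>: "\<bar>\<eta>\<bar> \<le> 1"
    have "0 < S \<eta>"
    proof -
      have "exp (- (K + 1)) \<le> S \<eta>"
      proof -
        have hb: "\<bar>\<eta> * h y\<bar> \<le> 1" for y
          using mult_mono[OF \<eta> h(2)[of y]] by (simp add: abs_mult)
        have b1: "- (K + 1) \<le> \<phi> y + \<eta> * h y" "\<phi> y + \<eta> * h y \<le> K + 1" for y
          using phi_bound[of y] hb[of y] unfolding abs_le_iff by linarith+
        have "gauss_smooth ?s (\<lambda>_. exp (- (K + 1))) x \<le> S \<eta>"
          unfolding S_def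
          by (rule gauss_smooth_mono[where K="exp (- (K + 1))" and K'="exp (K + 1)"]) (use b1 in auto)
        then show ?thesis by simp
      qed
      then show ?thesis by (rule less_le_trans[OF exp_gt_zero])
    qed
    then have "ln (S \<eta>) - psi t0 x = ln (S \<eta> / u t0 x)" using up by (simp add: psi_def ln_div)
    also have "\<dots> \<le> S \<eta> / u t0 x - 1" using up \<open>0 < S \<eta>\<close> by (intro ln_le_minus_one) simp
    also have "\<dots> \<le> (u t0 x + \<eta> * m + exp 1 * exp K * \<eta>\<^sup>2) / u t0 x - 1"
      using S_le[OF \<eta>] up by (intro diff_right_mono divide_right_mono) auto
    also have "\<dots> = \<eta> * (m / u t0 x) + exp 1 * exp K / u t0 x * \<eta>\<^sup>2"
      using up by (simp add: field_simps)
    finally show "\<eta> * (Eh - m / u t0 x) \<le> exp 1 * exp K / u t0 x * \<eta>\<^sup>2"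
      using perturbed[of \<eta>] by (simp add: right_diff_distrib)
  qed
  then show ?thesis by (simp add: Eh_def m_def)
qed

end

section \<open>The fixed point equation for the terminal law\<close>

lemma density_real_distribution:
  fixes f :: "real \<Rightarrow> real"
  assumes G: "real_distribution G" and f: "f \<in> borel_measurable borel" "\<And>y. 0 \<le> f y" "\<And>y. f y \<le> k"
    and one: "(\<integral>y. f y \<partial>G) = 1"
  shows "real_distribution (density G (\<lambda>y. ennreal (f y)))"
    and "cdf (density G (\<lambda>y. ennreal (f y))) x = (\<integral>y. indicator {..x} y * f y \<partial>G)"
proof -
  interpret G: real_distribution G by (rule G)
  have [measurable]: "f \<in> borel_measurable G" using f(1) by simp
  have int: "integrable G f" by (rule G.integrable_const_bound[where B=k]) (use f in auto)
  have emeas: "emeasure (density G (\<lambda>y. ennreal (f y))) A = ennreal (\<integral>y. indicator A y * f y \<partial>G)"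
    if A: "A \<in> sets borel" for A
  proof -
    have [measurable]: "A \<in> sets G" using A by simp
    have "emeasure (density G (\<lambda>y. ennreal (f y))) A = (\<integral>\<^sup>+y. ennreal (indicator A y * f y) \<partial>G)"
      by (subst emeasure_density) (auto intro!: nn_integral_cong simp: indicator_def A)
    also have "\<dots> = ennreal (\<integral>y. indicator A y * f y \<partial>G)"
    proof (rule nn_integral_eq_integral)
      show "integrable G (\<lambda>y. indicator A y * f y)"
        using integrable_mult_indicator[OF \<open>A \<in> sets G\<close> int] by simp
    qed (use f in auto)
    finally show ?thesis .
  qed
  show "real_distribution (density G (\<lambda>y. ennreal (f y)))"
    by (intro real_distribution.intro prob_spaceI real_distribution_axioms.intro)
      (use emeas[of UNIV] one in auto)
  show "cdf (density G (\<lambda>y. ennreal (f y))) x = (\<integral>y. indicator {..x} y * f y \<partial>G)"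
    unfolding cdf_def measure_def using emeas[of "{..x}"] f
    by (simp add: integral_nonneg_AE)
qed

text \<open>\<open>r x y\<close> stands for \<open>exp (R x y / (2 * c * \<sigma>^2))\<close> and
  \<open>G\<close> for the law of \<open>\<sigma> * B T\<close>. The two-sided bound confines every
  normalising constant to \<open>{m..k}\<close>; the absence of atoms makes small cells carry small
  mass.\<close>

locale rank_equation = G: real_distribution G for G +
  fixes r :: "real \<Rightarrow> real \<Rightarrow> real" and m k :: real
  assumes atomless: "\<And>x. measure G {x} = 0"
    and r_cont: "continuous_on UNIV (\<lambda>p. r (fst p) (snd p))"
    and m_pos: "0 < m" and r_lower: "\<And>x y. m \<le> r x y" and r_upper: "\<And>x y. r x y \<le> k"
begin

lemma r_measurable [measurable]: "(\<lambda>p. r (fst p) (snd p)) \<in> borel_measurable (borel \<Otimes>\<^sub>M borel)"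
  using borel_measurable_continuous_onI[OF r_cont] by (simp add: borel_prod)

lemma r_comp_measurable [measurable]:
  assumes [measurable]: "f \<in> borel_measurable borel" "g \<in> borel_measurable borel"
  shows "(\<lambda>y. r (f y) (g y)) \<in> borel_measurable borel"
  using measurable_compose[OF _ r_measurable, of "\<lambda>y. (f y, g y)" borel] by simp

lemma r_tendsto: "(f \<longlongrightarrow> a) net \<Longrightarrow> ((\<lambda>n. r y (f n)) \<longlongrightarrow> r y a) net"
  using continuous_on_tendsto_compose[OF r_cont, of "\<lambda>n. (y, f n)" "(y, a)" net]
  by (simp add: tendsto_Pair)

lemma r_pos: "0 < r x y"
  using less_le_trans[OF m_pos r_lower] .

lemma k_pos: "0 < k"
  using r_pos[of 0 0] r_upper[of 0 0] by linarith

lemma r_abs_le: "\<bar>r x y\<bar> \<le> k"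
  using r_pos[of x y] r_upper[of x y] by simp

lemma r_integrable [simp]:
  assumes "g \<in> borel_measurable borel"
  shows "integrable G (\<lambda>y. r y (g y))"
proof (rule G.integrable_const_bound[where B=k])
  show "(\<lambda>y. r y (g y)) \<in> borel_measurable G" using assms by measurable
qed (use r_abs_le in auto)

lemma r_integrable_indicator:
  assumes "g \<in> borel_measurable borel" "A \<in> sets borel"
  shows "integrable G (\<lambda>y. indicator A y * r y (g y))"
  using integrable_mult_indicator[OF _ r_integrable[OF assms(1)], of A] assms(2) by simp

text \<open>The constant \<open>k\<close> dominates, so convergence almost everywhere is enough;
  this matters because Helly's theorem gives limits at continuity points only. The set
  \<open>A\<close> is a cell, a half-line or the whole line.\<close>

lemma integral_r_tendsto:
  assumes "\<And>n. H n \<in> borel_measurable borel" "H' \<in> borel_measurable borel" "A \<in> sets borel"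
    and "AE y in G. (\<lambda>n. H n y) \<longlonglongrightarrow> H' y"
  shows "(\<lambda>n. \<integral>y. indicator A y * r y (H n y) \<partial>G) \<longlonglongrightarrow> (\<integral>y. indicator A y * r y (H' y) \<partial>G)"
proof (rule integral_dominated_convergence[where w="\<lambda>_. k"])
  show "(\<lambda>y. indicator A y * r y (H' y)) \<in> borel_measurable G"
    using r_integrable_indicator[OF assms(2,3)] by simp
  show "(\<lambda>y. indicator A y * r y (H n y)) \<in> borel_measurable G" for n
    using r_integrable_indicator[OF assms(1,3)] by simp
  show "AE y in G. (\<lambda>n. indicator A y * r y (H n y)) \<longlonglongrightarrow> indicator A y * r y (H' y)"
    using assms(4) by eventually_elim (intro tendsto_intros r_tendsto)
  show "AE y in G. norm (indicator A y * r y (H n y)) \<le> k" for n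
    using r_abs_le k_pos by (auto simp: indicator_def)
qed simp

text \<open>Explicit Euler scheme: on each cell \<open>{y. \<kappa> y = i}\<close> the rank is frozen at its value at the
  left end point. The normalising constant of the density is then found by the intermediate value theorem.\<close>

lemma euler_approximation:
  fixes \<kappa> :: "real \<Rightarrow> nat"
  assumes \<kappa>: "mono \<kappa>" and \<kappa>_meas [measurable]: "\<kappa> \<in> borel \<rightarrow>\<^sub>M count_space UNIV"
  obtains H Z where "H \<in> borel_measurable borel" "m \<le> Z" "Z = (\<integral>y. r y (H y) \<partial>G)"
    and "\<And>x. \<bar>(\<integral>y. indicator {..x} y * r y (H y) \<partial>G) / Z - H x\<bar> \<le> k / m * measure G {y. \<kappa> y = \<kappa> x}"
proof -
  define I where "I i a = (\<integral>y. indicator {y. \<kappa> y = i} y * r y a \<partial>G)" for i a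
  \<comment> \<open>\<open>A \<theta> i\<close> is the Euler value of the rank at the left end of
    cell \<open>i\<close>, started from 0 at minus infinity; \<theta> is a trial value for the
    reciprocal of the normalising constant.\<close>
  define A where "A \<theta> = rec_nat 0 (\<lambda>i a. a + \<theta> * I i a)" for \<theta> :: real
  have A_0: "A \<theta> 0 = 0" and A_Suc: "A \<theta> (Suc i) = A \<theta> i + \<theta> * I i (A \<theta> i)" for \<theta> i
    by (simp_all add: A_def)
  define H where "H \<theta> y = A \<theta> (\<kappa> y)" for \<theta> y
  have H_meas [measurable]: "H \<theta> \<in> borel_measurable borel" for \<theta>
    unfolding H_def[abs_def] by (rule measurable_compose[OF \<kappa>_meas]) simp
  define Z where "Z \<theta> = (\<integral>y. r y (H \<theta> y) \<partial>G)" for \<theta>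
  have [measurable]: "{y. \<kappa> y = i} \<in> sets borel" "{y. \<kappa> y < i} \<in> sets borel" for i
    by measurable
  have A_tendsto: "(\<lambda>j. A (l j) i) \<longlonglongrightarrow> A l' i" if l: "l \<longlonglongrightarrow> l'" for l l' i
  proof (induction i)
    case (Suc i)
    have "(\<lambda>j. I i (A (l j) i)) \<longlonglongrightarrow> I i (A l' i)"
      unfolding I_def by (rule integral_r_tendsto) (use Suc.IH in auto)
    then show ?case unfolding A_Suc by (intro tendsto_intros Suc.IH l)
  qed (simp add: A_0)
  have "continuous_on UNIV (\<lambda>l. l * Z l)"
  proof (rule continuous_on_sequentiallyI)
    fix l and l' :: real assume l: "l \<longlonglongrightarrow> l'"
    have "(\<lambda>j. \<integral>y. indicator UNIV y * r y (H (l j) y) \<partial>G) \<longlonglongrightarrow> (\<integral>y. indicator UNIV y * r y (H l' y) \<partial>G)"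
      by (rule integral_r_tendsto) (auto simp: H_def intro!: A_tendsto[OF l])
    then show "(\<lambda>j. l j * Z (l j)) \<longlonglongrightarrow> l' * Z l'"
      unfolding Z_def by (intro tendsto_intros l) simp
  qed
  then have cont: "continuous_on {1 / k..1 / m} (\<lambda>l. l * Z l)"
    by (rule continuous_on_subset) simp
  have Z_le: "Z l \<le> k" and Z_ge: "m \<le> Z l" for l
  proof -
    have "Z l \<le> (\<integral>y. k \<partial>G)" unfolding Z_def by (intro integral_mono) (auto simp: r_upper)
    then show "Z l \<le> k" using G.prob_space by simp
    have "(\<integral>y. m \<partial>G) \<le> Z l" unfolding Z_def by (intro integral_mono) (auto simp: r_lower)
    then show "m \<le> Z l" using G.prob_space by simp
  qed
  \<comment> \<open>The scheme is consistent exactly when \<theta> is the reciprocal of the mass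
    \<open>Z \<theta>\<close> it produces. As this mass lies in \<open>{m..k}\<close>, the product
    \<open>\<theta> * Z \<theta>\<close> is at most 1 at \<open>1 / k\<close> and at least 1 at
    \<open>1 / m\<close>.\<close>
  have "1 / k * Z (1 / k) \<le> 1" using Z_le[of "1 / k"] k_pos by simp
  moreover have "1 \<le> 1 / m * Z (1 / m)" using Z_ge[of "1 / m"] m_pos by simp
  moreover have "1 / k \<le> 1 / m" using m_pos r_lower[of 0 0] r_upper[of 0 0] by (intro divide_left_mono) auto
  ultimately obtain l where l: "l * Z l = 1"
    using IVT'[OF _ _ _ cont, of 1] by blast
  have Z_pos: "0 < Z l" using Z_ge[of l] m_pos by linarith
  have div: "p / Z l = l * p" for p
  proof -
    have "p = (l * p) * Z l" using l by (simp add: mult_ac)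
    then show ?thesis using Z_pos by (simp add: divide_eq_eq)
  qed
  have "1 / Z l \<le> 1 / m" using Z_ge[of l] m_pos by (intro divide_left_mono) auto
  then have l_bounds: "0 \<le> l" "l \<le> 1 / m"
    using div[of 1] Z_pos less_imp_le[OF divide_pos_pos[OF zero_less_one Z_pos]] by auto
  have A_eq: "A l i = l * (\<integral>y. indicator {y. \<kappa> y < i} y * r y (H l y) \<partial>G)" for i
  proof (induction i)
    case (Suc i)
    have "I i (A l i) = (\<integral>y. indicator {y. \<kappa> y = i} y * r y (H l y) \<partial>G)"
      unfolding I_def by (intro Bochner_Integration.integral_cong) (auto simp: H_def indicator_def)
    moreover have "(\<integral>y. indicator {y. \<kappa> y < Suc i} y * r y (H l y) \<partial>G)
      = (\<integral>y. indicator {y. \<kappa> y < i} y * r y (H l y) + indicator {y. \<kappa> y = i} y * r y (H l y) \<partial>G)"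
      by (intro Bochner_Integration.integral_cong) (auto simp: indicator_def)
    ultimately show ?case
      unfolding A_Suc using Suc.IH by (simp add: r_integrable_indicator distrib_left)
  qed (simp add: A_0)
  show thesis
  proof (rule that[of "H l" "Z l"])
    show "m \<le> Z l" by (rule Z_ge)
    show "Z l = (\<integral>y. r y (H l y) \<partial>G)" by (simp add: Z_def)
    fix x
    have "(\<integral>y. indicator {..x} y * r y (H l y) \<partial>G) / Z l - H l x
      = l * (\<integral>y. indicator {..x} y * r y (H l y) \<partial>G) - l * (\<integral>y. indicator {y. \<kappa> y < \<kappa> x} y * r y (H l y) \<partial>G)"
      using A_eq[of "\<kappa> x"] by (simp add: H_def[of l x] div)
    also have "\<dots> = l * (\<integral>y. indicator {..x} y * r y (H l y) - indicator {y. \<kappa> y < \<kappa> x} y * r y (H l y) \<partial>G)"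
      by (simp add: r_integrable_indicator right_diff_distrib)
    finally have eq: "(\<integral>y. indicator {..x} y * r y (H l y) \<partial>G) / Z l - H l x
      = l * (\<integral>y. indicator {..x} y * r y (H l y) - indicator {y. \<kappa> y < \<kappa> x} y * r y (H l y) \<partial>G)" .
    have "\<bar>\<integral>y. indicator {..x} y * r y (H l y) - indicator {y. \<kappa> y < \<kappa> x} y * r y (H l y) \<partial>G\<bar>
      \<le> (\<integral>y. k * indicator {y. \<kappa> y = \<kappa> x} y \<partial>G)"
    proof (rule integral_abs_bound_integral)
      show "integrable G (\<lambda>y. k * indicator {y. \<kappa> y = \<kappa> x} y)"
        by (intro integrable_mult_right integrable_real_indicator) (auto simp: G.emeasure_finite less_top[symmetric])
      fix y
      have "\<kappa> y < \<kappa> x \<Longrightarrow> y \<le> x" using monoD[OF \<kappa>, of x y] by (cases "y \<le> x") auto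
      moreover have "y \<le> x \<Longrightarrow> \<kappa> y \<le> \<kappa> x" using monoD[OF \<kappa>, of y x] .
      ultimately show "\<bar>indicator {..x} y * r y (H l y) - indicator {y. \<kappa> y < \<kappa> x} y * r y (H l y)\<bar> \<le> k * indicator {y. \<kappa> y = \<kappa> x} y"
        using r_abs_le[of y "H l y"] k_pos by (auto simp: indicator_def)
    qed (auto simp: r_integrable_indicator)
    then have "l * \<bar>\<integral>y. indicator {..x} y * r y (H l y) - indicator {y. \<kappa> y < \<kappa> x} y * r y (H l y) \<partial>G\<bar>
      \<le> 1 / m * (k * measure G {y. \<kappa> y = \<kappa> x})"
      using l_bounds m_pos k_pos by (intro mult_mono) auto
    then show "\<bar>(\<integral>y. indicator {..x} y * r y (H l y) \<partial>G) / Z l - H l x\<bar> \<le> k / m * measure G {y. \<kappa> y = \<kappa> x}"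
      unfolding eq using l_bounds by (simp add: abs_mult)
  qed simp
qed

text \<open>A grid of mesh \<open>1 / Suc n\<close> starting at \<open>- Suc n\<close>, since the
  argument of the ceiling is \<open>Suc n * (y + Suc n)\<close>. Truncation by \<open>nat\<close>
  merges everything to the left into cell 0, which gives the Euler recursion a first cell.\<close>

definition cell :: "nat \<Rightarrow> real \<Rightarrow> nat" where
  "cell n y = nat \<lceil>real (Suc n) * y + (real (Suc n))\<^sup>2\<rceil>"

lemma cell_mono: "mono (cell n)"
  unfolding cell_def by (intro monoI nat_mono ceiling_mono) (simp add: mult_left_mono)

lemma cell_measurable [measurable]: "cell n \<in> borel \<rightarrow>\<^sub>M count_space UNIV"
  unfolding cell_def[abs_def] by measurable

lemma cell_small:
  assumes "- real (Suc n) < x" "cell n y = cell n x"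
  shows "\<bar>y - x\<bar> < 1 / real (Suc n)"
proof -
  let ?f = "\<lambda>y. real (Suc n) * y + (real (Suc n))\<^sup>2"
  have "0 < real (Suc n) * (x + real (Suc n))" using assms(1) by (intro mult_pos_pos) auto
  then have "0 < ?f x" by (simp add: power2_eq_square distrib_left)
  then have "0 < \<lceil>?f x\<rceil>" by linarith
  then have "\<lceil>?f y\<rceil> = \<lceil>?f x\<rceil>" using assms(2) unfolding cell_def by linarith
  then have "\<bar>?f y - ?f x\<bar> < 1" by linarith
  then have "real (Suc n) * \<bar>y - x\<bar> < 1"
    by (simp add: abs_mult flip: right_diff_distrib)
  then show ?thesis by (simp add: field_simps)
qed

text \<open>As soon as the grid starts to the left of \<open>x\<close>, the cell of \<open>x\<close>
  lies in an interval shrinking to \<open>x\<close>, where the distribution function of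
  \<open>G\<close> is continuous.\<close>

lemma cell_measure_tendsto: "(\<lambda>n. measure G {y. cell n y = cell n x}) \<longlonglongrightarrow> 0"
proof -
  let ?u = "\<lambda>n. cdf G (x + 1 / real (Suc n)) - cdf G (x - 1 / real (Suc n))"
  have "isCont (cdf G) x" using atomless[of x] by (simp add: G.isCont_cdf)
  moreover have "(\<lambda>n. x + 1 / real (Suc n)) \<longlonglongrightarrow> x" "(\<lambda>n. x - 1 / real (Suc n)) \<longlonglongrightarrow> x"
    using tendsto_add[OF tendsto_const[of x] LIMSEQ_Suc[OF lim_const_over_n[of 1]]]
      tendsto_diff[OF tendsto_const[of x] LIMSEQ_Suc[OF lim_const_over_n[of 1]]] by simp_all
  ultimately have "?u \<longlonglongrightarrow> cdf G x - cdf G x"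
    by (intro tendsto_diff) (auto elim: isCont_tendsto_compose)
  then have "?u \<longlonglongrightarrow> 0" by simp
  obtain N :: nat where N: "- x < real N" using reals_Archimedean2 by blast
  have "\<forall>\<^sub>F n in sequentially. measure G {y. cell n y = cell n x} \<le> ?u n"
  proof (rule eventually_sequentiallyI[of N])
    fix n assume "N \<le> n"
    then have n: "- real (Suc n) < x" using N by simp
    have "{y. cell n y = cell n x} \<subseteq> {x - 1 / real (Suc n)<..x + 1 / real (Suc n)}"
      using cell_small[OF n] by (force simp: abs_less_iff)
    then have "measure G {y. cell n y = cell n x} \<le> measure G {x - 1 / real (Suc n)<..x + 1 / real (Suc n)}"
      by (intro G.finite_measure_mono) auto
    also have "\<dots> = ?u n"
      by (rule G.cdf_diff_eq[symmetric]) (simp add: field_simps add_pos_pos)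
    finally show "measure G {y. cell n y = cell n x} \<le> ?u n" .
  qed
  then show ?thesis
    by (rule tendsto_sandwich[OF _ _ tendsto_const \<open>?u \<longlonglongrightarrow> 0\<close>, rotated]) simp
qed

text \<open>Helly's limit \<open>F'\<close> might lose mass at infinity, so \<mu> is built from the
  density with \<open>F'\<close> inserted and normalised by its own integral \<open>Z'\<close>. Its
  distribution function is the limit of \<open>F (s n)\<close> at every point, hence equals
  \<open>F'\<close> wherever \<open>F'\<close> is continuous, and in the density the two are
  interchangeable.\<close>

lemma fixed_point:
  obtains \<mu> Z where "real_distribution \<mu>" "Z > 0" "\<mu> = density G (\<lambda>x. ennreal (r x (cdf \<mu> x) / Z))"
proof -
  define P where "P n H Z \<longleftrightarrow> H \<in> borel_measurable borel \<and> m \<le> Z \<and> Z = (\<integral>y. r y (H y) \<partial>G) \<and>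
    (\<forall>x. \<bar>(\<integral>y. indicator {..x} y * r y (H y) \<partial>G) / Z - H x\<bar> \<le> k / m * measure G {y. cell n y = cell n x})"
    for n and H :: "real \<Rightarrow> real" and Z :: real
  have "\<exists>H Z. P n H Z" for n
    by (rule euler_approximation[OF cell_mono cell_measurable[of n]]) (auto simp: P_def)
  then obtain H Z where HZ: "\<And>n. P n (H n) (Z n)" by metis
  then have H [measurable]: "\<And>n. H n \<in> borel_measurable borel" and Z: "\<And>n. m \<le> Z n"
    "\<And>n. Z n = (\<integral>y. r y (H n y) \<partial>G)"
    and err: "\<And>n x. \<bar>(\<integral>y. indicator {..x} y * r y (H n y) \<partial>G) / Z n - H n x\<bar> \<le> k / m * measure G {y. cell n y = cell n x}"
    unfolding P_def by blast+
  define F where "F n x = (\<integral>y. indicator {..x} y * r y (H n y) \<partial>G) / Z n" for n x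
  have Z_pos: "0 < Z n" for n using Z(1)[of n] m_pos by linarith
  have dist: "real_distribution (density G (\<lambda>y. ennreal (r y (H n y) / Z n)))"
    and F_cdf: "F n = cdf (density G (\<lambda>y. ennreal (r y (H n y) / Z n)))" for n
  proof -
    have 1: "r y (H n y) / Z n \<le> k / m" for y
      using r_upper[of y "H n y"] Z(1)[of n] m_pos k_pos by (intro frac_le) auto
    have 2: "(\<integral>y. r y (H n y) / Z n \<partial>G) = 1"
      using Z(2)[of n] Z_pos[of n] by simp
    have 3: "0 \<le> r y (H n y) / Z n" for y using r_pos Z_pos by (simp add: less_imp_le)
    note d = density_real_distribution[OF G.real_distribution_axioms _ 3 1 2]
    show "real_distribution (density G (\<lambda>y. ennreal (r y (H n y) / Z n)))" by (rule d(1)) measurable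
    show "F n = cdf (density G (\<lambda>y. ennreal (r y (H n y) / Z n)))"
    proof
      show "F n x = cdf (density G (\<lambda>y. ennreal (r y (H n y) / Z n))) x" for x
        by (subst d(2)) (simp_all add: F_def)
    qed
  qed
  have "\<exists>s. strict_mono (s::nat \<Rightarrow> nat) \<and> (\<exists>F'. (\<forall>x. continuous (at_right x) F') \<and> mono F' \<and> (\<forall>x. \<bar>F' x\<bar> \<le> 1) \<and>
      (\<forall>x. continuous (at x) F' \<longrightarrow> (\<lambda>n. F (s n) x) \<longlonglongrightarrow> F' x))"
  proof (rule Helly_selection)
    fix n x
    interpret D: real_distribution "density G (\<lambda>y. ennreal (r y (H n y) / Z n))" by (rule dist)
    show "continuous (at_right x) (F n)" unfolding F_cdf by (rule D.cdf_is_right_cont)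
    show "mono (F n)" unfolding F_cdf by (intro monoI D.cdf_nondecreasing)
    show "\<bar>F n x\<bar> \<le> 1" unfolding F_cdf using D.cdf_nonneg[of x] D.cdf_bounded_prob[of x] by simp
  qed
  then obtain s :: "nat \<Rightarrow> nat" and F' where s: "strict_mono s" and F'_mono: "mono F'"
    and F'_lim: "\<And>x. isCont F' x \<Longrightarrow> (\<lambda>n. F (s n) x) \<longlonglongrightarrow> F' x"
    by auto
  have [measurable]: "F' \<in> borel_measurable borel" by (rule borel_measurable_mono[OF F'_mono])
  \<comment> \<open>A monotone function has countably many discontinuities, a null set for the
    atomless \<open>G\<close>.\<close>
  have AE_cont: "AE y in G. isCont F' y"
  proof -
    have "countable {y. \<not> isCont F' y}" by (rule mono_ctble_discont[OF F'_mono])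
    then have "(\<Union>y\<in>{y. \<not> isCont F' y}. {y}) \<in> null_sets G"
      by (rule null_sets_UN') (auto simp: null_sets_def G.emeasure_eq_measure atomless)
    then show ?thesis by (rule AE_I') auto
  qed
  \<comment> \<open>The Euler ranks \<open>H\<close> differ from the distribution functions
    \<open>F\<close> by the mass of one cell, so both have the same limit.\<close>
  have AE_lim: "AE y in G. (\<lambda>n. H (s n) y) \<longlonglongrightarrow> F' y"
    using AE_cont
  proof eventually_elim
    case (elim y)
    have "(\<lambda>n. k / m * measure G {z. cell (s n) z = cell (s n) y}) \<longlonglongrightarrow> k / m * 0"
      by (intro tendsto_intros LIMSEQ_subseq_LIMSEQ[OF cell_measure_tendsto s, unfolded comp_def])
    then have lim0: "(\<lambda>n. k / m * measure G {z. cell (s n) z = cell (s n) y}) \<longlonglongrightarrow> 0" by simp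
    have "norm (F (s n) y - H (s n) y) \<le> k / m * measure G {z. cell (s n) z = cell (s n) y}" for n
      unfolding F_def real_norm_def by (rule err)
    then have "(\<lambda>n. F (s n) y - H (s n) y) \<longlonglongrightarrow> 0"
      by (intro Lim_null_comparison[OF _ lim0] always_eventually allI)
    from tendsto_diff[OF F'_lim[OF elim] this] show ?case by simp
  qed
  define Z' where "Z' = (\<integral>y. r y (F' y) \<partial>G)"
  have "(\<lambda>n. \<integral>y. indicator UNIV y * r y (H (s n) y) \<partial>G) \<longlonglongrightarrow> (\<integral>y. indicator UNIV y * r y (F' y) \<partial>G)"
    by (rule integral_r_tendsto) (use AE_lim in auto)
  then have Z_lim: "(\<lambda>n. Z (s n)) \<longlonglongrightarrow> Z'" by (simp add: Z(2) Z'_def)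
  then have "m \<le> Z'" by (rule LIMSEQ_le_const) (use Z(1) in auto)
  then have Z'_pos: "0 < Z'" using m_pos by linarith
  define \<mu> where "\<mu> = density G (\<lambda>y. ennreal (r y (F' y) / Z'))"
  have 1: "r y (F' y) / Z' \<le> k / m" for y
    using r_upper[of y "F' y"] \<open>m \<le> Z'\<close> m_pos k_pos by (intro frac_le) auto
  have 2: "(\<integral>y. r y (F' y) / Z' \<partial>G) = 1" using Z'_pos by (simp add: Z'_def)
  have 3: "0 \<le> r y (F' y) / Z'" for y using r_pos Z'_pos by (simp add: less_imp_le)
  note d = density_real_distribution[OF G.real_distribution_axioms _ 3 1 2]
  have \<mu>_dist: "real_distribution \<mu>" unfolding \<mu>_def by (rule d(1)) measurable
  have \<mu>_cdf: "cdf \<mu> x = (\<integral>y. indicator {..x} y * r y (F' y) \<partial>G) / Z'" for x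
    unfolding \<mu>_def by (subst d(2)) simp_all
  have F_lim: "(\<lambda>n. F (s n) x) \<longlonglongrightarrow> cdf \<mu> x" for x
    unfolding F_def \<mu>_cdf
  proof (intro tendsto_divide Z_lim integral_r_tendsto)
    show "AE y in G. (\<lambda>n. H (s n) y) \<longlonglongrightarrow> F' y" by (rule AE_lim)
  qed (use Z'_pos in auto)
  have "AE y in G. F' y = cdf \<mu> y"
    using AE_cont by eventually_elim (rule LIMSEQ_unique[OF F'_lim F_lim])
  moreover have "(\<lambda>y. cdf \<mu> y) \<in> borel_measurable borel"
  proof -
    interpret \<mu>: real_distribution \<mu> by (rule \<mu>_dist)
    show ?thesis by (rule borel_measurable_mono) (intro monoI \<mu>.cdf_nondecreasing)
  qed
  ultimately have "density G (\<lambda>y. ennreal (r y (F' y) / Z')) = density G (\<lambda>y. ennreal (r y (cdf \<mu> y) / Z'))"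
    by (intro density_cong) (auto elim: eventually_mono)
  then show thesis using that[OF \<mu>_dist Z'_pos] by (simp flip: \<mu>_def)
qed

end

section \<open>The fixed point theorem\<close>

text \<open>To the left of some \<open>a\<close> and to the right of some \<open>b\<close> the
  function stays within \<open>e\<close> of its infimum and supremum; in between compactness gives a
  modulus.\<close>

lemma bounded_mono_continuous_imp_uniformly_continuous:
  fixes f :: "real \<Rightarrow> real"
  assumes mono: "mono f" and cont: "continuous_on UNIV f" and bd: "\<And>x. \<bar>f x\<bar> \<le> K"
  shows "uniformly_continuous_on UNIV f"
  unfolding uniformly_continuous_on_def
proof (intro allI impI)
  fix e :: real assume "e > 0"
  have above: "bdd_above (range f)" and below: "bdd_below (range f)"
    using bd by (auto simp: abs_le_iff minus_le_iff intro!: bdd_aboveI[of _ K] bdd_belowI[of _ "-K"])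
  obtain b where b: "(SUP x. f x) - e < f b"
    using less_cSUP_iff[OF _ above, of "(SUP x. f x) - e"] \<open>e > 0\<close> by auto
  obtain a where a: "f a < (INF x. f x) + e"
    using cINF_less_iff[OF _ below, of "(INF x. f x) + e"] \<open>e > 0\<close> by auto
  have right: "\<bar>f x - f y\<bar> < e" if "b \<le> x" "b \<le> y" for x y
    using monoD[OF mono that(1)] monoD[OF mono that(2)] b cSUP_upper[OF UNIV_I above, of x] cSUP_upper[OF UNIV_I above, of y]
    by linarith
  have left: "\<bar>f x - f y\<bar> < e" if "x \<le> a" "y \<le> a" for x y
    using monoD[OF mono that(1)] monoD[OF mono that(2)] a cINF_lower[OF below UNIV_I, of x] cINF_lower[OF below UNIV_I, of y]
    by linarith
  \<comment> \<open>The margin 1 makes any two points at distance below 1 share a region: the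
    enlarged compact interval or one of the tails.\<close>
  have "uniformly_continuous_on {a - 1..b + 1} f"
    by (intro compact_uniformly_continuous continuous_on_subset[OF cont]) auto
  then obtain d where d: "d > 0" "\<And>x y. x \<in> {a - 1..b + 1} \<Longrightarrow> y \<in> {a - 1..b + 1} \<Longrightarrow> dist y x < d \<Longrightarrow> dist (f y) (f x) < e"
    using \<open>e > 0\<close> unfolding uniformly_continuous_on_def by blast
  have "dist (f y) (f x) < e" if "dist y x < min d 1" for x y
  proof -
    have xy: "\<bar>y - x\<bar> < d" "\<bar>y - x\<bar> < 1" using that by (auto simp: dist_real_def)
    consider "x \<in> {a - 1..b + 1} \<and> y \<in> {a - 1..b + 1}" | "b \<le> x \<and> b \<le> y" | "x \<le> a \<and> y \<le> a"
      using xy(2) by fastforce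
    then show ?thesis
      by cases (use d(2)[of x y] xy right[of y x] left[of y x] in \<open>auto simp: dist_real_def\<close>)
  qed
  then show "\<exists>d>0. \<forall>x\<in>UNIV. \<forall>y\<in>UNIV. dist y x < d \<longrightarrow> dist (f y) (f x) < e"
    using d(1) by (intro exI[of _ "min d 1"]) auto
qed

lemma uniformly_continuous_cos_sin:
  fixes t :: real
  shows "uniformly_continuous_on UNIV (\<lambda>x. cos (t * x))" "uniformly_continuous_on UNIV (\<lambda>x. sin (t * x))"
proof -
  have *: "uniformly_continuous_on UNIV f"
    if "\<And>x. (f has_field_derivative f' x) (at x)" "\<And>x. \<bar>f' x\<bar> \<le> \<bar>t\<bar>" for f f' :: "real \<Rightarrow> real"
    by (rule lipschitz_on_uniformly_continuous[of "\<bar>t\<bar>"], rule lipschitz_onI)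
      (use lipschitz_of_bounded_deriv[OF that] in \<open>auto simp: dist_real_def\<close>)
  have le: "\<bar>y * t\<bar> \<le> \<bar>t\<bar>" if "\<bar>y\<bar> \<le> 1" for y
    using mult_right_mono[OF that, of "\<bar>t\<bar>"] by (simp add: abs_mult)
  show "uniformly_continuous_on UNIV (\<lambda>x. cos (t * x))"
    by (rule *[of _ "\<lambda>x. - sin (t * x) * t"]) (auto intro!: derivative_eq_intros le)
  show "uniformly_continuous_on UNIV (\<lambda>x. sin (t * x))"
    by (rule *[of _ "\<lambda>x. cos (t * x) * t"]) (auto intro!: derivative_eq_intros le)
qed

lemma real_distribution_eqI:
  assumes M: "real_distribution M" and N: "real_distribution N"
    and eq: "\<And>h :: real \<Rightarrow> real. uniformly_continuous_on UNIV h \<Longrightarrow> (\<And>y. \<bar>h y\<bar> \<le> 1) \<Longrightarrow> (\<integral>y. h y \<partial>M) = (\<integral>y. h y \<partial>N)"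
  shows "M = N"
proof (rule Levy_uniqueness[OF M N])
  have char: "Re (char D t) = (\<integral>y. cos (t * y) \<partial>D)" "Im (char D t) = (\<integral>y. sin (t * y) \<partial>D)"
    if "real_distribution D" for D t
  proof -
    interpret D: real_distribution D by (rule that)
    have int: "integrable D (\<lambda>y. iexp (t * y))"
      by (rule D.integrable_const_bound[where B=1]) auto
    show "Re (char D t) = (\<integral>y. cos (t * y) \<partial>D)" "Im (char D t) = (\<integral>y. sin (t * y) \<partial>D)"
      unfolding char_def using integral_Re[OF int] integral_Im[OF int] by (simp_all add: Re_exp Im_exp)
  qed
  show "char M = char N"
  proof
    fix t
    show "char M t = char N t"
      by (rule complex_eqI)
        (use eq[OF uniformly_continuous_cos_sin(1)[of t]] eq[OF uniformly_continuous_cos_sin(2)[of t]]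
          in \<open>auto simp: char[OF M] char[OF N]\<close>)
  qed
qed

lemma emeasure_density_singleton_eq_0:
  assumes "f \<in> borel_measurable M" "{x} \<in> null_sets M"
  shows "emeasure (density M f) {x} = 0"
proof -
  have "emeasure (density M f) {x} = (\<integral>\<^sup>+y\<in>{x}. f y \<partial>M)"
    using assms by (intro emeasure_density) auto
  also have "\<dots> = 0" using assms(2) by (rule nn_integral_null_set)
  finally show ?thesis .
qed

context terminal_reward
begin

text \<open>\<open>terminal_expectation\<close> gives the density
  \<open>exp (\<phi> y) / u 0 0\<close> with respect to the normal law, and testing the total mass
  of \<mu> with the constant 1 forces \<open>Z\<close> to be \<open>u 0 0\<close>.\<close>

lemma solution_law:
  assumes X: "solves 0 0 X" and XT [measurable]: "X\<^sub>T \<in> borel_measurable M"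
    and lim: "AE \<omega> in M. ((\<lambda>t. X t \<omega>) \<longlongrightarrow> X\<^sub>T \<omega>) (at_left T)"
    and \<mu>: "real_distribution \<mu>" and "Z > 0"
    and dens: "\<mu> = density (distr std_normal_distribution borel (\<lambda>z. \<sigma> * sqrt T * z)) (\<lambda>y. ennreal (exp (\<phi> y) / Z))"
  shows "distr M borel X\<^sub>T = \<mu>"
proof (rule real_distribution_eqI[OF _ \<mu>])
  interpret solution_process M F B T \<sigma> K \<phi> 0 0 X
    by unfold_locales (use X T_pos in auto)
  interpret \<mu>: real_distribution \<mu> by (rule \<mu>)
  show "real_distribution (distr M borel X\<^sub>T)" by (rule real_distribution_distr) simp
  have int: "(\<integral>y. h y \<partial>\<mu>) = gauss_smooth (\<sigma> * sqrt T) (\<lambda>y. exp (\<phi> y) * h y) 0 / Z"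
    if [measurable]: "h \<in> borel_measurable borel" for h :: "real \<Rightarrow> real"
  proof -
    have "(\<integral>y. h y \<partial>\<mu>) = (\<integral>y. (exp (\<phi> y) / Z) * h y \<partial>distr std_normal_distribution borel (\<lambda>z. \<sigma> * sqrt T * z))"
      unfolding dens using \<open>Z > 0\<close> by (subst integral_density) auto
    also have "\<dots> = (LINT z|std_normal_distribution. (exp (\<phi> (\<sigma> * sqrt T * z)) / Z) * h (\<sigma> * sqrt T * z))"
      by (subst integral_distr) auto
    also have "\<dots> = gauss_smooth (\<sigma> * sqrt T) (\<lambda>y. exp (\<phi> y) * h y) 0 / Z"
      by (simp add: gauss_smooth_def)
    finally show ?thesis .
  qed
  have Z: "u 0 0 = Z"
    using int[of "\<lambda>_. 1"] \<mu>.prob_space \<open>Z > 0\<close> by (simp add: u_def)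
  fix h :: "real \<Rightarrow> real" assume h: "uniformly_continuous_on UNIV h" "\<And>y. \<bar>h y\<bar> \<le> 1"
  then have [measurable]: "h \<in> borel_measurable borel"
    by (intro borel_measurable_continuous_onI uniformly_continuous_imp_continuous)
  have "(\<integral>y. h y \<partial>distr M borel X\<^sub>T) = (\<integral>\<omega>. h (X\<^sub>T \<omega>) \<partial>M)"
    by (rule integral_distr) auto
  also have "\<dots> = (\<integral>y. h y \<partial>\<mu>)"
    using terminal_expectation[OF XT lim h] by (simp add: int Z)
  finally show "(\<integral>y. h y \<partial>distr M borel X\<^sub>T) = (\<integral>y. h y \<partial>\<mu>)" .
qed

context
  fixes c :: real and R :: "real \<Rightarrow> real \<Rightarrow> real" and \<mu> :: "real measure"
  assumes c_pos: "c > 0" and reward: "\<And>y. rank_reward R \<mu> y = 2 * c * \<sigma>\<^sup>2 * \<phi> y"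
begin

lemma optimal_drift_eq:
  assumes t: "0 \<le> t" "t < T"
  shows "optimal_drift M F B T c \<sigma> R \<mu> t x = drift t x"
proof -
  have "((\<lambda>y. 2 * c * \<sigma>\<^sup>2 * psi t y) has_field_derivative 2 * c * \<sigma>\<^sup>2 * psi_deriv t x) (at x)"
    by (intro DERIV_cmult psi_has_deriv t)
  then have "deriv (\<lambda>y. value_fun M F B T c \<sigma> R \<mu> t y) x = 2 * c * \<sigma>\<^sup>2 * psi_deriv t x"
    unfolding value_fun_eq[where R=R and \<mu>=\<mu>, OF c_pos t reward] by (rule DERIV_imp_deriv)
  then show ?thesis using c_pos by (simp add: optimal_drift_def drift_def)
qed

lemma optimal_drift_integral:
  assumes "0 \<le> t" "t < T"
  shows "(LINT s:{0..t}|lborel. optimal_drift M F B T c \<sigma> R \<mu> s (X s \<omega>)) = (LINT s:{0..t}|lborel. drift s (X s \<omega>))"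
    and "set_integrable lborel {0..t} (\<lambda>s. optimal_drift M F B T c \<sigma> R \<mu> s (X s \<omega>)) \<longleftrightarrow>
      set_integrable lborel {0..t} (\<lambda>s. drift s (X s \<omega>))"
proof -
  have eq: "optimal_drift M F B T c \<sigma> R \<mu> s (X s \<omega>) = drift s (X s \<omega>)" if "s \<in> {0..t}" for s
    using that assms by (intro optimal_drift_eq) auto
  show "(LINT s:{0..t}|lborel. optimal_drift M F B T c \<sigma> R \<mu> s (X s \<omega>)) = (LINT s:{0..t}|lborel. drift s (X s \<omega>))"
    by (rule set_lebesgue_integral_cong) (use eq in auto)
  show "set_integrable lborel {0..t} (\<lambda>s. optimal_drift M F B T c \<sigma> R \<mu> s (X s \<omega>)) \<longleftrightarrow>
      set_integrable lborel {0..t} (\<lambda>s. drift s (X s \<omega>))"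
    by (rule set_integrable_cong[OF refl refl]) (use eq in auto)
qed

lemma optimal_state_imp_solves:
  assumes "optimal_state M F B T c \<sigma> R \<mu> X" shows "solves 0 0 X"
  unfolding solves_def
proof (intro conjI)
  have "AE \<omega> in M. \<forall>t\<in>{0..<T}. X t \<omega> = (LINT s:{0..t}|lborel. optimal_drift M F B T c \<sigma> R \<mu> s (X s \<omega>)) + \<sigma> * B t \<omega>"
    using assms unfolding optimal_state_def by (auto elim: eventually_mono)
  with B_zero show "AE \<omega> in M. \<forall>t\<in>{0..<T}. X t \<omega> = 0 + (LINT s:{0..t}|lborel. drift s (X s \<omega>)) + \<sigma> * (B t \<omega> - B 0 \<omega>)"
    by eventually_elim (auto simp: optimal_drift_integral)
qed (use assms in \<open>auto simp: optimal_state_def\<close>)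

lemma solves_imp_optimal_state:
  assumes X: "solves 0 0 X" shows "optimal_state M F B T c \<sigma> R \<mu> X"
  unfolding optimal_state_def
proof (intro conjI)
  interpret solution_process M F B T \<sigma> K \<phi> 0 0 X
    by unfold_locales (use X T_pos in auto)
  show "AE \<omega> in M. X 0 \<omega> = 0 \<and> (\<forall>t\<in>{0..<T}.
      set_integrable lborel {0..t} (\<lambda>s. optimal_drift M F B T c \<sigma> R \<mu> s (X s \<omega>)) \<and>
      X t \<omega> = (LINT s:{0..t}|lborel. optimal_drift M F B T c \<sigma> R \<mu> s (X s \<omega>)) + \<sigma> * B t \<omega>)"
    using X_equation B_zero AE_space
  proof eventually_elim
    case (elim \<omega>)
    have eq: "X t \<omega> = (LINT s:{0..t}|lborel. drift s (X s \<omega>)) + \<sigma> * B t \<omega>" if "t \<in> {0..<T}" for t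
      using elim(1,2) that by auto
    have "X 0 \<omega> = (LINT s:{0..0}|lborel. drift s (X s \<omega>)) + \<sigma> * B 0 \<omega>" using eq[of 0] T_pos by simp
    then have "X 0 \<omega> = 0" using elim(2) by (simp only: set_lint_singleton)
    then show ?case
      using eq drift_path_integrable(1)[OF elim(3) order_refl] by (auto simp: optimal_drift_integral)
  qed
qed (use X in \<open>auto simp: solves_def\<close>)

text \<open>\<open>solution_law\<close> applies to every solution and every version of its terminal
  limit, so it provides the uniqueness demanded by \<open>terminal_law_map\<close>; existence comes
  from the pathwise construction.\<close>

lemma terminal_law_map_fixed:
  assumes \<mu>: "real_distribution \<mu>" and "Z > 0"
    and dens: "\<mu> = density (distr std_normal_distribution borel (\<lambda>z. \<sigma> * sqrt T * z)) (\<lambda>y. ennreal (exp (\<phi> y) / Z))"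
  shows "terminal_law_map M F B T c \<sigma> R \<mu> = \<mu>"
proof -
  have unique: "\<nu> = \<mu>" if law: "is_terminal_law M F B T c \<sigma> R \<mu> \<nu>" for \<nu>
  proof -
    obtain X X\<^sub>T where "optimal_state M F B T c \<sigma> R \<mu> X" and XT: "X\<^sub>T \<in> borel_measurable M"
      "AE \<omega> in M. ((\<lambda>t. X t \<omega>) \<longlongrightarrow> X\<^sub>T \<omega>) (at_left T)" "\<nu> = distr M borel X\<^sub>T"
      using law unfolding is_terminal_law_def by blast
    from solution_law[OF optimal_state_imp_solves[OF this(1)] XT(1,2) \<mu> \<open>Z > 0\<close> dens] XT(3)
    show ?thesis by simp
  qed
  have exists: "is_terminal_law M F B T c \<sigma> R \<mu> \<mu>"
  proof -
    obtain X where X: "solves 0 0 X" using solution_exists[OF order_refl T_pos] by blast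
    interpret solution_process M F B T \<sigma> K \<phi> 0 0 X
      by unfold_locales (use X T_pos in auto)
    obtain X\<^sub>T where XT: "X\<^sub>T \<in> borel_measurable M" "AE \<omega> in M. ((\<lambda>t. X t \<omega>) \<longlongrightarrow> X\<^sub>T \<omega>) (at_left T)"
      by (rule terminal_state_exists)
    show ?thesis
      unfolding is_terminal_law_def
      using solves_imp_optimal_state[OF X] XT solution_law[OF X XT \<mu> \<open>Z > 0\<close> dens] by metis
  qed
  have "\<exists>!\<nu>. is_terminal_law M F B T c \<sigma> R \<mu> \<nu>" using exists unique by blast
  moreover have "(THE \<nu>. is_terminal_law M F B T c \<sigma> R \<mu> \<nu>) = \<mu>" using exists unique by (rule the_equality)
  ultimately show ?thesis by (simp add: terminal_law_map_def)
qed

end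

end

theorem theorem3p2:
  fixes M :: "'w measure" and F :: "real \<Rightarrow> 'w measure" and B :: "real \<Rightarrow> 'w \<Rightarrow> real"
    and T c \<sigma> :: real and R :: "real \<Rightarrow> real \<Rightarrow> real"
  assumes "brownian_motion M F B"
    and "T > 0" and "c > 0" and "\<sigma> > 0"
    and "bounded ((\<lambda>(x, y). R x y) ` (UNIV \<times> {0..1}))"
    and "continuous_on (UNIV \<times> {0..1}) (\<lambda>(x, y). R x y)"
    and "\<And>y. y \<in> {0..1} \<Longrightarrow> mono (\<lambda>x. R x y)"
    and "\<And>x. mono_on {0..1} (R x)"
  shows "\<exists>\<mu>. real_distribution \<mu> \<and> terminal_law_map M F B T c \<sigma> R \<mu> = \<mu>"
proof -
  define \<gamma> where "\<gamma> = 2 * c * \<sigma>\<^sup>2"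
  have \<gamma>: "\<gamma> > 0" using assms by (simp add: \<gamma>_def)
  obtain C where C: "\<And>x y. y \<in> {0..1} \<Longrightarrow> \<bar>R x y\<bar> \<le> C"
    using assms(5) by (force simp: bounded_iff)
  \<comment> \<open>The law of \<open>\<sigma> * B T\<close>, that is, of the uncontrolled state at
    time \<open>T\<close>.\<close>
  define G where "G = distr std_normal_distribution borel (\<lambda>z. \<sigma> * sqrt T * z)"
  \<comment> \<open>The rank is clamped to \<open>{0..1}\<close>, where \<open>R\<close> is
    continuous and bounded, because the Euler scheme may pass through ranks above 1. On values of a
    distribution function the clamp does nothing.\<close>
  define r where "r x y = exp (R x (max 0 (min 1 y)) / \<gamma>)" for x y
  have st: "\<sigma> * sqrt T > 0" using assms by simp
  have G: "real_distribution G" unfolding G_def by (rule std_normal.real_distribution_distr) simp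
  interpret G: real_distribution G by (rule G)
  have G_null: "{x} \<in> null_sets G" for x
  proof -
    have "emeasure G {x} = emeasure std_normal_distribution {x / (\<sigma> * sqrt T)}"
      unfolding G_def using st by (subst emeasure_distr) (auto intro!: arg_cong2[where f=emeasure] simp: field_simps)
    also have "\<dots> = 0" by (rule emeasure_density_singleton_eq_0) auto
    finally show ?thesis by (simp add: null_sets_def)
  qed
  interpret rank_equation G r "exp (- (C / \<gamma>))" "exp (C / \<gamma>)"
  proof
    show "measure G {x} = 0" for x using G_null[of x] by (simp add: measure_def null_sets_def)
    have "continuous_on UNIV (\<lambda>p. (\<lambda>(x, y). R x y) (fst p, max 0 (min 1 (snd p))))"
      by (rule continuous_on_compose2[OF assms(6)]) (auto intro!: continuous_intros)
    then show "continuous_on UNIV (\<lambda>p. r (fst p) (snd p))"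
      unfolding r_def using \<gamma> by (auto intro!: continuous_intros)
    have "\<bar>R x (max 0 (min 1 y)) / \<gamma>\<bar> \<le> C / \<gamma>" for x y
      using C[of "max 0 (min 1 y)" x] \<gamma> by (simp add: abs_divide divide_right_mono)
    then show "exp (- (C / \<gamma>)) \<le> r x y" "r x y \<le> exp (C / \<gamma>)" for x y
      unfolding r_def exp_le_cancel_iff abs_le_iff by (simp_all add: minus_le_iff)
  qed simp
  obtain \<mu> Z where \<mu>: "real_distribution \<mu>" and Z: "Z > 0"
    and \<mu>_eq: "\<mu> = density G (\<lambda>x. ennreal (r x (cdf \<mu> x) / Z))"
    by (rule fixed_point)
  interpret \<mu>: real_distribution \<mu> by (rule \<mu>)
  define \<phi> where "\<phi> x = rank_reward R \<mu> x / \<gamma>" for x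
  have cdf01: "cdf \<mu> x \<in> {0..1}" for x using \<mu>.cdf_nonneg[of x] \<mu>.cdf_bounded_prob[of x] by simp
  have r_phi: "r x (cdf \<mu> x) = exp (\<phi> x)" for x
    using cdf01[of x] by (simp add: r_def \<phi>_def rank_reward_def)
  have cdf_meas [measurable]: "cdf \<mu> \<in> borel_measurable borel"
    by (rule borel_measurable_mono) (intro monoI \<mu>.cdf_nondecreasing)
  have "emeasure \<mu> {x} = 0" for x
    by (subst \<mu>_eq) (rule emeasure_density_singleton_eq_0[OF _ G_null], unfold G_def, measurable)
  then have cdf_cont: "continuous_on UNIV (cdf \<mu>)"
    by (auto simp: continuous_on_eq_continuous_within \<mu>.isCont_cdf measure_def)
  have phi_cont: "continuous_on UNIV \<phi>"
  proof -
    have "continuous_on UNIV (\<lambda>x. (\<lambda>(x, y). R x y) (x, cdf \<mu> x))"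
      by (rule continuous_on_compose2[OF assms(6)]) (use cdf01 in \<open>auto intro!: continuous_intros cdf_cont\<close>)
    then show ?thesis
      unfolding \<phi>_def rank_reward_def using \<gamma> by (auto intro!: continuous_intros)
  qed
  have phi_mono: "mono \<phi>"
  proof (rule monoI)
    fix x y :: real assume "x \<le> y"
    have "R x (cdf \<mu> x) \<le> R y (cdf \<mu> x)" using monoD[OF assms(7)[OF cdf01[of x]] \<open>x \<le> y\<close>] by simp
    also have "\<dots> \<le> R y (cdf \<mu> y)"
      using mono_onD[OF assms(8) cdf01 cdf01 \<mu>.cdf_nondecreasing[OF \<open>x \<le> y\<close>]] .
    finally show "\<phi> x \<le> \<phi> y" using \<gamma> by (simp add: \<phi>_def rank_reward_def divide_right_mono)
  qed
  have phi_bound: "\<bar>\<phi> x\<bar> \<le> C / \<gamma>" for x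
    using C[OF cdf01[of x], of x] \<gamma> by (simp add: \<phi>_def rank_reward_def abs_divide divide_right_mono)
  interpret terminal_reward M F B T \<sigma> "C / \<gamma>" \<phi>
    by unfold_locales
      (use assms phi_bound bounded_mono_continuous_imp_uniformly_continuous[OF phi_mono phi_cont phi_bound] in auto)
  have "rank_reward R \<mu> y = 2 * c * \<sigma>\<^sup>2 * \<phi> y" for y
    using \<gamma> by (simp add: \<phi>_def flip: \<gamma>_def)
  moreover have "\<mu> = density (distr std_normal_distribution borel (\<lambda>z. \<sigma> * sqrt T * z)) (\<lambda>y. ennreal (exp (\<phi> y) / Z))"
    using \<mu>_eq by (simp add: r_phi G_def)
  ultimately have "terminal_law_map M F B T c \<sigma> R \<mu> = \<mu>"
    using assms(3) \<mu> Z by (intro terminal_law_map_fixed)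
  with \<mu> show ?thesis by blast
qed

end
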